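(* Let $S=(S_t)_{t\ge0}$ be the subordinator with drift $0$ and Lévy measure $$\mu(dt)=\frac23\sum_{n=1}^\infty 2^{3n^2}\min\left\{1,\left(2^{2n^2}t\right)^{-3}\right\}dt\qquad\text{on }(0,\infty),$$ let $B=(B_t)_{t\ge0}$ be a Brownian motion on $\mathbb{R}^d$ with twice the standard speed, independent of $S$, and let $X=(X_t)_{t\ge0}=(B(S_t))_{t\ge0}$. Then $X$ does not satisfy $\mathrm{EHI}$.
   Context: A subordinator is a right-continuous non-decreasing Lévy process $S$ on $[0,\infty)$ with $S_0=0$; drift $0$ and Lévy measure $\mu$ means $\mathbb{E}[e^{-\lambda S_t}]=\exp\left(-t\int_{(0,\infty)}(1-e^{-\lambda u})\,\mu(du)\right)$ for $\lambda,t>0$. "Twice the standard speed" means $B_t-B_0$ has density $(4\pi t)^{-d/2}\exp(-|x|^2/(4t))$. Equivalent description of $S$: with $H_n=2^{n^2}$ and $A_n=2^{-2n^2}$, $S_t=\sum_{n\ge1}\sum_{i=1}^{N^{(n)}_t}A_nY_{n,i}$, where the $N^{(n)}$ are independent Poisson processes with rates $H_n$ and, independently of these, the $Y_{n,i}$ are i.i.d. with density $\frac23$ on $[0,1]$ and $\frac23y^{-3}$ on $[1,\infty)$. $\mathbb{E}_x$ denotes expectation for $X_0=x$; $\tau_U:=\min\{t\ge0:X_t\notin U\}$. A function $h:\mathbb{R}^d\to\mathbb{R}$ is harmonic (with respect to $X$) on an open set $D$ if $h(x)=\mathbb{E}_x[h(X_{\tau_U})]$ for all open $U\Subset D$ and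 all $x$. $X$ satisfies the elliptic Harnack inequality ($\mathrm{EHI}$) if there exist $C\ge1$ and $\kappa\in(0,1)$ such that for all $x_0\in\mathbb{R}^d$, $r>0$, and all $h$ non-negative everywhere and harmonic on the open ball $B(x_0,r)$, one has $C^{-1}h(y)\le h(x)\le Ch(y)$ for all $x,y\in B(x_0,\kappa r)$. *)

theory Defs
  imports "HOL-Probability.Probability"
begin

text \<open>Processes are functions Z with Z t w the value at time t on the outcome w; only the times
  t \<open>\<ge>\<close> 0 matter.  Path properties are required almost surely.\<close>

definition indep_increments ::
  "'a measure \<Rightarrow> (real \<Rightarrow> 'a \<Rightarrow> 'v::euclidean_space) \<Rightarrow> bool" where
  "indep_increments M Z \<longleftrightarrow>
     (\<forall>n (t :: nat \<Rightarrow> real). 0 \<le> t 0 \<and> mono t \<longrightarrow>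
        prob_space.indep_vars M (\<lambda>_. borel) (\<lambda>i w. Z (t (Suc i)) w - Z (t i) w) {..<n})"

definition stationary_increments ::
  "'a measure \<Rightarrow> (real \<Rightarrow> 'a \<Rightarrow> 'v::euclidean_space) \<Rightarrow> bool" where
  "stationary_increments M Z \<longleftrightarrow>
     (\<forall>s\<ge>0. \<forall>t\<ge>0. distr M borel (\<lambda>w. Z (s + t) w - Z s w) = distr M borel (\<lambda>w. Z t w - Z 0 w))"

text \<open>The left limits of a Levy process are not mentioned because they exist for monotone paths.\<close>

definition subordinator :: "'a measure \<Rightarrow> (real \<Rightarrow> 'a \<Rightarrow> real) \<Rightarrow> bool" where
  "subordinator M S \<longleftrightarrow>
     (\<forall>t\<ge>0. S t \<in> borel_measurable M) \<and>
     (AE w in M. S 0 w = 0) \<and>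
     (AE w in M. mono_on {0..} (\<lambda>t. S t w)) \<and>
     (AE w in M. \<forall>t\<ge>0. continuous (at_right t) (\<lambda>s. S s w)) \<and>
     indep_increments M S \<and> stationary_increments M S"

definition zero_drift_Levy_measure ::
  "'a measure \<Rightarrow> (real \<Rightarrow> 'a \<Rightarrow> real) \<Rightarrow> real measure \<Rightarrow> bool" where
  "zero_drift_Levy_measure M S \<mu> \<longleftrightarrow>
     (\<forall>l>0. \<forall>t>0. (\<integral>w. exp (- l * S t w) \<partial>M) =
        exp (- t * (LINT u:{0<..}|\<mu>. 1 - exp (- l * u))))"

text \<open>The n-th summand of the density (n \<open>\<ge>\<close> 1, hence the \<^const>\<open>Suc\<close>) has total mass \<open>2 ^ n\<^sup>2\<close> and
  first moment \<open>2 powi (- n\<^sup>2)\<close>, so \<open>1 - exp (- l * u)\<close> is integrable for every \<open>l > 0\<close>.\<close>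

definition Levy_mu :: "real measure" where
  "Levy_mu = density lborel (\<lambda>t. indicator {0<..} t *
     (ennreal (2 / 3) * (\<Sum>n. ennreal
        (2 ^ (3 * (Suc n)\<^sup>2) * min 1 ((2 ^ (2 * (Suc n)\<^sup>2) * t) powi (- 3))))))"

text \<open>Brownian motion started at x and run at twice the standard speed (generator the Laplacian).\<close>

definition double_speed_BM ::
  "'a measure \<Rightarrow> 'v::euclidean_space \<Rightarrow> (real \<Rightarrow> 'a \<Rightarrow> 'v) \<Rightarrow> bool" where
  "double_speed_BM M x B \<longleftrightarrow>
     (\<forall>t\<ge>0. B t \<in> borel_measurable M) \<and>
     (AE w in M. B 0 w = x) \<and>
     (AE w in M. continuous_on {0..} (\<lambda>t. B t w)) \<and>
     indep_increments M B \<and> stationary_increments M B \<and>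
     (\<forall>t>0. distributed M lborel (\<lambda>w. B t w - B 0 w)
        (\<lambda>z. ennreal ((4 * pi * t) powr (- real DIM('v) / 2) * exp (- (norm z)\<^sup>2 / (4 * t)))))"

text \<open>Independence of the generated \<open>\<sigma>\<close>-algebras; \<^const>\<open>prob_space.indep_var\<close> would force both
  processes to have the same value type.\<close>

definition indep_processes ::
  "'a measure \<Rightarrow> (real \<Rightarrow> 'a \<Rightarrow> 'u::euclidean_space) \<Rightarrow> (real \<Rightarrow> 'a \<Rightarrow> 'v::euclidean_space) \<Rightarrow> bool" where
  "indep_processes M Y Z \<longleftrightarrow>
     prob_space.indep_set M
       (sets (vimage_algebra (space M) (\<lambda>w. \<lambda>t\<in>{0..}. Y t w) (\<Pi>\<^sub>M t\<in>{0..}. borel)))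
       (sets (vimage_algebra (space M) (\<lambda>w. \<lambda>t\<in>{0..}. Z t w) (\<Pi>\<^sub>M t\<in>{0..}. borel)))"

text \<open>The minimum exists if the path is right-continuous and leaves the open set U; otherwise the
  value is an unspecified real.  For the processes and the relatively compact sets considered here
  this exception has probability 0.\<close>

definition exit_time :: "(real \<Rightarrow> 'a \<Rightarrow> 'v::euclidean_space) \<Rightarrow> 'v set \<Rightarrow> 'a \<Rightarrow> real" where
  "exit_time X U w = (LEAST t. 0 \<le> t \<and> X t w \<notin> U)"

text \<open>\<open>P x\<close> is the law under which X starts at x.  The measure is completed because exit times are
  in general measurable only with respect to the completion; integrability says that the
  expectation exists and is finite.\<close>

definition harmonic ::
  "('v \<Rightarrow> 'a measure) \<Rightarrow> (real \<Rightarrow> 'a \<Rightarrow> 'v::euclidean_space) \<Rightarrow> 'v set \<Rightarrow> ('v \<Rightarrow> real) \<Rightarrow> bool" where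
  "harmonic P X D h \<longleftrightarrow>
     (\<forall>U. open U \<and> compact (closure U) \<and> closure U \<subseteq> D \<longrightarrow>
        (\<forall>x. integrable (completion (P x)) (\<lambda>w. h (X (exit_time X U w) w)) \<and>
             h x = (\<integral>w. h (X (exit_time X U w) w) \<partial>completion (P x))))"

definition EHI ::
  "('v \<Rightarrow> 'a measure) \<Rightarrow> (real \<Rightarrow> 'a \<Rightarrow> 'v::euclidean_space) \<Rightarrow> bool" where
  "EHI P X \<longleftrightarrow>
     (\<exists>C \<kappa>. 1 \<le> C \<and> 0 < \<kappa> \<and> \<kappa> < 1 \<and>
        (\<forall>x0 r h. 0 < r \<and> (\<forall>y. 0 \<le> h y) \<and> harmonic P X (ball x0 r) h \<longrightarrow>
           (\<forall>x\<in>ball x0 (\<kappa> * r). \<forall>y\<in>ball x0 (\<kappa> * r). inverse C * h y \<le> h x \<and> h x \<le> C * h y)))"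

end

theory Submission
  imports Defs
begin

text \<open>In the range of lengths between two consecutive space scales \<open>2 powr (- m\<^sup>2)\<close> and
  \<open>2 powr (- (m + 1)\<^sup>2)\<close> of X, the jumps of level \<open>m + 1\<close> average out to a Brownian motion, the jumps of
  level m are so long that they act as killing, and the other levels are negligible.  Around the geometric
  mean of the two scales the suitably rescaled exponent of X tends to \<open>1 + \<xi>\<^sup>2\<close> as m grows, so harmonic
  functions look like solutions of \<open>h'' = h\<close>.  Such functions grow like cosh and violate the Harnack
  inequality on a ball of large rescaled radius r with any prescribed constant.

  To turn this into harmonic functions of X itself, solve \<open>L h = f\<close> for the generator L of X and a function f
  of one coordinate that vanishes on \<open>[- r, r]\<close> and has total mass zero.  Then h is a constant plus a cosine
  transform with density \<open>- F / \<Phi>\<close>, where F is the transform of f and \<open>\<Phi>\<close> the exponent of X, and dominated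
  convergence compares it with the limit problem.  For cosine transforms Dynkin's formula only uses the
  characteristic functions of the increments.  It is applied along dyadic skeletons of the path, stopped on
  leaving closed sets that exhaust U, and quasi-left-continuity carries it over to the exit time of U.\<close>

section \<open>Increments of the subordinated process\<close>

text \<open>Only functions of one coordinate are used, so in every dimension X enters through the
  characteristic functions \<open>exp (- t * \<phi> (\<xi>\<^sup>2))\<close> of one coordinate of
  its increments. The exponent is of order \<xi>^2 near 0, so its reciprocal is not integrable there
  and a positive source alone has no bounded potential; hence the demand that f have total mass
  zero. The resulting h is exactly harmonic for X, and only the estimates of its values pass through
  the limit problem. There the Green function is the density
  \<open>exp (- \<bar>z\<bar>) / 2\<close> of the Laplace law, so a source is felt at distance d
  with strength exp (- d). Whatever disturbs the comparison, namely the compensating source and the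
  error of the limit, must be held to a multiple of exp (- r), the size of h at the centre. Random
  times are approximated by times with finitely many values. There an expectation is a finite sum,
  and independence of increments at fixed times does the work of the strong Markov property.\<close>

lemma (in prob_space) indep_increments_integral_mult:
  fixes Z :: "real \<Rightarrow> 'a \<Rightarrow> 'v::euclidean_space" and G :: "nat \<Rightarrow> 'v \<Rightarrow> real"
  assumes Z: "\<And>t. 0 \<le> t \<Longrightarrow> Z t \<in> borel_measurable M"
    and Z0: "AE w in M. Z 0 w = z"
    and ind: "indep_increments M Z"
    and t: "0 \<le> t 0" "mono t"
    and G [measurable]: "\<And>i. G i \<in> borel_measurable borel"
    and g [measurable]: "g \<in> borel_measurable borel"
    and bd: "\<And>i y. \<bar>G i y\<bar> \<le> 1" "\<And>y. \<bar>g y\<bar> \<le> (1::real)"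
  shows "(LINT w|M. (\<Prod>i\<le>n. G i (Z (t i) w)) * g (Z (t (Suc n)) w - Z (t n) w)) =
    (LINT w|M. (\<Prod>i\<le>n. G i (Z (t i) w))) * (LINT w|M. g (Z (t (Suc n)) w - Z (t n) w))"
proof -
  \<comment> \<open>Prepending time 0 writes each position \<open>Z (t i)\<close> as z plus a
    partial sum of increments. The product is then a function of the increments 0 to n, while g uses
    increment \<open>Suc n\<close>.\<close>
  define s where "s = case_nat 0 t"
  define \<Delta> where "\<Delta> = (\<lambda>i w. Z (s (Suc i)) w - Z (s i) w)"
  have s: "0 \<le> s 0" "mono s"
    using t by (auto simp: s_def mono_iff_le_Suc split: nat.split)
  have s_nn: "0 \<le> s i" for i
    using monoD[OF s(2), of 0 i] s(1) by simp
  have iv: "indep_vars (\<lambda>_. borel) \<Delta> {..<Suc (Suc n)}"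
    using ind s unfolding indep_increments_def \<Delta>_def by blast
  have \<Delta> [measurable]: "\<Delta> i \<in> borel_measurable M" for i
    unfolding \<Delta>_def by (intro borel_measurable_diff Z s_nn)
  define F where "F = (\<lambda>f::nat \<Rightarrow> 'v. \<Prod>i\<le>n. G i (z + (\<Sum>k\<le>i. f k)))"
  define F' where "F' = (\<lambda>f::nat \<Rightarrow> 'v. g (f (Suc n)))"
  have F: "F \<in> borel_measurable (PiM {..n} (\<lambda>_. borel))"
    unfolding F_def
    by (intro borel_measurable_prod measurable_compose[OF _ G] borel_measurable_add
        borel_measurable_sum measurable_component_singleton borel_measurable_const) auto
  have F': "F' \<in> borel_measurable (PiM {Suc n} (\<lambda>_. borel))"
    unfolding F'_def by (intro measurable_compose[OF _ g] measurable_component_singleton) auto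
  have "indep_var (PiM {..n} (\<lambda>_. borel)) (\<lambda>w. restrict (\<lambda>i. \<Delta> i w) {..n})
      (PiM {Suc n} (\<lambda>_. borel)) (\<lambda>w. restrict (\<lambda>i. \<Delta> i w) {Suc n})"
    by (rule indep_var_restrict[OF iv]) auto
  from indep_var_compose[OF this F F']
  have "indep_var borel (\<lambda>w. F (restrict (\<lambda>i. \<Delta> i w) {..n})) borel (\<lambda>w. F' (restrict (\<lambda>i. \<Delta> i w) {Suc n}))"
    by (simp add: comp_def)
  also have "(\<lambda>w. F (restrict (\<lambda>i. \<Delta> i w) {..n})) = (\<lambda>w. \<Prod>i\<le>n. G i (z + (\<Sum>k\<le>i. \<Delta> k w)))"
    unfolding F_def by (intro ext prod.cong refl arg_cong2[where f=G] arg_cong2[where f="(+)"] sum.cong) auto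
  also have "(\<lambda>w. F' (restrict (\<lambda>i. \<Delta> i w) {Suc n})) = (\<lambda>w. g (\<Delta> (Suc n) w))"
    unfolding F'_def by simp
  finally have iv2: "indep_var borel (\<lambda>w. \<Prod>i\<le>n. G i (z + (\<Sum>k\<le>i. \<Delta> k w))) borel (\<lambda>w. g (\<Delta> (Suc n) w))" .
  have bdP: "\<bar>\<Prod>i\<le>n. G i (y i)\<bar> \<le> 1" for y
    unfolding abs_prod using bd(1) by (intro prod_le_1) auto
  have tele: "(\<Sum>k\<le>i. \<Delta> k w) = Z (t i) w - Z 0 w" for i w
    unfolding \<Delta>_def by (induction i) (auto simp: s_def)
  have eq: "AE w in M. (\<Prod>i\<le>n. G i (z + (\<Sum>k\<le>i. \<Delta> k w))) = (\<Prod>i\<le>n. G i (Z (t i) w))"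
    using Z0 by eventually_elim (simp add: tele)
  have \<Delta>n: "\<Delta> (Suc n) w = Z (t (Suc n)) w - Z (t n) w" for w
    by (simp add: \<Delta>_def s_def)
  have tn: "0 \<le> t i" for i using s_nn[of "Suc i"] by (simp add: s_def)
  have Zt [measurable]: "Z (t i) \<in> borel_measurable M" for i by (intro Z tn)
  have "(LINT w|M. (\<Prod>i\<le>n. G i (z + (\<Sum>k\<le>i. \<Delta> k w))) * g (\<Delta> (Suc n) w)) =
     (LINT w|M. (\<Prod>i\<le>n. G i (z + (\<Sum>k\<le>i. \<Delta> k w)))) * (LINT w|M. g (\<Delta> (Suc n) w))"
    by (rule indep_var_lebesgue_integral[OF iv2])
      (auto intro!: integrable_const_bound[where B=1] bdP bd)
  moreover have "(LINT w|M. (\<Prod>i\<le>n. G i (z + (\<Sum>k\<le>i. \<Delta> k w))) * g (\<Delta> (Suc n) w)) =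
     (LINT w|M. (\<Prod>i\<le>n. G i (Z (t i) w)) * g (\<Delta> (Suc n) w))"
    by (rule integral_cong_AE) (use eq in auto)
  moreover have "(LINT w|M. (\<Prod>i\<le>n. G i (z + (\<Sum>k\<le>i. \<Delta> k w)))) = (LINT w|M. (\<Prod>i\<le>n. G i (Z (t i) w)))"
    by (rule integral_cong_AE) (use eq in auto)
  ultimately show ?thesis by (simp add: \<Delta>n)
qed

text \<open>The \<sigma>-algebra to which \<open>indep_processes\<close> refers, named so that
  measurability with respect to it can be stated.\<close>

definition history ::
  "'a measure \<Rightarrow> (real \<Rightarrow> 'a \<Rightarrow> 'u::euclidean_space) \<Rightarrow> 'a measure" where
  "history M Y = vimage_algebra (space M) (\<lambda>w. \<lambda>t\<in>{0..}. Y t w) (\<Pi>\<^sub>M t\<in>{0..}. borel)"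

lemma space_history [simp]: "space (history M Y) = space M"
  by (simp add: history_def)

lemma measurable_history: "0 \<le> t \<Longrightarrow> Y t \<in> borel_measurable (history M Y)"
proof -
  assume t: "0 \<le> t"
  have "(\<lambda>w. (\<lambda>t\<in>{0..}. Y t w) t) \<in> borel_measurable (history M Y)"
    unfolding history_def
    by (intro measurable_compose[OF measurable_vimage_algebra1 measurable_component_singleton])
      (use t in \<open>auto simp: space_PiM split: if_splits\<close>)
  then show ?thesis using t by simp
qed

lemma (in prob_space) indep_processes_integral_mult:
  fixes u v :: "'a \<Rightarrow> real"
  assumes ind: "indep_processes M Y Z"
    and u: "u \<in> borel_measurable (history M Y)" and v: "v \<in> borel_measurable (history M Z)"
    and bd: "\<And>w. \<bar>u w\<bar> \<le> 1" "\<And>w. \<bar>v w\<bar> \<le> 1"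
  shows "(LINT w|M. u w * v w) = (LINT w|M. u w) * (LINT w|M. v w)"
proof -
  have ids: "indep_set (sets (history M Y)) (sets (history M Z))"
    using ind unfolding indep_processes_def history_def .
  have sub: "sets (history M Y) \<subseteq> events" "sets (history M Z) \<subseteq> events"
    using indep_setD_ev1[OF ids] indep_setD_ev2[OF ids] .
  have um [measurable]: "u \<in> borel_measurable M" and vm [measurable]: "v \<in> borel_measurable M"
    using u v sub by (auto simp: measurable_def)
  have sg: "sigma_sets (space M) {f -` A \<inter> space M |A. A \<in> sets borel} \<subseteq> sets (history M W)"
    if "f \<in> borel_measurable (history M W)" for f :: "'a \<Rightarrow> real" and W :: "real \<Rightarrow> 'a \<Rightarrow> 'w::euclidean_space"
    using that sets.sigma_sets_subset[of "{f -` A \<inter> space M |A. A \<in> sets borel}" "history M W"]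
    by (auto simp: measurable_def)
  have "indep_var borel u borel v"
    unfolding indep_var_eq
  proof (intro conjI)
    show "indep_set (sigma_sets (space M) {u -` A \<inter> space M |A. A \<in> sets borel})
        (sigma_sets (space M) {v -` A \<inter> space M |A. A \<in> sets borel})"
      using ids sg[OF u] sg[OF v] unfolding indep_sets2_eq by blast
  qed auto
  then show ?thesis
    by (rule indep_var_lebesgue_integral) (auto intro!: integrable_const_bound[where B=1] bd)
qed

section \<open>Gaussian increments in one coordinate\<close>

lemma integral_cos_std_normal:
  "(LBINT x. cos (a * x) * std_normal_density x) = exp (- a\<^sup>2 / 2)"
  "(LBINT x. sin (a * x) * std_normal_density x) = 0"
proof -
  have int: "integrable lborel (\<lambda>x. std_normal_density x *\<^sub>R iexp (a * x))"
    by (rule Bochner_Integration.integrable_bound[where f=std_normal_density])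
      (auto simp: integrable_normal_density)
  have "char std_normal_distribution a = (LBINT x. std_normal_density x *\<^sub>R iexp (a * x))"
    unfolding char_def
    by (subst integral_density) (auto simp: normal_density_nonneg)
  then have eq: "(LBINT x. std_normal_density x *\<^sub>R iexp (a * x)) = complex_of_real (exp (- (a\<^sup>2) / 2))"
    by (simp add: char_std_normal_distribution)
  show "(LBINT x. cos (a * x) * std_normal_density x) = exp (- a\<^sup>2 / 2)"
    using integral_Re[OF int] eq by (simp add: Re_exp mult.commute)
  show "(LBINT x. sin (a * x) * std_normal_density x) = 0"
    using integral_Im[OF int] eq by (simp add: Im_exp mult.commute)
qed

lemma integral_normal_affine:
  fixes k :: "real \<Rightarrow> real"
  assumes "0 < \<sigma>"
  shows "(LBINT x. k x * normal_density 0 \<sigma> x) = (LBINT x. k (\<sigma> * x) * std_normal_density x)"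
proof -
  have "(LBINT x. k x * normal_density 0 \<sigma> x) =
      \<sigma> *\<^sub>R (LBINT x. k (0 + \<sigma> * x) * normal_density 0 \<sigma> (0 + \<sigma> * x))"
    using assms lborel_integral_real_affine[of \<sigma> "\<lambda>x. k x * normal_density 0 \<sigma> x" 0] by simp
  also have "\<dots> = (LBINT x. k (\<sigma> * x) * std_normal_density x)"
    unfolding integral_scaleR_right[symmetric]
    using assms by (intro Bochner_Integration.integral_cong)
      (auto simp: normal_density_def real_sqrt_mult power_mult_distrib field_simps)
  finally show ?thesis .
qed

lemma gaussian_density_prod:
  fixes z :: "'v::euclidean_space"
  assumes "0 < t"
  shows "(4 * pi * t) powr (- real DIM('v) / 2) * exp (- (norm z)\<^sup>2 / (4 * t)) =
    (\<Prod>b\<in>Basis. normal_density 0 (sqrt (2 * t)) (z \<bullet> b))"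
proof -
  have "(norm z)\<^sup>2 = (\<Sum>b\<in>Basis. (z \<bullet> b)\<^sup>2)"
    unfolding power2_norm_eq_inner by (subst euclidean_inner) (simp add: power2_eq_square)
  then have e: "exp (- (norm z)\<^sup>2 / (4 * t)) = (\<Prod>b\<in>Basis. exp (- (z \<bullet> b)\<^sup>2 / (4 * t)))"
    by (simp add: exp_sum[symmetric] sum_divide_distrib sum_negf)
  have "(4 * pi * t) powr (- real DIM('v) / 2) = ((4 * pi * t) powr (- 1 / 2)) powr real DIM('v)"
    by (simp add: powr_powr)
  also have "\<dots> = ((4 * pi * t) powr (- 1 / 2)) ^ DIM('v)"
    by (rule powr_realpow) (use assms in simp)
  also have "(4 * pi * t) powr (- 1 / 2) = 1 / sqrt (4 * pi * t)"
    using assms by (simp add: powr_minus_divide powr_half_sqrt)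
  also have "(1 / sqrt (4 * pi * t)) ^ DIM('v) = (\<Prod>b\<in>(Basis::'v set). 1 / sqrt (4 * pi * t))"
    by simp
  finally show ?thesis
    unfolding e prod.distrib[symmetric] normal_density_def using assms
    by (simp only: prod.distrib[symmetric]) (intro prod.cong refl, simp add: mult.commute)
qed

text \<open>Fubini for the product density: the coordinates other than b integrate to 1, which
  leaves a normal law of variance 2 t.\<close>

lemma integral_gaussian_coordinate:
  fixes k :: "real \<Rightarrow> real" and b :: "'v::euclidean_space"
  assumes t: "0 < t" and b: "b \<in> Basis"
    and k [measurable]: "k \<in> borel_measurable borel" and bd: "\<And>y. \<bar>k y\<bar> \<le> 1"
  shows "(\<integral>z. (\<Prod>b\<in>Basis. normal_density 0 (sqrt (2 * t)) (z \<bullet> b)) * k (z \<bullet> b) \<partial>(lborel::'v measure)) =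
    (\<integral>x. k x * normal_density 0 (sqrt (2 * t)) x \<partial>lborel)"
proof -
  let ?n = "normal_density 0 (sqrt (2 * t))"
  let ?k = "\<lambda>c x. (if c = b then k x else 1) * ?n x"
  have spos: "0 < sqrt (2 * t)" using t by simp
  interpret product_sigma_finite "\<lambda>_::'v. lborel :: real measure"
    by (simp add: product_sigma_finite_def sigma_finite_lborel)
  have "(\<integral>z. (\<Prod>c\<in>Basis. ?n (z \<bullet> c)) * k (z \<bullet> b) \<partial>(lborel::'v measure)) = (\<integral>z. (\<Prod>c\<in>Basis. ?k c (z \<bullet> c)) \<partial>(lborel::'v measure))"
    using b by (intro Bochner_Integration.integral_cong) (auto simp: prod.distrib prod.If_cases mult.commute prod.delta)
  also have "\<dots> = (\<integral>f. (\<Prod>c\<in>Basis. ?k c ((\<Sum>b\<in>Basis. f b *\<^sub>R b) \<bullet> c)) \<partial>(\<Pi>\<^sub>M b\<in>(Basis::'v set). lborel))"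
    by (subst lborel_eq, subst integral_distr) auto
  also have "\<dots> = (\<integral>f. (\<Prod>c\<in>Basis. ?k c (f c)) \<partial>(\<Pi>\<^sub>M b\<in>(Basis::'v set). lborel))"
    by (intro Bochner_Integration.integral_cong refl prod.cong arg_cong2[where f="?k"])
      (auto simp: inner_sum_left inner_Basis if_distrib[of "\<lambda>u. _ * u"] cong: if_cong)
  also have "\<dots> = (\<Prod>c\<in>Basis. \<integral>x. ?k c x \<partial>lborel)"
  proof (rule product_integral_prod)
    fix c :: 'v
    show "integrable lborel (\<lambda>x. (if c = b then k x else 1) * ?n x)"
      by (rule Bochner_Integration.integrable_bound[where f="?n"])
       (use spos bd in \<open>auto simp: integrable_normal_density normal_density_nonneg abs_mult intro!: mult_left_le_one_le\<close>)
  qed simp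
  also have "\<dots> = (\<Prod>c\<in>Basis. if c = b then \<integral>x. k x * ?n x \<partial>lborel else 1)"
    using spos by (intro prod.cong) auto
  also have "\<dots> = (\<integral>x. k x * ?n x \<partial>lborel)" using b by simp
  finally show ?thesis .
qed

text \<open>The coordinate is centred normal with variance 2 (t - s), and the doubled speed cancels
  the factor 1/2 in the exponent of the normal characteristic function. Equal times are treated
  separately, since the increment then has no density.\<close>

lemma (in prob_space) double_speed_BM_increment:
  fixes B :: "real \<Rightarrow> 'a \<Rightarrow> 'v::euclidean_space"
  assumes B: "double_speed_BM M x B" and st: "0 \<le> s" "s \<le> t" and b: "b \<in> Basis"
  shows "(LINT w|M. cos (a * ((B t w - B s w) \<bullet> b))) = exp (- a\<^sup>2 * (t - s))"
    and "(LINT w|M. sin (a * ((B t w - B s w) \<bullet> b))) = 0"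
proof -
  have Bm: "\<And>t. 0 \<le> t \<Longrightarrow> B t \<in> borel_measurable M" and stat: "stationary_increments M B"
    and D: "\<And>t. 0 < t \<Longrightarrow> distributed M lborel (\<lambda>w. B t w - B 0 w)
        (\<lambda>z. ennreal ((4 * pi * t) powr (- real DIM('v) / 2) * exp (- (norm z)\<^sup>2 / (4 * t))))"
    using B unfolding double_speed_BM_def by auto
  have [measurable]: "B t \<in> borel_measurable M" "B s \<in> borel_measurable M" "B (t - s) \<in> borel_measurable M"
    "B 0 \<in> borel_measurable M"
    using st by (auto intro!: Bm)
  have main: "(LINT w|M. k ((B t w - B s w) \<bullet> b)) = (LBINT y. k (sqrt (2 * (t - s)) * y) * std_normal_density y)"
    if [measurable]: "k \<in> borel_measurable borel" and bd: "\<And>y. \<bar>k y\<bar> \<le> 1" and ts: "s < t" for k :: "real \<Rightarrow> real"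
  proof -
    have ts': "0 < t - s" using ts by simp
    have "distr M borel (\<lambda>w. B (s + (t - s)) w - B s w) = distr M borel (\<lambda>w. B (t - s) w - B 0 w)"
      using stat[unfolded stationary_increments_def, rule_format, of s "t - s"] st by simp
    then have d: "distr M borel (\<lambda>w. B t w - B s w) = distr M borel (\<lambda>w. B (t - s) w - B 0 w)" by simp
    have "(LINT w|M. k ((B t w - B s w) \<bullet> b)) = (\<integral>z. k (z \<bullet> b) \<partial>distr M borel (\<lambda>w. B t w - B s w))"
      by (subst integral_distr) auto
    also have "\<dots> = (LINT w|M. k ((B (t - s) w - B 0 w) \<bullet> b))"
      unfolding d by (subst integral_distr) auto
    also have "\<dots> = (\<integral>z. (\<Prod>b\<in>Basis. normal_density 0 (sqrt (2 * (t - s))) (z \<bullet> b)) * k (z \<bullet> b) \<partial>(lborel::'v measure))"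
      unfolding gaussian_density_prod[OF ts', symmetric]
      by (rule distributed_integral[OF D[OF ts'], of "\<lambda>z. k (z \<bullet> b)", symmetric]) auto
    also have "\<dots> = (LBINT y. k (sqrt (2 * (t - s)) * y) * std_normal_density y)"
      using ts b bd by (subst integral_gaussian_coordinate) (auto intro!: integral_normal_affine)
    finally show ?thesis .
  qed
  show "(LINT w|M. cos (a * ((B t w - B s w) \<bullet> b))) = exp (- a\<^sup>2 * (t - s))"
  proof (cases "s = t")
    case False
    then have ts: "s < t" using st by simp
    show ?thesis
      using main[of "\<lambda>y. cos (a * y)"] integral_cos_std_normal(1)[of "a * sqrt (2 * (t - s))"] ts
      by (simp add: power_mult_distrib mult.assoc)
  qed (simp add: prob_space)
  show "(LINT w|M. sin (a * ((B t w - B s w) \<bullet> b))) = 0"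
  proof (cases "s = t")
    case False
    then have ts: "s < t" using st by simp
    show ?thesis
      using main[of "\<lambda>y. sin (a * y)"] integral_cos_std_normal(2)[of "a * sqrt (2 * (t - s))"] ts
      by (simp add: mult.assoc)
  qed simp
qed

text \<open>The cap \<open>4 ^ m\<close> keeps the range finite: a process can then be evaluated at a rounded random time
  without joint measurability of its paths.\<close>

definition dyadic_up :: "nat \<Rightarrow> real \<Rightarrow> real" where
  "dyadic_up m s = real (min (nat \<lceil>s * 2 ^ m\<rceil>) (4 ^ m)) / 2 ^ m"

lemma dyadic_up_nonneg: "0 \<le> dyadic_up m s"
  by (simp add: dyadic_up_def)

lemma dyadic_up_mono: "s \<le> t \<Longrightarrow> dyadic_up m s \<le> dyadic_up m t"
  unfolding dyadic_up_def
  by (intro divide_right_mono of_nat_mono min.mono nat_mono ceiling_mono mult_right_mono) auto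

lemma dyadic_up_measurable [measurable]: "dyadic_up m \<in> borel_measurable borel"
  unfolding dyadic_up_def by measurable

lemma finite_range_dyadic_up: "finite (range (dyadic_up m))"
  by (rule finite_subset[of _ "(\<lambda>j. real j / 2 ^ m) ` {..4 ^ m}"]) (auto simp: dyadic_up_def)

text \<open>As soon as \<open>2 ^ m\<close> exceeds s, the cap is inactive and rounding up moves s
  by at most \<open>1 / 2 ^ m\<close>.\<close>

lemma dyadic_up_tendsto:
  assumes "0 \<le> s"
  shows "(\<lambda>m. dyadic_up m s) \<longlonglongrightarrow> s"
proof (rule tendsto_sandwich)
  obtain m0 where m0: "s < 2 ^ m0" using real_arch_pow[of 2 s] by auto
  have ge: "\<forall>\<^sub>F m in sequentially. s \<le> dyadic_up m s \<and> dyadic_up m s \<le> s + 1 / 2 ^ m"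
    using eventually_ge_at_top[of m0]
  proof eventually_elim
    case (elim m)
    have "(2::real) ^ m0 \<le> 2 ^ m" by (rule power_increasing) (use elim in auto)
    then have "s \<le> 2 ^ m" using m0 by linarith
    then have "s * 2 ^ m \<le> 2 ^ m * 2 ^ m" by (rule mult_right_mono) simp
    also have "(2::real) ^ m * 2 ^ m = real (4 ^ m)" by (simp flip: power_mult_distrib)
    finally have "\<lceil>s * 2 ^ m\<rceil> \<le> int (4 ^ m)" by (simp add: ceiling_le_iff)
    then have "nat \<lceil>s * 2 ^ m\<rceil> \<le> 4 ^ m" by linarith
    then have eq: "dyadic_up m s = real (nat \<lceil>s * 2 ^ m\<rceil>) / 2 ^ m" by (simp add: dyadic_up_def min_def)
    have "s * 2 ^ m \<le> real (nat \<lceil>s * 2 ^ m\<rceil>)" by linarith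
    moreover have "real (nat \<lceil>s * 2 ^ m\<rceil>) \<le> s * 2 ^ m + 1"
    proof -
      have "0 \<le> s * 2 ^ m" using assms by simp
      then show ?thesis by linarith
    qed
    ultimately show ?case unfolding eq by (simp add: field_simps)
  qed
  show "\<forall>\<^sub>F m in sequentially. s \<le> dyadic_up m s" "\<forall>\<^sub>F m in sequentially. dyadic_up m s \<le> s + 1 / 2 ^ m"
    using ge by (auto elim: eventually_mono)
  show "(\<lambda>m. s + 1 / 2 ^ m) \<longlonglongrightarrow> s"
    using tendsto_add[OF tendsto_const[of s] LIMSEQ_inverse_realpow_zero[of 2]] by (simp add: divide_inverse)
qed simp

text \<open>Besides the continuous functions, this class contains the indicators that express that a skeleton of
  the path has not yet left a closed set.\<close>

definition baire1 :: "('v::euclidean_space \<Rightarrow> real) \<Rightarrow> bool" where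
  "baire1 g \<longleftrightarrow> (\<exists>c. (\<forall>k. continuous_on UNIV (c k)) \<and> (\<forall>k y. \<bar>c k y\<bar> \<le> 1) \<and> (\<forall>y. (\<lambda>k::nat. c k y) \<longlonglongrightarrow> g y))"

lemma baire1_continuous: "continuous_on UNIV g \<Longrightarrow> (\<And>y. \<bar>g y\<bar> \<le> 1) \<Longrightarrow> baire1 g"
  unfolding baire1_def by (rule exI[of _ "\<lambda>_. g"]) auto

lemma baire1_mult:
  assumes "baire1 f" "baire1 g"
  shows "baire1 (\<lambda>y. f y * g y)"
proof -
  obtain c where c: "\<And>k::nat. continuous_on UNIV (c k)" "\<And>k y. \<bar>c k y\<bar> \<le> 1" "\<And>y. (\<lambda>k. c k y) \<longlonglongrightarrow> f y"
    using assms(1) unfolding baire1_def by auto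
  obtain d where d: "\<And>k::nat. continuous_on UNIV (d k)" "\<And>k y. \<bar>d k y\<bar> \<le> 1" "\<And>y. (\<lambda>k. d k y) \<longlonglongrightarrow> g y"
    using assms(2) unfolding baire1_def by auto
  show ?thesis
    unfolding baire1_def using c d
    by (intro exI[of _ "\<lambda>k y. c k y * d k y"])
      (auto intro!: continuous_intros tendsto_mult simp: abs_mult mult_le_one)
qed

lemma baire1_measurable: "baire1 g \<Longrightarrow> g \<in> borel_measurable borel"
  unfolding baire1_def by (metis borel_measurable_LIMSEQ_metric borel_measurable_continuous_onI)

text \<open>Ramps in q of slope k equal 1 on the closed set and are eventually 0 at each point
  outside it. One minus these ramps serves the open complement.\<close>

lemma baire1_indicator:
  fixes q :: "'v::euclidean_space \<Rightarrow> real"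
  assumes q: "continuous_on UNIV q"
  shows "baire1 (indicator {y. e \<le> q y})" "baire1 (indicator {y. q y < e})"
proof -
  define c where "c = (\<lambda>(k::nat) y. max 0 (1 - real k * max 0 (e - q y)))"
  have c1: "continuous_on UNIV (c k)" for k unfolding c_def by (intro continuous_intros q)
  have c2: "0 \<le> c k y" "c k y \<le> 1" for k y unfolding c_def by auto
  have c3: "(\<lambda>k. c k y) \<longlonglongrightarrow> indicator {y. e \<le> q y} y" for y
  proof (cases "e \<le> q y")
    case False
    obtain K where K: "1 / (e - q y) < real K" using reals_Archimedean2 by blast
    have "\<forall>\<^sub>F k in sequentially. c k y = 0"
      using eventually_ge_at_top[of K]
    proof eventually_elim
      case (elim k)
      have "1 < real K * (e - q y)" using K False by (simp add: divide_simps mult.commute)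
      also have "\<dots> \<le> real k * (e - q y)" using elim False by (intro mult_right_mono) auto
      finally show ?case using False by (simp add: c_def)
    qed
    then show ?thesis using False by (simp add: tendsto_eventually)
  qed (simp add: c_def)
  show "baire1 (indicator {y. e \<le> q y})"
    unfolding baire1_def using c1 c2 c3 by (intro exI[of _ c]) auto
  have "(\<lambda>k. 1 - c k y) \<longlonglongrightarrow> indicator {y. q y < e} y" for y
    using tendsto_diff[OF tendsto_const[of 1] c3[of y]] by (auto simp: indicator_def split: if_splits)
  then show "baire1 (indicator {y. q y < e})"
    unfolding baire1_def using c1 c2 by (intro exI[of _ "\<lambda>k y. 1 - c k y"]) (auto intro!: continuous_intros simp: abs_le_iff)
qed

text \<open>The Laplace exponent \<open>\<phi>\<close> is kept abstract. Its value at 0 is a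
  separate assumption because \<open>laplace\<close> covers positive l only, while the frequency
  \<xi> = 0 occurs as well.\<close>

locale subordination = prob_space M for M :: "'a measure" +
  fixes S :: "real \<Rightarrow> 'a \<Rightarrow> real" and B :: "real \<Rightarrow> 'a \<Rightarrow> 'v::euclidean_space"
    and x :: 'v and \<phi> :: "real \<Rightarrow> real"
  assumes S: "subordinator M S" and B: "double_speed_BM M x B" and ind: "indep_processes M S B"
    and laplace: "\<And>l t. 0 < l \<Longrightarrow> 0 < t \<Longrightarrow> (LINT w|M. exp (- l * S t w)) = exp (- t * \<phi> l)"
    and \<phi>_0: "\<phi> 0 = 0"
begin

section \<open>Increments of X from those of S and B\<close>

lemma S_measurable: "0 \<le> t \<Longrightarrow> S t \<in> borel_measurable M"
  and S_start: "AE w in M. S 0 w = 0"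
  and S_mono: "AE w in M. mono_on {0..} (\<lambda>t. S t w)"
  and S_indep: "indep_increments M S"
  and S_stationary: "stationary_increments M S"
  using S unfolding subordinator_def by auto

lemma B_measurable: "0 \<le> t \<Longrightarrow> B t \<in> borel_measurable M"
  and B_start: "AE w in M. B 0 w = x"
  and B_cont: "AE w in M. continuous_on {0..} (\<lambda>t. B t w)"
  and B_indep: "indep_increments M B"
  using B unfolding double_speed_BM_def by auto

lemma S_nonneg: "AE w in M. \<forall>t\<ge>0. 0 \<le> S t w"
  using S_start S_mono by eventually_elim (metis atLeast_iff mono_on_def order_refl)

text \<open>Almost surely the minimum with 1 changes nothing, the increment of S being nonnegative.
  It makes the integrand bounded at every outcome, as the factorisation lemmas demand.\<close>

lemma laplace_increment:
  assumes "0 \<le> s" "s \<le> t" "0 \<le> l"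
  shows "(LINT w|M. min 1 (exp (- l * (S t w - S s w)))) = exp (- (t - s) * \<phi> l)"
proof (cases "l = 0 \<or> s = t")
  case True
  then show ?thesis by (auto simp: \<phi>_0 prob_space)
next
  case False
  then have lt: "0 < l" "0 < t - s" using assms by auto
  have [measurable]: "S t \<in> borel_measurable M" "S s \<in> borel_measurable M" "S (t - s) \<in> borel_measurable M"
    "S 0 \<in> borel_measurable M"
    using assms by (auto intro!: S_measurable)
  have d: "distr M borel (\<lambda>w. S t w - S s w) = distr M borel (\<lambda>w. S (t - s) w - S 0 w)"
    using S_stationary[unfolded stationary_increments_def, rule_format, of s "t - s"] assms by simp
  have "(LINT w|M. min 1 (exp (- l * (S t w - S s w)))) = (\<integral>y. min 1 (exp (- l * y)) \<partial>distr M borel (\<lambda>w. S t w - S s w))"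
    by (subst integral_distr) auto
  also have "\<dots> = (LINT w|M. min 1 (exp (- l * (S (t - s) w - S 0 w))))"
    unfolding d by (subst integral_distr) auto
  also have "\<dots> = (LINT w|M. exp (- l * S (t - s) w))"
  proof (rule integral_cong_AE)
    show "AE w in M. min 1 (exp (- l * (S (t - s) w - S 0 w))) = exp (- l * S (t - s) w)"
      using S_start S_nonneg
    proof eventually_elim
      case (elim w)
      have "0 \<le> S (t - s) w" by (rule elim(2)[rule_format]) (use lt in simp)
      then have "0 \<le> l * S (t - s) w" using lt(1) by simp
      then show ?case unfolding elim(1) by (simp add: min_absorb2)
    qed
  qed auto
  also have "\<dots> = exp (- (t - s) * \<phi> l)" by (rule laplace) (use lt in auto)
  finally show ?thesis .
qed

text \<open>The readings of the rounded clock as one random list. It takes finitely many values, so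
  fixing it costs only a finite sum.\<close>

definition grid_times :: "nat \<Rightarrow> (nat \<Rightarrow> real) \<Rightarrow> nat \<Rightarrow> 'a \<Rightarrow> real list" where
  "grid_times m T n w = map (\<lambda>i. dyadic_up m (S (T i) w)) [0..<n]"

lemma grid_times_nth: "i < n \<Longrightarrow> grid_times m T n w ! i = dyadic_up m (S (T i) w)"
  by (simp add: grid_times_def)

definition grid_lists :: "nat \<Rightarrow> nat \<Rightarrow> real list set" where
  "grid_lists m n = {a. set a \<subseteq> range (dyadic_up m) \<and> length a = n}"

lemma finite_grid_lists: "finite (grid_lists m n)"
  unfolding grid_lists_def by (intro finite_lists_length_eq finite_range_dyadic_up)

lemma grid_times_in: "grid_times m T n w \<in> grid_lists m n"
  by (auto simp: grid_lists_def grid_times_def)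

lemma grid_times_eq_iff:
  "a \<in> grid_lists m n \<Longrightarrow> grid_times m T n w = a \<longleftrightarrow> (\<forall>i<n. dyadic_up m (S (T i) w) = a ! i)"
  by (auto simp: grid_lists_def grid_times_def list_eq_iff_nth_eq)

lemma grid_event_eq:
  "a \<in> grid_lists m n \<Longrightarrow> indicator {w. grid_times m T n w = a} w =
    (\<Prod>i<n. indicator {y. dyadic_up m y = a ! i} (S (T i) w) :: real)"
  by (auto simp: grid_times_eq_iff indicator_def intro!: prod.neutral[symmetric] prod_zero)

text \<open>The expectation is split according to the value a of the rounded clock. On each piece
  the event and u depend on S alone and \<open>v a\<close> on B alone, so independence of the two
  processes factorises the integral.\<close>

lemma integral_grid_decouple:
  fixes u :: "'a \<Rightarrow> real" and v :: "real list \<Rightarrow> 'a \<Rightarrow> real"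
  assumes T: "\<And>i. 0 \<le> T i"
    and u: "u \<in> borel_measurable (history M S)" "\<And>w. \<bar>u w\<bar> \<le> 1"
    and v: "\<And>a. a \<in> grid_lists m n \<Longrightarrow> v a \<in> borel_measurable (history M B)" "\<And>a w. \<bar>v a w\<bar> \<le> 1"
  shows "(LINT w|M. u w * v (grid_times m T n w) w) =
    (\<Sum>a\<in>grid_lists m n. (LINT w|M. indicator {w. grid_times m T n w = a} w * u w) * (LINT w|M. v a w))"
proof -
  let ?I = "\<lambda>a w. indicator {w. grid_times m T n w = a} w :: real"
  have Im: "?I a \<in> borel_measurable (history M S)" if "a \<in> grid_lists m n" for a
  proof -
    have "(\<lambda>w. \<Prod>i<n. indicator {y. dyadic_up m y = a ! i} (S (T i) w) :: real) \<in> borel_measurable (history M S)"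
      by (intro borel_measurable_prod measurable_compose[OF measurable_history[OF T]]) measurable
    then show ?thesis by (simp add: grid_event_eq[OF that])
  qed
  have sub: "sets (history M S) \<subseteq> sets M" "sets (history M B) \<subseteq> sets M"
    using ind unfolding indep_processes_def history_def[symmetric] indep_sets2_eq by auto
  have toM: "f \<in> borel_measurable M" if "f \<in> borel_measurable (history M S) \<or> f \<in> borel_measurable (history M B)" for f :: "'a \<Rightarrow> real"
    using that sub by (auto simp: measurable_def)
  have sum_eq: "u w * v (grid_times m T n w) w = (\<Sum>a\<in>grid_lists m n. (?I a w * u w) * v a w)" for w
  proof -
    have "(\<Sum>a\<in>grid_lists m n. (?I a w * u w) * v a w) =
        (\<Sum>a\<in>grid_lists m n. if a = grid_times m T n w then u w * v a w else 0)"
      by (intro sum.cong) (auto simp: indicator_def)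
    then show ?thesis using finite_grid_lists grid_times_in by simp
  qed
  have uI: "(\<lambda>w. ?I a w * u w) \<in> borel_measurable (history M S)" "\<bar>?I a w * u w\<bar> \<le> 1" if "a \<in> grid_lists m n" for a w
    using Im[OF that] u by (auto simp: indicator_def)
  have "(LINT w|M. u w * v (grid_times m T n w) w) = (LINT w|M. (\<Sum>a\<in>grid_lists m n. (?I a w * u w) * v a w))"
    by (simp add: sum_eq)
  also have "\<dots> = (\<Sum>a\<in>grid_lists m n. \<integral>w. (?I a w * u w) * v a w \<partial>M)"
  proof (rule Bochner_Integration.integral_sum)
    fix a assume a: "a \<in> grid_lists m n"
    have "(\<lambda>w. ?I a w * u w * v a w) \<in> borel_measurable M"
      using uI(1)[OF a] v(1)[OF a] by (intro borel_measurable_times toM) auto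
    moreover have "\<bar>?I a w * u w * v a w\<bar> \<le> 1" for w
      unfolding abs_mult[of _ "v a w"] using uI(2)[OF a] v(2) by (intro mult_le_one) auto
    ultimately show "integrable M (\<lambda>w. ?I a w * u w * v a w)"
      by (intro integrable_const_bound[where B=1]) auto
  qed
  also have "\<dots> = (\<Sum>a\<in>grid_lists m n. (LINT w|M. ?I a w * u w) * (LINT w|M. v a w))"
    by (intro sum.cong refl indep_processes_integral_mult[OF ind] uI v)
  finally show ?thesis .
qed

lemma B_history: "0 \<le> t \<Longrightarrow> B t \<in> borel_measurable (history M B)"
  by (rule measurable_history)

lemma grid_nth_nonneg: "a \<in> grid_lists m n \<Longrightarrow> i < n \<Longrightarrow> 0 \<le> a ! i"
  unfolding grid_lists_def using dyadic_up_nonneg by (force dest: nth_mem)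

lemma grid_process_measurable:
  assumes "0 \<le> t"
  shows "(\<lambda>w. B (dyadic_up m (S t w)) w) \<in> borel_measurable M"
proof -
  have St [measurable]: "S t \<in> borel_measurable M" using assms by (rule S_measurable)
  have [measurable]: "(\<lambda>w. min (nat \<lceil>S t w * 2 ^ m\<rceil>) (4 ^ m)) \<in> measurable M (count_space UNIV)"
    by measurable
  show ?thesis
    unfolding dyadic_up_def
    by (rule measurable_compose_countable[of "\<lambda>j w. B (real j / 2 ^ m) w"]) (auto intro!: B_measurable)
qed

text \<open>Cosine and sine are treated together: k is one of them, and q is 1 or 0 accordingly. The
  bounds by 1 are what the factorisation lemmas and dominated convergence ask for.\<close>

context
  fixes T :: "nat \<Rightarrow> real" and g :: "nat \<Rightarrow> 'v \<Rightarrow> real" and n :: nat and b :: 'v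
    and k :: "real \<Rightarrow> real" and \<xi> q :: real
  assumes T: "0 \<le> T 0" "mono T"
    and g: "\<And>i. continuous_on UNIV (g i)" "\<And>i y. \<bar>g i y\<bar> \<le> 1"
    and k: "continuous_on UNIV k" "\<And>y. \<bar>k y\<bar> \<le> 1" and q: "\<bar>q\<bar> \<le> 1"
    and kB: "\<And>s t. 0 \<le> s \<Longrightarrow> s \<le> t \<Longrightarrow>
      (LINT w|M. k (\<xi> * ((B t w - B s w) \<bullet> b))) = q * exp (- \<xi>\<^sup>2 * (t - s))"
begin

lemma T_nonneg: "0 \<le> T i"
  using monoD[OF T(2), of 0 i] T(1) by simp

lemma g_measurable: "g i \<in> borel_measurable borel"
  using g(1) by (rule borel_measurable_continuous_onI)

lemma k_measurable: "k \<in> borel_measurable borel"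
  using k(1) by (rule borel_measurable_continuous_onI)

lemma prod_g_bound: "\<bar>\<Prod>i\<in>I. g i (y i)\<bar> \<le> 1"
  unfolding abs_prod using g(2) by (intro prod_le_1) auto

lemma grid_mono:
  "AE w in M. \<forall>j<n'. \<forall>i\<le>j. grid_times m T n' w ! i \<le> grid_times m T n' w ! j"
  using S_mono
proof eventually_elim
  case (elim w)
  have "S (T i) w \<le> S (T j) w" if "i \<le> j" for i j
    using elim T_nonneg monoD[OF T(2) that] by (auto simp: mono_on_def)
  then show ?case by (auto simp: grid_times_nth dyadic_up_mono)
qed

text \<open>With the clock frozen at a list of readings, the last increment of B is independent of
  the earlier positions and has a Gaussian characteristic function in the elapsed clock time. Lists
  with a decrease have probability zero.\<close>

lemma subordinate_step_time:
  "(LINT w|M. (\<Prod>i\<le>n. g i (B (dyadic_up m (S (T i) w)) w)) *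
      k (\<xi> * ((B (dyadic_up m (S (T (Suc n)) w)) w - B (dyadic_up m (S (T n) w)) w) \<bullet> b))) =
   (LINT w|M. (\<Prod>i\<le>n. g i (B (dyadic_up m (S (T i) w)) w)) *
      (q * min 1 (exp (- \<xi>\<^sup>2 * (dyadic_up m (S (T (Suc n)) w) - dyadic_up m (S (T n) w))))))"
proof -
  let ?N = "Suc (Suc n)"
  define v where "v = (\<lambda>(a::real list) w. (\<Prod>i\<le>n. g i (B (a ! i) w)) * k (\<xi> * ((B (a ! Suc n) w - B (a ! n) w) \<bullet> b)))"
  define v' where "v' = (\<lambda>(a::real list) w. (\<Prod>i\<le>n. g i (B (a ! i) w)) * (q * min 1 (exp (- \<xi>\<^sup>2 * (a ! Suc n - a ! n)))))"
  have bv: "\<bar>v a w\<bar> \<le> 1" for a w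
    unfolding v_def abs_mult using prod_g_bound k by (intro mult_le_one) auto
  have bv': "\<bar>v' a w\<bar> \<le> 1" for a w
    unfolding v'_def abs_mult using prod_g_bound q by (intro mult_le_one) (auto simp: abs_mult)
  have Bm: "B (a ! i) \<in> borel_measurable (history M B)" if "a \<in> grid_lists m ?N" "i < ?N" for a i
    using grid_nth_nonneg[OF that] by (rule B_history)
  have mP: "(\<lambda>w. \<Prod>i\<le>n. g i (B (a ! i) w)) \<in> borel_measurable (history M B)" if "a \<in> grid_lists m ?N" for a
    by (intro borel_measurable_prod measurable_compose[OF _ g_measurable] Bm[OF that]) auto
  have mv: "v a \<in> borel_measurable (history M B)" if "a \<in> grid_lists m ?N" for a
    unfolding v_def
    by (intro borel_measurable_times mP that measurable_compose[OF _ k_measurable] borel_measurable_const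
      borel_measurable_inner borel_measurable_diff Bm[OF that]) auto
  have mv': "v' a \<in> borel_measurable (history M B)" if "a \<in> grid_lists m ?N" for a
    unfolding v'_def by (intro borel_measurable_times mP that borel_measurable_const)
  have eq: "(LINT w|M. indicator {w. grid_times m T ?N w = a} w * (1::real)) * (LINT w|M. v a w) =
      (LINT w|M. indicator {w. grid_times m T ?N w = a} w * (1::real)) * (LINT w|M. v' a w)"
    if a: "a \<in> grid_lists m ?N" for a
  proof (cases "\<forall>j<?N. \<forall>i\<le>j. a ! i \<le> a ! j")
    case True
    \<comment> \<open>The list is continued by its last entry, because independence of increments is
      stated for infinite monotone sequences of times.\<close>
    define t where "t = (\<lambda>i. a ! (min i (Suc n)))"
    have t: "0 \<le> t 0" "mono t"
      using grid_nth_nonneg[OF a] True by (auto simp: t_def mono_def)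
    have tn: "t n = a ! n" "t (Suc n) = a ! Suc n" by (auto simp: t_def)
    have ti: "(\<Prod>i\<le>n. g i (B (a ! i) w)) = (\<Prod>i\<le>n. g i (B (t i) w))" for w
      by (intro prod.cong) (auto simp: t_def)
    have "(LINT w|M. v a w) = (LINT w|M. (\<Prod>i\<le>n. g i (B (t i) w))) * (LINT w|M. k (\<xi> * ((B (t (Suc n)) w - B (t n) w) \<bullet> b)))"
      unfolding v_def ti unfolding tn[symmetric]
      by (rule indep_increments_integral_mult[OF B_measurable B_start B_indep t g_measurable _ g(2) k(2)])
        (auto intro!: measurable_compose[OF _ k_measurable])
    also have "\<dots> = (LINT w|M. (\<Prod>i\<le>n. g i (B (t i) w))) * (q * exp (- \<xi>\<^sup>2 * (a ! Suc n - a ! n)))"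
      using kB[of "a ! n" "a ! Suc n"] grid_nth_nonneg[OF a, of n] True by (simp add: tn)
    also have "\<dots> = (LINT w|M. v' a w)"
    proof -
      have "0 \<le> \<xi>\<^sup>2 * (a ! Suc n - a ! n)" using True by simp
      then have "min 1 (exp (- \<xi>\<^sup>2 * (a ! Suc n - a ! n))) = exp (- \<xi>\<^sup>2 * (a ! Suc n - a ! n))"
        by (intro min_absorb2) simp
      then show ?thesis by (simp add: v'_def ti)
    qed
    finally show ?thesis by simp
  next
    case False
    have "(LINT w|M. indicator {w. grid_times m T ?N w = a} w * (1::real)) = 0"
    proof (rule integral_eq_zero_AE)
      show "AE w in M. indicator {w. grid_times m T ?N w = a} w * (1::real) = 0"
        using grid_mono by eventually_elim (use False in \<open>auto simp: indicator_def\<close>)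
    qed
    then show ?thesis by simp
  qed
  have "(LINT w|M. 1 * v (grid_times m T ?N w) w) = (LINT w|M. 1 * v' (grid_times m T ?N w) w)"
    using integral_grid_decouple[of T "\<lambda>_. 1" m ?N v, OF T_nonneg _ _ mv bv]
      integral_grid_decouple[of T "\<lambda>_. 1" m ?N v', OF T_nonneg _ _ mv' bv']
    by (simp only: eq cong: sum.cong) simp
  then show ?thesis
    by (simp add: v_def v'_def grid_times_nth del: upt_Suc)
qed

text \<open>Here the last increment of S is not rounded: its Laplace transform is known exactly and
  it is independent of the earlier readings, both of which rounding would destroy. Only the
  positions of B still see the rounded clock.\<close>

lemma subordinate_step_laplace:
  "(LINT w|M. (\<Prod>i\<le>n. g i (B (dyadic_up m (S (T i) w)) w)) *
      (min 1 (exp (- \<xi>\<^sup>2 * (S (T (Suc n)) w - S (T n) w))))) =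
   exp (- (T (Suc n) - T n) * \<phi> (\<xi>\<^sup>2)) * (LINT w|M. (\<Prod>i\<le>n. g i (B (dyadic_up m (S (T i) w)) w)))"
proof -
  let ?N = "Suc n" and ?e = "\<lambda>y. min 1 (exp (- \<xi>\<^sup>2 * y))"
  define v where "v = (\<lambda>(a::real list) w. (\<Prod>i\<le>n. g i (B (a ! i) w)))"
  have bv: "\<bar>v a w\<bar> \<le> 1" for a w
    unfolding v_def by (rule prod_g_bound)
  have mv: "v a \<in> borel_measurable (history M B)" if "a \<in> grid_lists m ?N" for a
    unfolding v_def using grid_nth_nonneg[OF that]
    by (intro borel_measurable_prod measurable_compose[OF _ g_measurable] B_history) auto
  have Sm: "S (T i) \<in> borel_measurable (history M S)" for i by (rule measurable_history[OF T_nonneg])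
  have mu: "(\<lambda>w. ?e (S (T (Suc n)) w - S (T n) w)) \<in> borel_measurable (history M S)"
    by (intro measurable_compose[OF borel_measurable_diff[OF Sm Sm]]) measurable
  have bu: "\<bar>?e y\<bar> \<le> 1" for y by auto
  have eq: "(LINT w|M. indicator {w. grid_times m T ?N w = a} w * ?e (S (T (Suc n)) w - S (T n) w)) =
    exp (- (T (Suc n) - T n) * \<phi> (\<xi>\<^sup>2)) * (LINT w|M. indicator {w. grid_times m T ?N w = a} w * (1::real))"
    if a: "a \<in> grid_lists m ?N" for a
  proof -
    let ?G = "\<lambda>i. indicator {y. dyadic_up m y = a ! i} :: real \<Rightarrow> real"
    have "(LINT w|M. (\<Prod>i\<le>n. ?G i (S (T i) w)) * ?e (S (T (Suc n)) w - S (T n) w)) =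
      (LINT w|M. (\<Prod>i\<le>n. ?G i (S (T i) w))) * (LINT w|M. ?e (S (T (Suc n)) w - S (T n) w))"
      by (rule indep_increments_integral_mult[OF S_measurable S_start S_indep T _ _ _ bu]) (auto simp: indicator_def)
    also have "(LINT w|M. ?e (S (T (Suc n)) w - S (T n) w)) = exp (- (T (Suc n) - T n) * \<phi> (\<xi>\<^sup>2))"
      by (rule laplace_increment) (use T_nonneg monoD[OF T(2), of n "Suc n"] in auto)
    finally show ?thesis by (simp add: grid_event_eq[OF a] lessThan_Suc_atMost)
  qed
  have e1: "(LINT w|M. ?e (S (T (Suc n)) w - S (T n) w) * v (grid_times m T ?N w) w) =
     exp (- (T (Suc n) - T n) * \<phi> (\<xi>\<^sup>2)) * (LINT w|M. 1 * v (grid_times m T ?N w) w)"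
    using integral_grid_decouple[of T "\<lambda>_. 1" m ?N v, OF T_nonneg _ _ mv bv]
      integral_grid_decouple[of T "\<lambda>w. ?e (S (T (Suc n)) w - S (T n) w)" m ?N v, OF T_nonneg mu bu mv bv]
    by (simp only: eq cong: sum.cong) (simp add: sum_distrib_left mult.assoc)
  have v: "v (grid_times m T ?N w) w = (\<Prod>i\<le>n. g i (B (dyadic_up m (S (T i) w)) w))" for w
    unfolding v_def by (intro prod.cong) (auto simp: grid_times_nth simp del: upt_Suc)
  show ?thesis using e1 by (simp add: v mult.commute)
qed

lemma grid_process_tendsto: "AE w in M. \<forall>t\<ge>0. (\<lambda>m. B (dyadic_up m (S t w)) w) \<longlonglongrightarrow> B (S t w) w"
  using B_cont S_nonneg
proof eventually_elim
  case (elim w)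
  show ?case
  proof (intro allI impI)
    fix t :: real assume t: "0 \<le> t"
    show "(\<lambda>m. B (dyadic_up m (S t w)) w) \<longlonglongrightarrow> B (S t w) w"
      by (rule continuous_on_tendsto_compose[OF elim(1) dyadic_up_tendsto])
        (use elim t dyadic_up_nonneg in auto)
  qed
qed

text \<open>Both one-step identities pass to the limit of fine rounding, by continuity of B and
  dominated convergence. In the limit the right side of the first is q times the left side of the
  second, so they can be chained.\<close>

lemma subordinate_increment_continuous:
  fixes X :: "real \<Rightarrow> 'a \<Rightarrow> 'v"
  assumes X: "\<And>t. 0 \<le> t \<Longrightarrow> X t \<in> borel_measurable M" "AE w in M. \<forall>t\<ge>0. X t w = B (S t w) w"
  shows "(LINT w|M. (\<Prod>i\<le>n. g i (X (T i) w)) * k (\<xi> * ((X (T (Suc n)) w - X (T n) w) \<bullet> b))) =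
    q * exp (- (T (Suc n) - T n) * \<phi> (\<xi>\<^sup>2)) * (LINT w|M. (\<Prod>i\<le>n. g i (X (T i) w)))"
proof -
  let ?Z = "\<lambda>m t w. B (dyadic_up m (S t w)) w"
  let ?e = "\<lambda>y. min 1 (exp (- \<xi>\<^sup>2 * y))"
  note [measurable] = X(1)[OF T_nonneg] S_measurable[OF T_nonneg] grid_process_measurable[OF T_nonneg]
    g_measurable k_measurable
  have lim: "AE w in M. \<forall>i. (\<lambda>m. ?Z m (T i) w) \<longlonglongrightarrow> X (T i) w"
    using grid_process_tendsto X(2) by eventually_elim (use T_nonneg in auto)
  have gl: "(\<lambda>m. g i (y m)) \<longlonglongrightarrow> g i z" if "y \<longlonglongrightarrow> z" for i y z
    using continuous_on_tendsto_compose[OF g(1) that] by simp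
  have kl: "(\<lambda>m. k (y m)) \<longlonglongrightarrow> k z" if "y \<longlonglongrightarrow> z" for y z
    using continuous_on_tendsto_compose[OF k(1) that] by simp
  have b1: "\<bar>(\<Prod>i\<le>n. g i (y i)) * z\<bar> \<le> 1" if "\<bar>z\<bar> \<le> 1" for y z
    unfolding abs_mult using prod_g_bound that by (intro mult_le_one) auto
  have qe: "\<bar>q * min 1 (exp z)\<bar> \<le> 1" for z
    unfolding abs_mult using q by (intro mult_le_one) auto
  have L1: "(\<lambda>m. \<integral>w. (\<Prod>i\<le>n. g i (?Z m (T i) w)) * k (\<xi> * ((?Z m (T (Suc n)) w - ?Z m (T n) w) \<bullet> b)) \<partial>M)
      \<longlonglongrightarrow> (LINT w|M. (\<Prod>i\<le>n. g i (X (T i) w)) * k (\<xi> * ((X (T (Suc n)) w - X (T n) w) \<bullet> b)))"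
  proof (rule integral_dominated_convergence[where w="\<lambda>_. 1"])
    show "AE w in M. (\<lambda>m. (\<Prod>i\<le>n. g i (?Z m (T i) w)) * k (\<xi> * ((?Z m (T (Suc n)) w - ?Z m (T n) w) \<bullet> b)))
       \<longlonglongrightarrow> (\<Prod>i\<le>n. g i (X (T i) w)) * k (\<xi> * ((X (T (Suc n)) w - X (T n) w) \<bullet> b))"
      using lim by eventually_elim (intro tendsto_intros tendsto_prod gl kl, auto)
  qed (auto intro!: b1 k(2))
  have L2: "(\<lambda>m. \<integral>w. (\<Prod>i\<le>n. g i (?Z m (T i) w)) * (q * ?e (dyadic_up m (S (T (Suc n)) w) - dyadic_up m (S (T n) w))) \<partial>M)
      \<longlonglongrightarrow> (LINT w|M. (\<Prod>i\<le>n. g i (X (T i) w)) * (q * ?e (S (T (Suc n)) w - S (T n) w)))"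
  proof (rule integral_dominated_convergence[where w="\<lambda>_. 1"])
    show "AE w in M. (\<lambda>m. (\<Prod>i\<le>n. g i (?Z m (T i) w)) * (q * ?e (dyadic_up m (S (T (Suc n)) w) - dyadic_up m (S (T n) w))))
       \<longlonglongrightarrow> (\<Prod>i\<le>n. g i (X (T i) w)) * (q * ?e (S (T (Suc n)) w - S (T n) w))"
      using lim S_nonneg
      by eventually_elim (intro tendsto_intros tendsto_prod tendsto_min gl dyadic_up_tendsto, auto simp: T_nonneg)
  qed (auto intro!: b1 qe)
  have L3: "(\<lambda>m. \<integral>w. (\<Prod>i\<le>n. g i (?Z m (T i) w)) * ?e (S (T (Suc n)) w - S (T n) w) \<partial>M)
      \<longlonglongrightarrow> (LINT w|M. (\<Prod>i\<le>n. g i (X (T i) w)) * ?e (S (T (Suc n)) w - S (T n) w))"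
  proof (rule integral_dominated_convergence[where w="\<lambda>_. 1"])
    show "AE w in M. (\<lambda>m. (\<Prod>i\<le>n. g i (?Z m (T i) w)) * ?e (S (T (Suc n)) w - S (T n) w))
       \<longlonglongrightarrow> (\<Prod>i\<le>n. g i (X (T i) w)) * ?e (S (T (Suc n)) w - S (T n) w)"
      using lim by eventually_elim (intro tendsto_intros tendsto_prod gl, auto)
  qed (auto intro!: b1)
  have L4: "(\<lambda>m. \<integral>w. (\<Prod>i\<le>n. g i (?Z m (T i) w)) \<partial>M) \<longlonglongrightarrow> (LINT w|M. (\<Prod>i\<le>n. g i (X (T i) w)))"
  proof (rule integral_dominated_convergence[where w="\<lambda>_. 1"])
    show "AE w in M. (\<lambda>m. (\<Prod>i\<le>n. g i (?Z m (T i) w))) \<longlonglongrightarrow> (\<Prod>i\<le>n. g i (X (T i) w))"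
      using lim by eventually_elim (intro tendsto_prod gl, auto)
  qed (auto intro!: prod_g_bound)
  have E1: "(LINT w|M. (\<Prod>i\<le>n. g i (X (T i) w)) * k (\<xi> * ((X (T (Suc n)) w - X (T n) w) \<bullet> b))) =
      (LINT w|M. (\<Prod>i\<le>n. g i (X (T i) w)) * (q * ?e (S (T (Suc n)) w - S (T n) w)))"
    using LIMSEQ_unique[OF L1 L2[folded subordinate_step_time]] .
  have E2: "(LINT w|M. (\<Prod>i\<le>n. g i (X (T i) w)) * ?e (S (T (Suc n)) w - S (T n) w)) =
      exp (- (T (Suc n) - T n) * \<phi> (\<xi>\<^sup>2)) * (LINT w|M. (\<Prod>i\<le>n. g i (X (T i) w)))"
    using LIMSEQ_unique[OF L3[unfolded subordinate_step_laplace] tendsto_mult_left[OF L4]] .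
  show ?thesis
    unfolding E1 using E2 by (simp add: mult.left_commute[of _ q] mult.assoc)
qed

end


lemma subordinate_increment_baire1:
  fixes X :: "real \<Rightarrow> 'a \<Rightarrow> 'v"
  assumes X: "\<And>t. 0 \<le> t \<Longrightarrow> X t \<in> borel_measurable M" "AE w in M. \<forall>t\<ge>0. X t w = B (S t w) w"
    and T: "0 \<le> T 0" "mono T" and g: "\<And>i. baire1 (g i)"
    and k: "continuous_on UNIV k" "\<And>y. \<bar>k y\<bar> \<le> 1" and q: "\<bar>q\<bar> \<le> 1"
    and kB: "\<And>s t. 0 \<le> s \<Longrightarrow> s \<le> t \<Longrightarrow>
      (LINT w|M. k (\<xi> * ((B t w - B s w) \<bullet> b))) = q * exp (- \<xi>\<^sup>2 * (t - s))"
  shows "(LINT w|M. (\<Prod>i\<le>n. g i (X (T i) w)) * k (\<xi> * ((X (T (Suc n)) w - X (T n) w) \<bullet> b))) =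
    q * exp (- (T (Suc n) - T n) * \<phi> (\<xi>\<^sup>2)) * (LINT w|M. (\<Prod>i\<le>n. g i (X (T i) w)))"
proof -
  have "\<forall>i. \<exists>c. (\<forall>j. continuous_on UNIV (c j)) \<and> (\<forall>j y. \<bar>c j y\<bar> \<le> 1) \<and> (\<forall>y. (\<lambda>j::nat. c j y) \<longlonglongrightarrow> g i y)"
    using g unfolding baire1_def by blast
  then obtain c where c: "\<And>i j. continuous_on UNIV (c i j)" "\<And>i j y. \<bar>c i j y\<bar> \<le> 1"
      "\<And>i y. (\<lambda>j::nat. c i j y) \<longlonglongrightarrow> g i y"
    by metis
  have T0: "0 \<le> T i" for i using monoD[OF T(2), of 0 i] T(1) by simp
  have cm [measurable]: "c i j \<in> borel_measurable borel" for i j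
    by (rule borel_measurable_continuous_onI[OF c(1)])
  have km [measurable]: "k \<in> borel_measurable borel"
    by (rule borel_measurable_continuous_onI[OF k(1)])
  note [measurable] = X(1)[OF T0] baire1_measurable[OF g]
  have bp: "\<bar>\<Prod>i\<le>n. c i j (y i)\<bar> \<le> 1" for j y
    unfolding abs_prod using c(2) by (intro prod_le_1) auto
  have L1: "(\<lambda>j. \<integral>w. (\<Prod>i\<le>n. c i j (X (T i) w)) * k (\<xi> * ((X (T (Suc n)) w - X (T n) w) \<bullet> b)) \<partial>M) \<longlonglongrightarrow>
    (LINT w|M. (\<Prod>i\<le>n. g i (X (T i) w)) * k (\<xi> * ((X (T (Suc n)) w - X (T n) w) \<bullet> b)))"
    by (rule integral_dominated_convergence[where w="\<lambda>_. 1"])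
      (auto simp: abs_mult intro!: mult_le_one bp k(2) tendsto_mult tendsto_prod c(3))
  have L2: "(\<lambda>j. \<integral>w. (\<Prod>i\<le>n. c i j (X (T i) w)) \<partial>M) \<longlonglongrightarrow> (LINT w|M. (\<Prod>i\<le>n. g i (X (T i) w)))"
    by (rule integral_dominated_convergence[where w="\<lambda>_. 1"]) (auto intro!: bp tendsto_prod c(3))
  have eq: "(LINT w|M. (\<Prod>i\<le>n. c i j (X (T i) w)) * k (\<xi> * ((X (T (Suc n)) w - X (T n) w) \<bullet> b))) =
    q * exp (- (T (Suc n) - T n) * \<phi> (\<xi>\<^sup>2)) * (LINT w|M. (\<Prod>i\<le>n. c i j (X (T i) w)))" for j
    by (rule subordinate_increment_continuous[OF T c(1) c(2) k q kB X])
  show ?thesis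
    by (rule LIMSEQ_unique[OF L1]) (unfold eq, intro tendsto_mult_left L2)
qed

lemma subordinate_increment:
  fixes X :: "real \<Rightarrow> 'a \<Rightarrow> 'v"
  assumes X: "\<And>t. 0 \<le> t \<Longrightarrow> X t \<in> borel_measurable M" "AE w in M. \<forall>t\<ge>0. X t w = B (S t w) w"
    and T: "0 \<le> T 0" "mono T" and g: "\<And>i. baire1 (g i)" and b: "b \<in> Basis"
  shows "(LINT w|M. (\<Prod>i\<le>n. g i (X (T i) w)) * cos (\<xi> * ((X (T (Suc n)) w - X (T n) w) \<bullet> b))) =
      exp (- (T (Suc n) - T n) * \<phi> (\<xi>\<^sup>2)) * (LINT w|M. (\<Prod>i\<le>n. g i (X (T i) w)))" (is ?c)
    and "(LINT w|M. (\<Prod>i\<le>n. g i (X (T i) w)) * sin (\<xi> * ((X (T (Suc n)) w - X (T n) w) \<bullet> b))) = 0" (is ?s)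
proof -
  have "continuous_on UNIV (cos :: real \<Rightarrow> real)" "continuous_on UNIV (sin :: real \<Rightarrow> real)"
    by (intro continuous_intros)+
  note cs = this
  show ?c ?s
    using subordinate_increment_baire1[where g=g and k=cos and q=1 and \<xi>=\<xi> and b=b and n=n, OF X T g] double_speed_BM_increment(1)[OF B _ _ b, of _ _ \<xi>]
      subordinate_increment_baire1[where g=g and k=sin and q=0 and \<xi>=\<xi> and b=b and n=n, OF X T g] double_speed_BM_increment(2)[OF B _ _ b, of _ _ \<xi>]
    by (auto simp: cs)
qed

end

section \<open>Hitting times and Dynkin's formula\<close>

text \<open>Here the path properties hold for every outcome.  The processes of the theorem are brought into this form
  by changing them on a null set.\<close>

locale subordinate_paths = prob_space M for M :: "'a measure" +
  fixes S :: "real \<Rightarrow> 'a \<Rightarrow> real" and B :: "real \<Rightarrow> 'a \<Rightarrow> 'v::euclidean_space"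
    and X :: "real \<Rightarrow> 'a \<Rightarrow> 'v" and x :: 'v and \<phi> :: "real \<Rightarrow> real"
  assumes X_def: "\<And>t w. X t w = B (S t w) w"
    and S_0: "\<And>w. S 0 w = 0"
    and S_mono: "\<And>s t w. 0 \<le> s \<Longrightarrow> s \<le> t \<Longrightarrow> S s w \<le> S t w"
    and S_rcont: "\<And>t w. 0 \<le> t \<Longrightarrow> ((\<lambda>s. S s w) \<longlongrightarrow> S t w) (at_right t)"
    and B_cont: "\<And>w. continuous_on {0..} (\<lambda>t. B t w)"
    and B_0: "\<And>w. B 0 w = x"
    and X_measurable: "\<And>t. 0 \<le> t \<Longrightarrow> X t \<in> borel_measurable M"
    and \<phi>_nonneg: "\<And>l. 0 \<le> l \<Longrightarrow> 0 \<le> \<phi> l" and \<phi>_pos: "\<And>l. 0 < l \<Longrightarrow> 0 < \<phi> l"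
    and \<phi>_measurable: "\<phi> \<in> borel_measurable borel"
    and increment_cos: "\<And>T g n b \<xi>. 0 \<le> T 0 \<Longrightarrow> mono T \<Longrightarrow> (\<And>i. baire1 (g i)) \<Longrightarrow> b \<in> Basis \<Longrightarrow>
      (LINT w|M. (\<Prod>i\<le>n. g i (X (T i) w)) * cos (\<xi> * ((X (T (Suc n)) w - X (T n) w) \<bullet> b))) =
      exp (- (T (Suc n) - T n) * \<phi> (\<xi>\<^sup>2)) * (LINT w|M. (\<Prod>i\<le>n. g i (X (T i) w)))"
    and increment_sin: "\<And>T g n b \<xi>. 0 \<le> T 0 \<Longrightarrow> mono T \<Longrightarrow> (\<And>i. baire1 (g i)) \<Longrightarrow> b \<in> Basis \<Longrightarrow>
      (LINT w|M. (\<Prod>i\<le>n. g i (X (T i) w)) * sin (\<xi> * ((X (T (Suc n)) w - X (T n) w) \<bullet> b))) = 0"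
begin

section \<open>Path regularity of X and escape from balls\<close>

lemma X_0: "X 0 w = x"
  by (simp add: X_def S_0 B_0)

lemma S_nonneg: "0 \<le> t \<Longrightarrow> 0 \<le> S t w"
  using S_mono[of 0 t w] by (simp add: S_0)

lemma B_tendsto:
  assumes "(f \<longlongrightarrow> s) F" "\<forall>\<^sub>F u in F. 0 \<le> f u" "0 \<le> s"
  shows "((\<lambda>u. B (f u) w) \<longlongrightarrow> B s w) F"
  using continuous_on_tendsto_compose[OF B_cont assms(1)] assms(2,3) by auto

lemma X_rcont:
  assumes "0 \<le> t"
  shows "((\<lambda>s. X s w) \<longlongrightarrow> X t w) (at_right t)"
  unfolding X_def
proof (rule B_tendsto[OF S_rcont[OF assms]])
  show "\<forall>\<^sub>F u in at_right t. 0 \<le> S u w"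
    unfolding eventually_at_right_field using assms by (intro exI[of _ "t + 1"]) (auto intro!: S_nonneg)
qed (rule S_nonneg[OF assms])

lemma X_rcont_seq:
  assumes "0 \<le> t" "u \<longlonglongrightarrow> t" "\<And>m. t \<le> u m"
  shows "(\<lambda>m. X (u m) w) \<longlonglongrightarrow> X t w"
proof -
  have "continuous (at t within {t..}) (\<lambda>s. X s w)"
  proof -
    have "continuous (at_right t) (\<lambda>s. X s w)"
      using X_rcont[OF assms(1)] by (simp add: continuous_within)
    then show ?thesis by (simp add: continuous_within at_within_Ici_at_right)
  qed
  then show ?thesis
    by (rule continuous_within_sequentially[THEN iffD1, rule_format, unfolded comp_def]) (use assms in auto)
qed

text \<open>Along increasing times the clock increases to some s, which may lie strictly below
  \<open>S t w\<close> if S jumps. Continuity of B then gives the limit \<open>B s w\<close> of the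
  positions.\<close>

lemma X_left_limit:
  assumes u: "incseq u" "0 \<le> u 0" "\<And>m. u m \<le> t"
  shows "\<exists>s. (\<lambda>m. S (u m) w) \<longlonglongrightarrow> s \<and> s \<le> S t w \<and> (\<forall>m. S (u m) w \<le> s) \<and> (\<lambda>m. X (u m) w) \<longlonglongrightarrow> B s w"
proof -
  have u0: "0 \<le> u m" for m using incseqD[OF u(1), of 0 m] u(2) by simp
  have inc: "incseq (\<lambda>m. S (u m) w)"
    using u(1) u0 by (auto simp: incseq_def intro!: S_mono)
  obtain s where s: "(\<lambda>m. S (u m) w) \<longlonglongrightarrow> s"
    using incseq_convergent[OF inc, of "S t w"] u(3) u0 S_mono by metis
  have "s \<le> S t w" by (rule LIMSEQ_le_const2[OF s]) (use u u0 S_mono in auto)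
  moreover have le: "\<forall>m. S (u m) w \<le> s" using incseq_le[OF inc s] by auto
  moreover have "(\<lambda>m. X (u m) w) \<longlonglongrightarrow> B s w"
    unfolding X_def
    by (rule B_tendsto[OF s]) (use le S_nonneg[OF u0] order_trans in \<open>auto intro: order_trans\<close>)
  ultimately show ?thesis using s by blast
qed

text \<open>The length u of the extra step is independent of the mesh: Dynkin's formula takes one
  more grid step, while quasi-left-continuity needs a fixed span after a random grid time.\<close>

lemma skeleton_increment:
  assumes g: "\<And>i. baire1 (g i)" and \<delta>: "0 \<le> \<delta>" and u: "0 \<le> u" and b: "b \<in> Basis"
  shows "(LINT w|M. (\<Prod>i\<le>j. g i (X (real i * \<delta>) w)) * cos (\<xi> * ((X (real j * \<delta> + u) w - X (real j * \<delta>) w) \<bullet> b))) =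
      exp (- u * \<phi> (\<xi>\<^sup>2)) * (LINT w|M. (\<Prod>i\<le>j. g i (X (real i * \<delta>) w)))"
    and "(LINT w|M. (\<Prod>i\<le>j. g i (X (real i * \<delta>) w)) * sin (\<xi> * ((X (real j * \<delta> + u) w - X (real j * \<delta>) w) \<bullet> b))) = 0"
proof -
  define T where "T = (\<lambda>i. if i \<le> j then real i * \<delta> else real j * \<delta> + u)"
  have T: "0 \<le> T 0" "mono T"
    using \<delta> u by (auto simp: T_def mono_def intro!: mult_right_mono add_increasing2)
  have e: "(\<Prod>i\<le>j. g i (X (T i) w)) = (\<Prod>i\<le>j. g i (X (real i * \<delta>) w))" for w
    by (intro prod.cong) (auto simp: T_def)
  have t: "T j = real j * \<delta>" "T (Suc j) = real j * \<delta> + u" by (auto simp: T_def)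
  show "(LINT w|M. (\<Prod>i\<le>j. g i (X (real i * \<delta>) w)) * cos (\<xi> * ((X (real j * \<delta> + u) w - X (real j * \<delta>) w) \<bullet> b))) =
      exp (- u * \<phi> (\<xi>\<^sup>2)) * (LINT w|M. (\<Prod>i\<le>j. g i (X (real i * \<delta>) w)))"
    using increment_cos[where g=g and n=j and \<xi>=\<xi>, OF T g b] by (simp add: e t)
  show "(LINT w|M. (\<Prod>i\<le>j. g i (X (real i * \<delta>) w)) * sin (\<xi> * ((X (real j * \<delta> + u) w - X (real j * \<delta>) w) \<bullet> b))) = 0"
    using increment_sin[where g=g and n=j and \<xi>=\<xi>, OF T g b] by (simp add: e t)
qed

text \<open>A step of a skeleton of large mesh is bounded by \<open>2 * R\<close> with probability less than 1, as one sees by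
  integrating \<open>1 + cos\<close> of it, so the probability of never leaving the ball decays geometrically.\<close>

lemma exits_bounded:
  assumes R: "0 < R"
  shows "AE w in M. \<exists>t\<ge>0. R < norm (X t w)"
proof -
  obtain b :: 'v where b: "b \<in> Basis" using nonempty_Basis by blast
  \<comment> \<open>Two points of the ball differ by at most 2 R, so with this frequency the
    argument of the cosine is at most 1, hence below pi/3, and the cosine is at least 1/2.\<close>
  define \<xi> where "\<xi> = 1 / (2 * R)"
  have \<phi>: "0 < \<phi> (\<xi>\<^sup>2)" using R by (intro \<phi>_pos) (simp add: \<xi>_def)
  \<comment> \<open>At this time the characteristic function is 1/4. The recursion becomes 3/2 times
    the new probability at most 1 + 1/4 times the old one, that is, the ratio 5/6.\<close>
  define s where "s = ln 4 / \<phi> (\<xi>\<^sup>2)"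
  have s: "0 \<le> s" using \<phi> by (simp add: s_def)
  have es: "exp (- s * \<phi> (\<xi>\<^sup>2)) = 1 / 4" using \<phi> by (simp add: s_def exp_minus)
  let ?g = "indicator {y::'v. - R \<le> - norm y} :: 'v \<Rightarrow> real"
  have g: "baire1 ?g" by (rule baire1_indicator) (intro continuous_intros)
  define A where "A = (\<lambda>j w. \<Prod>i\<le>j. ?g (X (real i * s) w))"
  note [measurable] = X_measurable
  have Xm [measurable]: "X (real i * s) \<in> borel_measurable M" for i using s by (intro X_measurable) auto
  have A01: "0 \<le> A j w" "A j w \<le> 1" for j w
    unfolding A_def by (auto intro!: prod_nonneg prod_le_1 simp: indicator_def)
  have Am [measurable]: "A j \<in> borel_measurable M" for j
    unfolding A_def by (intro borel_measurable_prod measurable_compose[OF Xm] baire1_measurable g)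
  have intA: "integrable M (A j)" for j
    by (rule integrable_const_bound[where B=1]) (use A01 in auto)
  define P where "P = (\<lambda>j. \<integral>w. A j w \<partial>M)"
  have step: "P (Suc j) \<le> 5 / 6 * P j" for j
  proof -
    let ?c = "\<lambda>w. cos (\<xi> * ((X (real j * s + s) w - X (real j * s) w) \<bullet> b))"
    have m2 [measurable]: "X (real j * s + s) \<in> borel_measurable M" using s by (intro X_measurable) auto
    have ic: "integrable M (\<lambda>w. A j w * ?c w)"
      by (rule integrable_const_bound[where B=1]) (use A01 in \<open>auto simp: abs_mult intro!: mult_le_one\<close>)
    have pw: "3 / 2 * A (Suc j) w \<le> A j w + A j w * ?c w" for w
    proof (cases "A (Suc j) w = 0")
      case True
      have "0 \<le> 1 + ?c w" using cos_ge_minus_one[of "\<xi> * ((X (real j * s + s) w - X (real j * s) w) \<bullet> b)"] by linarith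
      then have "0 \<le> A j w * (1 + ?c w)" by (rule mult_nonneg_nonneg[OF A01(1)])
      then show ?thesis using True by (simp add: algebra_simps)
    next
      case False
      then have "\<forall>i\<in>{..Suc j}. ?g (X (real i * s) w) \<noteq> 0"
        unfolding A_def prod_zero_iff[OF finite_atMost] by blast
      then have n: "\<forall>i\<le>Suc j. norm (X (real i * s) w) \<le> R"
        by (simp only: indicator_def Ball_def atMost_iff) (auto split: if_splits)
      then have A1: "A (Suc j) w = 1" "A j w = 1"
        unfolding A_def by (auto intro!: prod.neutral)
      have "norm (X (real j * s + s) w) \<le> R" using n[rule_format, of "Suc j"] by (simp add: algebra_simps)
      moreover have "norm (X (real j * s) w) \<le> R" using n by simp
      ultimately have "\<bar>(X (real j * s + s) w - X (real j * s) w) \<bullet> b\<bar> \<le> 2 * R"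
        using Basis_le_norm[OF b, of "X (real j * s + s) w - X (real j * s) w"]
          norm_triangle_ineq4[of "X (real j * s + s) w" "X (real j * s) w"] by linarith
      then have "\<bar>\<xi> * ((X (real j * s + s) w - X (real j * s) w) \<bullet> b)\<bar> \<le> 1"
        using R by (simp add: \<xi>_def abs_mult divide_simps)
      then have "cos (pi / 3) \<le> cos \<bar>\<xi> * ((X (real j * s + s) w - X (real j * s) w) \<bullet> b)\<bar>"
        using pi_gt3 by (intro cos_monotone_0_pi_le) auto
      then have "1 / 2 \<le> ?c w" by (simp add: cos_60)
      then show ?thesis using A1 by simp
    qed
    have "3 / 2 * P (Suc j) = (LINT w|M. 3 / 2 * A (Suc j) w)" by (simp add: P_def)
    also have "\<dots> \<le> (LINT w|M. A j w + A j w * ?c w)"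
      by (intro integral_mono pw integrable_mult_right intA Bochner_Integration.integrable_add ic)
    also have "\<dots> = P j + (LINT w|M. A j w * ?c w)"
      unfolding P_def by (rule Bochner_Integration.integral_add[OF intA ic])
    also have "(LINT w|M. A j w * ?c w) = 1 / 4 * P j"
      unfolding P_def A_def using skeleton_increment(1)[OF g s s b, of j \<xi>] by (simp only: es)
    finally show ?thesis by simp
  qed
  have P_le: "P j \<le> (5 / 6) ^ j" for j
  proof (induction j)
    case 0
    show ?case unfolding P_def using integral_mono[OF intA[of 0], of "\<lambda>_. 1"] A01 by (simp add: prob_space)
  next
    case (Suc j)
    then show ?case using step[of j] by simp
  qed
  have "prob {w\<in>space M. \<forall>i. norm (X (real i * s) w) \<le> R} \<le> (5 / 6) ^ j" for j
  proof -
    have "prob {w\<in>space M. \<forall>i. norm (X (real i * s) w) \<le> R} = (LINT w|M. indicator {w\<in>space M. \<forall>i. norm (X (real i * s) w) \<le> R} w)"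
      by simp
    also have "\<dots> \<le> P j"
      unfolding P_def
    proof (rule integral_mono[OF _ intA])
      show "integrable M (\<lambda>w. indicator {w\<in>space M. \<forall>i. norm (X (real i * s) w) \<le> R} w :: real)"
        by (rule integrable_real_indicator) (auto simp: emeasure_eq_measure)
      show "indicator {w\<in>space M. \<forall>i. norm (X (real i * s) w) \<le> R} w \<le> A j w" for w
        using A01[of j w] by (auto simp: indicator_def A_def)
    qed
    finally show ?thesis using P_le[of j] by linarith
  qed
  then have "prob {w\<in>space M. \<forall>i. norm (X (real i * s) w) \<le> R} \<le> 0"
    by (intro LIMSEQ_le_const[OF LIMSEQ_realpow_zero[of "5/6"]]) auto
  then have "prob {w\<in>space M. \<forall>i. norm (X (real i * s) w) \<le> R} = 0"
    using measure_nonneg[of M] by (simp add: order_antisym)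
  then have "AE w in M. \<not> (\<forall>i. norm (X (real i * s) w) \<le> R)"
    by (intro AE_I[where N="{w\<in>space M. \<forall>i. norm (X (real i * s) w) \<le> R}"]) (auto simp: emeasure_eq_measure)
  then show ?thesis
  proof eventually_elim
    case (elim w)
    then obtain i where "R < norm (X (real i * s) w)" by (auto simp: not_le)
    then show ?case using s by (intro exI[of _ "real i * s"]) auto
  qed
qed

end

lemma (in prob_space) integral_bounded_swap:
  fixes \<rho> :: "real \<Rightarrow> real" and F :: "'a \<Rightarrow> real \<Rightarrow> real"
  assumes \<rho>: "integrable lborel \<rho>"
    and F: "(\<lambda>(w, z). F w z) \<in> borel_measurable (M \<Otimes>\<^sub>M lborel)" and bd: "\<And>w z. \<bar>F w z\<bar> \<le> C"
  shows "(LINT w|M. (LBINT z. \<rho> z * F w z)) = (LBINT z. \<rho> z * (LINT w|M. F w z))"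
    and "integrable M (\<lambda>w. \<integral>z. \<rho> z * F w z \<partial>lborel)"
    and "(\<lambda>z. \<integral>w. F w z \<partial>M) \<in> borel_measurable lborel"
proof -
  interpret pair_sigma_finite M lborel
    by (simp add: pair_sigma_finite_def sigma_finite_lborel sigma_finite_measure_axioms)
  have [measurable]: "\<rho> \<in> borel_measurable lborel" using \<rho> by auto
  note F [measurable]
  have C: "0 \<le> C" using bd[of undefined undefined] by linarith
  have "integrable (M \<Otimes>\<^sub>M lborel) (\<lambda>(w, z). \<rho> z * F w z)"
  proof (rule Fubini_integrable)
    have i: "integrable lborel (\<lambda>z. \<rho> z * F w z)" if "w \<in> space M" for w
      by (rule Bochner_Integration.integrable_bound[OF integrable_mult_right[OF \<rho>, of C]])
        (use that bd C in \<open>auto simp: abs_mult mult.commute[of C] intro!: mult_left_mono\<close>)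
    then show "AE w in M. integrable lborel (\<lambda>z. case (w, z) of (w, z) \<Rightarrow> \<rho> z * F w z)" by auto
    show "integrable M (\<lambda>w. \<integral>z. norm (case (w, z) of (w, z) \<Rightarrow> \<rho> z * F w z) \<partial>lborel)"
    proof (rule integrable_const_bound[where B="\<integral>z. C * norm (\<rho> z) \<partial>lborel"])
      show "AE w in M. norm (LBINT z. norm (case (w, z) of (w, z) \<Rightarrow> \<rho> z * F w z)) \<le> (LBINT z. C * norm (\<rho> z))"
      proof (intro AE_I2)
        fix w assume w: "w \<in> space M"
        have "(LBINT z. norm (\<rho> z * F w z)) \<le> (LBINT z. C * norm (\<rho> z))"
          by (rule integral_mono[OF integrable_norm[OF i[OF w]]])
            (use \<rho> bd in \<open>auto simp: abs_mult mult.commute[of C] intro!: mult_left_mono\<close>)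
        then show "norm (LBINT z. norm (case (w, z) of (w, z) \<Rightarrow> \<rho> z * F w z)) \<le> (LBINT z. C * norm (\<rho> z))"
          by simp
      qed
    qed simp
  qed simp
  then have int: "integrable (M \<Otimes>\<^sub>M lborel) (case_prod (\<lambda>w z. \<rho> z * F w z))" by simp
  show "(LINT w|M. (LBINT z. \<rho> z * F w z)) = (LBINT z. \<rho> z * (LINT w|M. F w z))"
    using Fubini_integral[OF int] by simp
  show "integrable M (\<lambda>w. \<integral>z. \<rho> z * F w z \<partial>lborel)"
    using integrable_fst[OF int] by simp
  show "(\<lambda>z. \<integral>w. F w z \<partial>M) \<in> borel_measurable lborel"
    by measurable
qed

section \<open>Hitting times of open sets and their grid approximations\<close>

context subordinate_paths
begin

text \<open>The entrance time into the set where q < e, capped at N. Inserting N bounds the time and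
  keeps the set nonempty, so that its infimum is meaningful on every path. The grid version
  \<open>step_hit\<close> counts steps, so its cap is \<open>N * 2 ^ m\<close>.\<close>

definition hit :: "('v \<Rightarrow> real) \<Rightarrow> real \<Rightarrow> nat \<Rightarrow> 'a \<Rightarrow> real" where
  "hit q e N w = Inf (insert (real N) {t. 0 \<le> t \<and> q (X t w) < e})"

definition step_hit :: "('v \<Rightarrow> real) \<Rightarrow> real \<Rightarrow> nat \<Rightarrow> nat \<Rightarrow> 'a \<Rightarrow> nat" where
  "step_hit q e N m w = (LEAST j. q (X (real j * (1 / 2) ^ m) w) < e \<or> N * 2 ^ m \<le> j)"

abbreviation step_time :: "('v \<Rightarrow> real) \<Rightarrow> real \<Rightarrow> nat \<Rightarrow> nat \<Rightarrow> 'a \<Rightarrow> real" where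
  "step_time q e N m w \<equiv> real (step_hit q e N m w) * (1 / 2) ^ m"

lemma hit_set_bdd: "bdd_below (insert (real N) {t. 0 \<le> t \<and> q (X t w) < e})"
  by (rule bdd_belowI[of _ 0]) auto

lemma hit_le: "hit q e N w \<le> real N"
  unfolding hit_def by (rule cInf_lower[OF _ hit_set_bdd]) simp

lemma hit_nonneg: "0 \<le> hit q e N w"
  unfolding hit_def by (rule cInf_greatest) auto

lemma hit_lower: "0 \<le> t \<Longrightarrow> q (X t w) < e \<Longrightarrow> hit q e N w \<le> t"
  unfolding hit_def by (rule cInf_lower[OF _ hit_set_bdd]) simp

lemma hit_witness:
  assumes "hit q e N w < real N" "hit q e N w < z"
  shows "\<exists>t. 0 \<le> t \<and> q (X t w) < e \<and> t < z \<and> hit q e N w \<le> t"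
proof -
  have "Inf (insert (real N) {t. 0 \<le> t \<and> q (X t w) < e}) < min (real N) z"
    using assms unfolding hit_def by simp
  from cInf_lessD[OF _ this] show ?thesis by (auto intro: hit_lower)
qed

text \<open>Times at which q < e approach the infimum from the right. Right-continuity carries the
  inequality over, but only in its weak form.\<close>

lemma hit_attained:
  assumes q: "continuous_on UNIV q" and lt: "hit q e N w < real N"
  shows "q (X (hit q e N w) w) \<le> e"
proof -
  have "\<exists>t. 0 \<le> t \<and> q (X t w) < e \<and> t < hit q e N w + 1 / real (Suc m) \<and> hit q e N w \<le> t" for m
    by (rule hit_witness[OF lt]) simp
  then obtain u where u: "\<And>m. q (X (u m) w) < e" "\<And>m. u m < hit q e N w + 1 / real (Suc m)" "\<And>m. hit q e N w \<le> u m"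
    by metis
  have "u \<longlonglongrightarrow> hit q e N w"
  proof (rule tendsto_sandwich[where f="\<lambda>_. hit q e N w" and h="\<lambda>m. hit q e N w + 1 / real (Suc m)"])
    show "\<forall>\<^sub>F m in sequentially. hit q e N w \<le> u m" using u(3) by (intro always_eventually allI)
    show "\<forall>\<^sub>F m in sequentially. u m \<le> hit q e N w + 1 / real (Suc m)"
      using u(2) by (intro always_eventually allI less_imp_le)
    show "(\<lambda>m. hit q e N w + 1 / real (Suc m)) \<longlonglongrightarrow> hit q e N w"
      using tendsto_add[OF tendsto_const[of "hit q e N w"] LIMSEQ_inverse_real_of_nat] by (simp add: inverse_eq_divide)
  qed simp
  then have "(\<lambda>m. X (u m) w) \<longlonglongrightarrow> X (hit q e N w) w" by (rule X_rcont_seq[OF hit_nonneg _ u(3)])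
  then have "(\<lambda>m. q (X (u m) w)) \<longlonglongrightarrow> q (X (hit q e N w) w)"
    using continuous_on_tendsto_compose[OF q] by simp
  then show ?thesis by (rule LIMSEQ_le_const2) (use u(1) less_imp_le in blast)
qed

lemma step_hit_prop: "q (X (step_time q e N m w) w) < e \<or> N * 2 ^ m \<le> step_hit q e N m w"
  unfolding step_hit_def by (rule LeastI[of _ "N * 2 ^ m"]) simp

lemma step_hit_le: "step_hit q e N m w \<le> N * 2 ^ m"
  unfolding step_hit_def by (rule Least_le) simp

lemma step_hit_lower: "q (X (real j * (1 / 2) ^ m) w) < e \<Longrightarrow> step_hit q e N m w \<le> j"
  unfolding step_hit_def by (rule Least_le) simp

lemma before_step_hit: "j < step_hit q e N m w \<Longrightarrow> e \<le> q (X (real j * (1 / 2) ^ m) w)"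
  using step_hit_lower[of q j m w e N] by linarith

lemma step_time_le: "step_time q e N m w \<le> real N"
proof -
  have "real (step_hit q e N m w) \<le> real (N * 2 ^ m)" using step_hit_le of_nat_le_iff by blast
  then show ?thesis by (simp add: power_one_over divide_simps)
qed

lemma hit_le_step_time: "hit q e N w \<le> step_time q e N m w"
  using step_hit_prop[of q e N m w]
proof
  assume "N * 2 ^ m \<le> step_hit q e N m w"
  then have "step_hit q e N m w = N * 2 ^ m" using step_hit_le[of q e N m w] by simp
  then show ?thesis using hit_le[of q e N w] by (simp add: power_one_over)
qed (auto intro: hit_lower)

text \<open>Grid hits never precede the true one. Conversely, shortly after a time with q < e the
  path still satisfies q < e by right-continuity, so every fine enough grid has a point
  there.\<close>

lemma step_time_tendsto:
  assumes q: "continuous_on UNIV q"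
  shows "(\<lambda>m. step_time q e N m w) \<longlonglongrightarrow> hit q e N w"
proof (rule order_tendstoI)
  fix a assume "a < hit q e N w"
  then show "\<forall>\<^sub>F m in sequentially. a < step_time q e N m w"
    using hit_le_step_time order_less_le_trans by (intro always_eventually) blast
next
  fix a assume a: "hit q e N w < a"
  show "\<forall>\<^sub>F m in sequentially. step_time q e N m w < a"
  proof (cases "hit q e N w < real N")
    case False
    then have "real N < a" using a by linarith
    then show ?thesis by (intro always_eventually allI order_le_less_trans[OF step_time_le])
  next
    case True
    obtain t where t: "0 \<le> t" "q (X t w) < e" "t < a" using hit_witness[OF True a] by blast
    have "((\<lambda>s. q (X s w)) \<longlongrightarrow> q (X t w)) (at_right t)"
      using continuous_on_tendsto_compose[OF q X_rcont[OF t(1)]] by simp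
    then have "\<forall>\<^sub>F s in at_right t. q (X s w) < e" using t(2) by (rule order_tendstoD)
    then obtain d where d: "t < d" "\<And>s. t < s \<Longrightarrow> s < d \<Longrightarrow> q (X s w) < e"
      unfolding eventually_at_right_field by blast
    have "(\<lambda>m. (1 / 2 :: real) ^ m) \<longlonglongrightarrow> 0" by (rule LIMSEQ_realpow_zero) auto
    then have "\<forall>\<^sub>F m in sequentially. (1 / 2 :: real) ^ m < min d a - t"
      by (rule order_tendstoD) (use d t in auto)
    then show ?thesis
    proof eventually_elim
      case (elim m)
      \<comment> \<open>The first grid index strictly after t.\<close>
      define j where "j = Suc (nat \<lfloor>t * 2 ^ m\<rfloor>)"
      have "0 \<le> t * 2 ^ m" using t by simp
      then have "t * 2 ^ m < real j" "real j \<le> t * 2 ^ m + 1" unfolding j_def by linarith+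
      then have j: "t < real j * (1 / 2) ^ m" "real j * (1 / 2) ^ m \<le> t + (1 / 2) ^ m"
        by (auto simp: power_one_over field_simps)
      then have "q (X (real j * (1 / 2) ^ m) w) < e" using elim by (intro d(2)) auto
      then have "real (step_hit q e N m w) \<le> real j" using step_hit_lower of_nat_le_iff by blast
      then have "step_time q e N m w \<le> real j * (1 / 2) ^ m" by (intro mult_right_mono) auto
      then show ?case using j elim by linarith
    qed
  qed
qed

lemma X_step_tendsto:
  assumes q: "continuous_on UNIV q" and u: "0 \<le> u"
  shows "(\<lambda>m. X (step_time q e N m w + u) w) \<longlonglongrightarrow> X (hit q e N w + u) w"
  by (rule X_rcont_seq) (use hit_nonneg u hit_le_step_time step_time_tendsto[OF q] in \<open>auto intro!: tendsto_intros add_nonneg_nonneg\<close>)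

lemma step_hit_measurable:
  assumes q: "continuous_on UNIV q"
  shows "step_hit q e N m \<in> measurable M (count_space UNIV)"
proof -
  have [measurable]: "q \<in> borel_measurable borel" using q by (rule borel_measurable_continuous_onI)
  have [measurable]: "X (real j * (1 / 2) ^ m) \<in> borel_measurable M" for j by (rule X_measurable) simp
  show ?thesis unfolding step_hit_def by measurable
qed

lemma X_step_measurable:
  assumes q: "continuous_on UNIV q" and u: "0 \<le> u"
  shows "(\<lambda>w. X (step_time q e N m w + u) w) \<in> borel_measurable M"
  by (rule measurable_compose_countable[of "\<lambda>j w. X (real j * (1 / 2) ^ m + u) w", OF _ step_hit_measurable[OF q]])
    (use u in \<open>auto intro!: X_measurable\<close>)

lemma X_hit_measurable:
  assumes q: "continuous_on UNIV q" and u: "0 \<le> u"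
  shows "(\<lambda>w. X (hit q e N w + u) w) \<in> borel_measurable M"
  by (rule borel_measurable_LIMSEQ_metric[OF X_step_measurable[OF q u] X_step_tendsto[OF q u]])

text \<open>The event \<open>step_hit q e N m w = j\<close> is a product of indicators of the
  positions up to step j. On it the increment after the random time is one after the fixed step j,
  and the contributions of all j are summed.\<close>

lemma step_increment:
  assumes q: "continuous_on UNIV q" and u: "0 \<le> u" and b: "b \<in> Basis"
  shows "(LINT w|M. cos (\<xi> * ((X (step_time q e N m w + u) w -
      X (step_time q e N m w) w) \<bullet> b))) = exp (- u * \<phi> (\<xi>\<^sup>2))"
proof -
  let ?J = "N * 2 ^ m"
  let ?I = "\<lambda>j w. indicator {w. step_hit q e N m w = j} w :: real"
  let ?c = "\<lambda>j w. cos (\<xi> * ((X (real j * (1 / 2) ^ m + u) w - X (real j * (1 / 2) ^ m) w) \<bullet> b))"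
  \<comment> \<open>At the cap \<open>j = N * 2 ^ m\<close> the walk stops whether or not the set
    has been reached, hence the last factor 1 there.\<close>
  define G where "G = (\<lambda>j i. if i < j then indicator {y. e \<le> q y}
    else if j < ?J then indicator {y. q y < e} else (\<lambda>y::'v. 1::real))"
  have G: "baire1 (G j i)" for j i
    unfolding G_def using baire1_indicator[OF q] baire1_continuous[of "\<lambda>_::'v. 1"] by auto
  have [measurable]: "X (real j * (1 / 2) ^ m + u) \<in> borel_measurable M" "X (real j * (1 / 2) ^ m) \<in> borel_measurable M" for j
    using u by (auto intro!: X_measurable)
  note [measurable] = step_hit_measurable[OF q]
  have I: "?I j w = (\<Prod>i\<le>j. G j i (X (real i * (1 / 2) ^ m) w))" if "j \<le> ?J" for j w
  proof (cases "step_hit q e N m w = j")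
    case True
    have "G j i (X (real i * (1 / 2) ^ m) w) = 1" if "i \<le> j" for i
      using before_step_hit[of i q e N m w] step_hit_prop[of q e N m w] True that by (auto simp: G_def)
    then show ?thesis using True by (auto intro!: prod.neutral[symmetric])
  next
    case False
    have "\<exists>i\<le>j. G j i (X (real i * (1 / 2) ^ m) w) = 0"
    proof (cases "step_hit q e N m w < j")
      case True
      then show ?thesis using step_hit_prop[of q e N m w] that by (intro exI[of _ "step_hit q e N m w"]) (auto simp: G_def)
    next
      case False2: False
      then have "j < step_hit q e N m w" using False by simp
      then show ?thesis
        using before_step_hit[of j q e N m w] step_hit_le[of q e N m w] by (intro exI[of _ j]) (auto simp: G_def)
    qed
    then show ?thesis using False by (auto intro!: prod_zero[symmetric])
  qed
  have E: "(LINT w|M. ?I j w * ?c j w) = exp (- u * \<phi> (\<xi>\<^sup>2)) * (LINT w|M. ?I j w)" if "j \<le> ?J" for j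
    using skeleton_increment(1)[of "G j" "(1 / 2) ^ m" u b j \<xi>, OF G _ u b] by (simp add: I[OF that])
  have int: "integrable M (\<lambda>w. ?I j w * ?c j w)" "integrable M (?I j)" for j
    by (auto intro!: integrable_const_bound[where B=1] simp: indicator_def)
  have s: "f (step_hit q e N m w) = (\<Sum>j\<le>?J. ?I j w * f j)" for f :: "nat \<Rightarrow> real" and w
  proof -
    have "(\<Sum>j\<le>?J. ?I j w * f j) = (\<Sum>j\<le>?J. if j = step_hit q e N m w then f j else 0)"
      by (intro sum.cong) (auto simp: indicator_def)
    then show ?thesis using step_hit_le[of q e N m w] by simp
  qed
  have "(LINT w|M. ?c (step_hit q e N m w) w) = (LINT w|M. (\<Sum>j\<le>?J. ?I j w * ?c j w))"
    by (rule Bochner_Integration.integral_cong[OF refl]) (rule s)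
  also have "\<dots> = (\<Sum>j\<le>?J. exp (- u * \<phi> (\<xi>\<^sup>2)) * (LINT w|M. ?I j w))"
    by (subst Bochner_Integration.integral_sum[OF int(1)]) (intro sum.cong refl E, simp)
  also have "\<dots> = exp (- u * \<phi> (\<xi>\<^sup>2)) * (LINT w|M. (\<Sum>j\<le>?J. ?I j w))"
    by (subst Bochner_Integration.integral_sum[OF int(2)]) (simp add: sum_distrib_left)
  also have "(\<lambda>w. (\<Sum>j\<le>?J. ?I j w)) = (\<lambda>_. 1)" using s[of "\<lambda>_. 1"] by auto
  finally show ?thesis by (simp add: prob_space)
qed

lemma hit_increment:
  assumes q: "continuous_on UNIV q" and u: "0 \<le> u" and b: "b \<in> Basis"
  shows "(LINT w|M. cos (\<xi> * ((X (hit q e N w + u) w - X (hit q e N w) w) \<bullet> b))) = exp (- u * \<phi> (\<xi>\<^sup>2))"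
proof -
  note [measurable] = X_step_measurable[OF q u] X_step_measurable[OF q order_refl, simplified]
    X_hit_measurable[OF q u] X_hit_measurable[OF q order_refl, simplified]
  have "(\<lambda>m. \<integral>w. cos (\<xi> * ((X (step_time q e N m w + u) w -
      X (step_time q e N m w) w) \<bullet> b)) \<partial>M) \<longlonglongrightarrow>
      (LINT w|M. cos (\<xi> * ((X (hit q e N w + u) w - X (hit q e N w) w) \<bullet> b)))"
    by (rule integral_dominated_convergence[where w="\<lambda>_. 1"])
      (use X_step_tendsto[OF q u] X_step_tendsto[OF q order_refl] in \<open>auto intro!: tendsto_intros\<close>)
  then show ?thesis
    unfolding step_increment[OF q u b] by (simp add: LIMSEQ_const_iff)
qed

end

section \<open>Cosine transforms\<close>

lemma cos_transform_tendsto: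
  fixes \<rho> :: "real \<Rightarrow> real"
  assumes \<rho>: "integrable lborel \<rho>" and [measurable]: "\<omega> \<in> borel_measurable borel" and u: "u \<longlonglongrightarrow> y"
  shows "(\<lambda>m. \<integral>z. \<rho> z * cos (\<omega> z * (u m :: real)) \<partial>lborel) \<longlonglongrightarrow> (LBINT z. \<rho> z * cos (\<omega> z * y))"
proof (rule integral_dominated_convergence[where w="\<lambda>z. \<bar>\<rho> z\<bar>"])
  have [measurable]: "\<rho> \<in> borel_measurable lborel" using \<rho> by auto
  show "(\<lambda>z. \<rho> z * cos (\<omega> z * y)) \<in> borel_measurable lborel"
    "\<And>m. (\<lambda>z. \<rho> z * cos (\<omega> z * u m)) \<in> borel_measurable lborel"
    by measurable
qed (use \<rho> u in \<open>auto intro!: tendsto_intros simp: abs_mult mult_left_le\<close>)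

lemma cos_transform_integrable:
  fixes \<rho> :: "real \<Rightarrow> real"
  assumes \<rho>: "integrable lborel \<rho>" and [measurable]: "\<omega> \<in> borel_measurable borel"
  shows "integrable lborel (\<lambda>z. \<rho> z * cos (\<omega> z * y))"
proof -
  have [measurable]: "\<rho> \<in> borel_measurable lborel" using \<rho> by auto
  show ?thesis
    by (rule Bochner_Integration.integrable_bound[OF \<rho>]) (auto simp: abs_mult mult_left_le)
qed

lemma cos_transform_bound:
  fixes \<rho> :: "real \<Rightarrow> real"
  assumes \<rho>: "integrable lborel \<rho>" and [measurable]: "\<omega> \<in> borel_measurable borel"
  shows "\<bar>\<integral>z. \<rho> z * cos (\<omega> z * y) \<partial>lborel\<bar> \<le> (LBINT z. \<bar>\<rho> z\<bar>)"
proof -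
  have "\<bar>\<integral>z. \<rho> z * cos (\<omega> z * y) \<partial>lborel\<bar> \<le> (LBINT z. \<bar>\<rho> z * cos (\<omega> z * y)\<bar>)"
    using integral_norm_bound[of lborel "\<lambda>z. \<rho> z * cos (\<omega> z * y)"] by simp
  also have "\<dots> \<le> (LBINT z. \<bar>\<rho> z\<bar>)"
    by (rule integral_mono[OF integrable_abs[OF cos_transform_integrable[OF assms]]])
      (use \<rho> in \<open>auto simp: abs_mult mult_left_le\<close>)
  finally show ?thesis .
qed

text \<open>The factor \<open>1 - exp (- u)\<close> does two things in the remainder estimate: it is
  at most 1, which gives domination, and it tends to 0 with u.\<close>

lemma exp_minus_taylor_bounds:
  fixes u :: real
  assumes "0 \<le> u"
  shows "0 \<le> exp (- u) - 1 + u" "exp (- u) - 1 + u \<le> u * (1 - exp (- u))"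
proof -
  show "0 \<le> exp (- u) - 1 + u" using exp_ge_add_one_self[of "- u"] by linarith
  have "exp (- u) * (1 + u) \<le> exp (- u) * exp u"
    using exp_ge_add_one_self[of u] by (intro mult_left_mono) auto
  then have "exp (- u) * (1 + u) \<le> 1" by (simp add: exp_minus)
  then show "exp (- u) - 1 + u \<le> u * (1 - exp (- u))" by (simp add: algebra_simps)
qed

section \<open>Dynkin's formula for cosine transforms\<close>

context subordinate_paths
begin

text \<open>The generator of X multiplies the density of a cosine transform by minus the exponent.
  So \<open>zero\<close> says that the generator annihilates h wherever e \<le> q. The function
  \<open>\<omega>\<close> leaves room for a change of the frequency scale.\<close>

context
  fixes \<rho> \<omega> :: "real \<Rightarrow> real" and b :: 'v and c :: real and h :: "'v \<Rightarrow> real"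
    and q :: "'v \<Rightarrow> real" and e :: real
  assumes b: "b \<in> Basis" and \<rho>: "integrable lborel \<rho>" and \<omega>: "\<omega> \<in> borel_measurable borel"
    and \<rho>\<phi>: "integrable lborel (\<lambda>z. \<rho> z * \<phi> ((\<omega> z)\<^sup>2))"
    and h: "\<And>y. h y = c + (LBINT z. \<rho> z * cos (\<omega> z * (y \<bullet> b)))"
    and q: "continuous_on UNIV q"
    and zero: "\<And>y. e \<le> q y \<Longrightarrow> (LBINT z. (\<rho> z * \<phi> ((\<omega> z)\<^sup>2)) * cos (\<omega> z * (y \<bullet> b))) = 0"
begin

lemma h_tendsto: "u \<longlonglongrightarrow> y \<Longrightarrow> (\<lambda>m. h (u m)) \<longlonglongrightarrow> h y"
  unfolding h by (intro tendsto_intros cos_transform_tendsto \<rho> \<omega>)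

lemma h_continuous: "continuous_on UNIV h"
  by (rule continuous_on_sequentiallyI) (simp add: h_tendsto)

lemma h_measurable: "h \<in> borel_measurable borel"
  by (rule borel_measurable_continuous_onI[OF h_continuous])

lemma h_bound: "\<bar>h y\<bar> \<le> \<bar>c\<bar> + (LBINT z. \<bar>\<rho> z\<bar>)"
  unfolding h using cos_transform_bound[OF \<rho> \<omega>, of "y \<bullet> b"] by linarith

abbreviation "\<psi> z \<equiv> \<phi> ((\<omega> z)\<^sup>2)"

text \<open>The error of one step of length \<open>\<delta>\<close> is \<open>o(\<delta>)\<close>, hence negligible when summed over \<open>N * 2 ^ m\<close> steps of
  length \<open>(1 / 2) ^ m\<close>.\<close>

definition remainder :: "real \<Rightarrow> real" where
  "remainder \<delta> = (LBINT z. \<bar>\<rho> z\<bar> * (exp (- \<delta> * \<psi> z) - 1 + \<delta> * \<psi> z))"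

lemma rho_measurable: "\<rho> \<in> borel_measurable lborel" "(\<lambda>z. \<psi> z) \<in> borel_measurable lborel"
proof -
  note [measurable] = \<phi>_measurable \<omega>
  show "\<rho> \<in> borel_measurable lborel" using \<rho> by auto
  show "(\<lambda>z. \<psi> z) \<in> borel_measurable lborel" by measurable
qed

lemma remainder_integrable:
  assumes "0 \<le> \<delta>"
  shows "integrable lborel (\<lambda>z. \<rho> z * (exp (- \<delta> * \<psi> z) - 1 + \<delta> * \<psi> z))"
proof (rule Bochner_Integration.integrable_bound[OF integrable_mult_right[OF \<rho>\<phi>, of \<delta>]])
  note [measurable] = rho_measurable
  show "(\<lambda>z. \<rho> z * (exp (- \<delta> * \<psi> z) - 1 + \<delta> * \<psi> z)) \<in> borel_measurable lborel"
    by measurable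
  show "AE z in lborel. norm (\<rho> z * (exp (- \<delta> * \<psi> z) - 1 + \<delta> * \<psi> z))
      \<le> norm (\<delta> * (\<rho> z * \<psi> z))"
  proof (intro AE_I2)
    fix z
    have p: "0 \<le> \<delta> * \<psi> z" using assms \<phi>_nonneg by simp
    then have "exp (- (\<delta> * \<psi> z)) \<le> 1" by simp
    then have "\<bar>exp (- \<delta> * \<psi> z) - 1 + \<delta> * \<psi> z\<bar> \<le> \<bar>\<delta> * \<psi> z\<bar>"
      using exp_minus_taylor_bounds(1)[OF p] p by simp
    then have "\<bar>\<rho> z\<bar> * \<bar>exp (- \<delta> * \<psi> z) - 1 + \<delta> * \<psi> z\<bar> \<le> \<bar>\<rho> z\<bar> * \<bar>\<delta> * \<psi> z\<bar>"
      by (rule mult_left_mono) simp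
    then show "norm (\<rho> z * (exp (- \<delta> * \<psi> z) - 1 + \<delta> * \<psi> z))
      \<le> norm (\<delta> * (\<rho> z * \<psi> z))"
      by (simp add: abs_mult mult_ac)
  qed
qed

lemma remainder_tendsto: "(\<lambda>m. remainder ((1 / 2) ^ m) * 2 ^ m) \<longlonglongrightarrow> 0"
proof -
  note [measurable] = rho_measurable
  let ?f = "\<lambda>m z. \<bar>\<rho> z\<bar> * (exp (- ((1 / 2) ^ m) * \<psi> z) - 1 + (1 / 2) ^ m * \<psi> z) * 2 ^ m"
  have d0: "(\<lambda>m. (1 / 2 :: real) ^ m) \<longlonglongrightarrow> 0" by (rule LIMSEQ_realpow_zero) auto
  have b: "0 \<le> ?f m z \<and> ?f m z \<le> \<bar>\<rho> z * \<psi> z\<bar> * (1 - exp (- ((1 / 2) ^ m * \<psi> z)))" for m z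
  proof -
    let ?u = "(1 / 2) ^ m * \<psi> z"
    have p: "0 \<le> ?u" using \<phi>_nonneg by simp
    have "?f m z = \<bar>\<rho> z\<bar> * ((exp (- ?u) - 1 + ?u) * 2 ^ m)" by simp
    also have "\<dots> \<le> \<bar>\<rho> z\<bar> * ((?u * (1 - exp (- ?u))) * 2 ^ m)"
      using exp_minus_taylor_bounds(2)[OF p] by (intro mult_left_mono mult_right_mono) auto
    also have "\<dots> = \<bar>\<rho> z * \<psi> z\<bar> * (1 - exp (- ?u))"
      using \<phi>_nonneg[of "(\<omega> z)\<^sup>2"] by (simp add: abs_mult power_one_over)
    finally show ?thesis using exp_minus_taylor_bounds(1)[OF p] by simp
  qed
  have "(\<lambda>m. \<integral>z. ?f m z \<partial>lborel) \<longlonglongrightarrow> (\<integral>z. 0 \<partial>(lborel :: real measure))"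
  proof (rule integral_dominated_convergence[where w="\<lambda>z. \<bar>\<rho> z * \<psi> z\<bar>"])
    show "AE z in lborel. norm (?f m z) \<le> \<bar>\<rho> z * \<psi> z\<bar>" for m
    proof (intro AE_I2)
      fix z
      have "\<bar>\<rho> z * \<psi> z\<bar> * (1 - exp (- ((1 / 2) ^ m * \<psi> z))) \<le> \<bar>\<rho> z * \<psi> z\<bar> * 1"
        by (intro mult_left_mono) auto
      then show "norm (?f m z) \<le> \<bar>\<rho> z * \<psi> z\<bar>" using b[of z m] by simp
    qed
    show "AE z in lborel. (\<lambda>m. ?f m z) \<longlonglongrightarrow> 0"
    proof (intro AE_I2)
      fix z
      have "(\<lambda>m. \<bar>\<rho> z * \<psi> z\<bar> * (1 - exp (- ((1 / 2) ^ m * \<psi> z)))) \<longlonglongrightarrow>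
        \<bar>\<rho> z * \<psi> z\<bar> * (1 - exp (- (0 * \<psi> z)))"
        by (intro tendsto_intros d0)
      then have lim: "(\<lambda>m. \<bar>\<rho> z * \<psi> z\<bar> * (1 - exp (- ((1 / 2) ^ m * \<psi> z)))) \<longlonglongrightarrow> 0"
        by (simp only: mult_zero_left minus_zero exp_zero diff_self mult_zero_right)
      show "(\<lambda>m. ?f m z) \<longlonglongrightarrow> 0"
        by (rule tendsto_sandwich[OF _ _ tendsto_const lim]) (intro always_eventually allI conjunct1[OF b] conjunct2[OF b])+
    qed
  qed (use \<rho>\<phi> in auto)
  then show ?thesis by (simp add: remainder_def)
qed

text \<open>By the addition theorem the step multiplies the transform of the current position by
  \<open>exp (- \<delta> * \<psi> z)\<close>, and the sine part drops out. The term linear in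
  \<open>\<delta>\<close> is the generator applied to h, which vanishes where \<open>A j\<close> is
  nonzero, and the rest is the Taylor remainder.\<close>

lemma dynkin_one_step:
  fixes \<delta> :: real
  assumes \<delta>: "0 \<le> \<delta>"
  defines "A \<equiv> (\<lambda>j w. \<Prod>i\<le>j. indicator {y. e \<le> q y} (X (real i * \<delta>) w) :: real)"
  shows "\<bar>\<integral>w. A j w * (h (X (real (Suc j) * \<delta>) w) - h (X (real j * \<delta>) w)) \<partial>M\<bar> \<le> remainder \<delta>"
    and "integrable M (\<lambda>w. A j w * (h (X (real (Suc j) * \<delta>) w) - h (X (real j * \<delta>) w)))"
proof -
  note [measurable] = rho_measurable \<omega> h_measurable
  let ?K = "indicator {y. e \<le> q y} :: 'v \<Rightarrow> real"
  let ?X = "\<lambda>j w. X (real j * \<delta>) w"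
  have Kb: "baire1 ?K" by (rule baire1_indicator[OF q])
  have [measurable]: "X (real i * \<delta>) \<in> borel_measurable M" for i using \<delta> by (intro X_measurable) auto
  have [measurable]: "X (\<delta> + real i * \<delta>) \<in> borel_measurable M" for i using \<delta> by (intro X_measurable) auto
  have Am [measurable]: "A j \<in> borel_measurable M" for j
    unfolding A_def by (intro borel_measurable_prod measurable_compose[OF _ baire1_measurable[OF Kb]]) auto
  have A01: "0 \<le> A j w" "A j w \<le> 1" for j w
    unfolding A_def by (auto intro!: prod_nonneg prod_le_1 simp: indicator_def)
  have Acos: "\<bar>A j w * cos y\<bar> \<le> 1" for j w y
    unfolding abs_mult using A01[of j w] by (intro mult_le_one) auto
  have Asin: "\<bar>A j w * sin y\<bar> \<le> 1" for j w y
    unfolding abs_mult using A01[of j w] by (intro mult_le_one) auto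
  have Acos2: "\<bar>A j w * cos y * cos d\<bar> \<le> 1" for j w y d
    unfolding abs_mult[of _ "cos d"] by (intro mult_le_one Acos) auto
  have Asin2: "\<bar>A j w * sin y * sin d\<bar> \<le> 1" for j w y d
    unfolding abs_mult[of _ "sin d"] by (intro mult_le_one Asin) auto
  show "integrable M (\<lambda>w. A j w * (h (?X (Suc j) w) - h (?X j w)))"
  proof (rule integrable_const_bound[where B="1 * (2 * (\<bar>c\<bar> + (LBINT z. \<bar>\<rho> z\<bar>)))"])
    show "AE w in M. norm (A j w * (h (?X (Suc j) w) - h (?X j w))) \<le> 1 * (2 * (\<bar>c\<bar> + (LBINT z. \<bar>\<rho> z\<bar>)))"
    proof (intro AE_I2)
      fix w
      have "\<bar>h (?X (Suc j) w) - h (?X j w)\<bar> \<le> 2 * (\<bar>c\<bar> + (LBINT z. \<bar>\<rho> z\<bar>))"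
        unfolding mult_2 by (rule order_trans[OF abs_triangle_ineq4 add_mono[OF h_bound h_bound]])
      then show "norm (A j w * (h (?X (Suc j) w) - h (?X j w))) \<le> 1 * (2 * (\<bar>c\<bar> + (LBINT z. \<bar>\<rho> z\<bar>)))"
        using A01[of j w] unfolding real_norm_def abs_mult by (intro mult_mono) auto
    qed
  qed measurable
  have E1: "(LINT w|M. A j w * (cos (\<omega> z * (?X (Suc j) w \<bullet> b)) - cos (\<omega> z * (?X j w \<bullet> b)))) =
      (exp (- \<delta> * \<psi> z) - 1) * (LINT w|M. A j w * cos (\<omega> z * (?X j w \<bullet> b)))" for z
  proof -
    let ?D = "\<lambda>w. \<omega> z * ((X (real j * \<delta> + \<delta>) w - X (real j * \<delta>) w) \<bullet> b)"
    let ?Y = "\<lambda>w. \<omega> z * (?X j w \<bullet> b)"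
    have sp: "A j w * f (?X j w) = (\<Prod>i\<le>j. ?K (?X i w) * (if i = j then f (?X i w) else 1))" for f w
      unfolding A_def prod.distrib by simp
    have g: "baire1 (\<lambda>y. ?K y * (if i = j then f y else 1))" if "baire1 f" for f i
      using that baire1_mult[OF Kb that] Kb by (cases "i = j") auto
    have bc: "baire1 (\<lambda>y. cos (\<omega> z * (y \<bullet> b)))" "baire1 (\<lambda>y. sin (\<omega> z * (y \<bullet> b)))"
      by (auto intro!: baire1_continuous continuous_intros)
    have c1: "(LINT w|M. A j w * cos (?Y w) * cos (?D w)) =
        exp (- \<delta> * \<psi> z) * (LINT w|M. A j w * cos (?Y w))"
      unfolding sp[of _ "\<lambda>y. cos (\<omega> z * (y \<bullet> b))"]
      by (rule skeleton_increment(1)[of "\<lambda>i y. ?K y * (if i = j then cos (\<omega> z * (y \<bullet> b)) else 1)"])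
        (use g[OF bc(1)] \<delta> b in auto)
    have s1: "(LINT w|M. A j w * sin (?Y w) * sin (?D w)) = 0"
      unfolding sp[of _ "\<lambda>y. sin (\<omega> z * (y \<bullet> b))"]
      by (rule skeleton_increment(2)[of "\<lambda>i y. ?K y * (if i = j then sin (\<omega> z * (y \<bullet> b)) else 1)"])
        (use g[OF bc(2)] \<delta> b in auto)
    have eq: "A j w * (cos (\<omega> z * (?X (Suc j) w \<bullet> b)) - cos (?Y w)) =
        A j w * cos (?Y w) * cos (?D w) - A j w * sin (?Y w) * sin (?D w) - A j w * cos (?Y w)" for w
    proof -
      have "\<omega> z * (?X (Suc j) w \<bullet> b) = ?Y w + ?D w" by (simp add: inner_diff_left algebra_simps)
      then have "cos (\<omega> z * (?X (Suc j) w \<bullet> b)) = cos (?Y w) * cos (?D w) - sin (?Y w) * sin (?D w)"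
        by (simp only: cos_add)
      then show ?thesis by (simp only: right_diff_distrib mult.assoc)
    qed
    have [measurable]: "X (real j * \<delta> + \<delta>) \<in> borel_measurable M" using \<delta> by (intro X_measurable) auto
    have i1: "integrable M (\<lambda>w. A j w * cos (?Y w) * cos (?D w))"
      by (rule integrable_const_bound[where B=1]) (auto intro!: Acos2)
    have i2: "integrable M (\<lambda>w. A j w * sin (?Y w) * sin (?D w))"
      by (rule integrable_const_bound[where B=1]) (auto intro!: Asin2)
    have i3: "integrable M (\<lambda>w. A j w * cos (?Y w))"
      by (rule integrable_const_bound[where B="1"]) (auto intro!: Acos)
    show ?thesis
      unfolding eq using i1 i2 i3 c1 s1 by (simp add: algebra_simps)
  qed
  have F1: "(LINT w|M. (LBINT z. \<rho> z * (A j w * (cos (\<omega> z * (?X (Suc j) w \<bullet> b)) - cos (\<omega> z * (?X j w \<bullet> b)))))) =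
      (LBINT z. \<rho> z * (LINT w|M. A j w * (cos (\<omega> z * (?X (Suc j) w \<bullet> b)) - cos (\<omega> z * (?X j w \<bullet> b)))))"
  proof (rule integral_bounded_swap(1)[OF \<rho>, where C=2])
    show "\<bar>A j w * (cos (\<omega> z * (?X (Suc j) w \<bullet> b)) - cos (\<omega> z * (?X j w \<bullet> b)))\<bar> \<le> 2" for w z
      using Acos[of j w "\<omega> z * (?X (Suc j) w \<bullet> b)"] Acos[of j w "\<omega> z * (?X j w \<bullet> b)"]
      unfolding right_diff_distrib by linarith
  qed measurable
  have F2: "(LINT w|M. (LBINT z. (\<rho> z * \<psi> z) * (A j w * cos (\<omega> z * (?X j w \<bullet> b))))) =
      (LBINT z. (\<rho> z * \<psi> z) * (LINT w|M. A j w * cos (\<omega> z * (?X j w \<bullet> b))))"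
    by (rule integral_bounded_swap(1)[OF \<rho>\<phi>, where C=1]) (measurable, rule Acos)
  have Im: "(\<lambda>z. \<integral>w. A j w * cos (\<omega> z * (?X j w \<bullet> b)) \<partial>M) \<in> borel_measurable lborel"
    by (rule integral_bounded_swap(3)[OF \<rho>\<phi>, where C=1]) (measurable, rule Acos)
  note [measurable] = Im
  have Ib: "\<bar>\<integral>w. A j w * cos (\<omega> z * (?X j w \<bullet> b)) \<partial>M\<bar> \<le> 1" for z
  proof -
    have "norm (LINT w|M. A j w * cos (\<omega> z * (?X j w \<bullet> b))) \<le> (LINT w|M. norm (A j w * cos (\<omega> z * (?X j w \<bullet> b))))"
      by (rule integral_norm_bound)
    also have "\<dots> \<le> (LINT w|M. 1)"
      by (intro integral_mono integrable_norm integrable_const_bound[where B=1] integrable_const)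
        (auto intro!: Acos)
    finally show ?thesis by (simp add: prob_space)
  qed
  have Az: "(LBINT z. (\<rho> z * \<psi> z) * (A j w * cos (\<omega> z * (?X j w \<bullet> b)))) = 0" for w
  proof (cases "e \<le> q (?X j w)")
    case True
    have "(LBINT z. (\<rho> z * \<psi> z) * (A j w * cos (\<omega> z * (?X j w \<bullet> b)))) =
      (LBINT z. A j w * ((\<rho> z * \<psi> z) * cos (\<omega> z * (?X j w \<bullet> b))))"
      by (simp add: mult_ac)
    also have "\<dots> = A j w * (LBINT z. (\<rho> z * \<psi> z) * cos (\<omega> z * (?X j w \<bullet> b)))" by simp
    finally show ?thesis using zero[OF True] by simp
  next
    case False
    then have "A j w = 0" unfolding A_def by (auto intro!: prod_zero bexI[of _ j])
    then show ?thesis by simp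
  qed
  define R where "R = (\<lambda>z. exp (- \<delta> * \<psi> z) - 1 + \<delta> * \<psi> z)"
  have R: "0 \<le> R z" for z
    using exp_minus_taylor_bounds(1)[of "\<delta> * \<psi> z"] \<delta> \<phi>_nonneg by (simp add: R_def)
  have [measurable]: "R \<in> borel_measurable lborel" unfolding R_def by measurable
  define I where "I = (\<lambda>z. \<integral>w. A j w * cos (\<omega> z * (?X j w \<bullet> b)) \<partial>M)"
  have [measurable]: "I \<in> borel_measurable lborel" unfolding I_def by measurable
  have Ib': "\<bar>I z\<bar> \<le> 1" for z using Ib unfolding I_def .
  have Z: "(LBINT z. (\<rho> z * \<psi> z) * I z) = 0"
    using F2 by (simp only: Az I_def) simp
  have iRr: "integrable lborel (\<lambda>z. \<rho> z * R z)" unfolding R_def by (rule remainder_integrable[OF \<delta>])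
  have iRI: "integrable lborel (\<lambda>z. \<rho> z * R z * I z)"
    by (rule Bochner_Integration.integrable_bound[OF iRr]) (use Ib' in \<open>auto simp: abs_mult mult_left_le\<close>)
  have iZ: "integrable lborel (\<lambda>z. (\<rho> z * \<psi> z) * I z)"
    by (rule Bochner_Integration.integrable_bound[OF \<rho>\<phi>]) (use Ib' in \<open>auto simp: abs_mult mult_left_le\<close>)
  have hd: "A j w * (h (?X (Suc j) w) - h (?X j w)) =
      (LBINT z. \<rho> z * (A j w * (cos (\<omega> z * (?X (Suc j) w \<bullet> b)) - cos (\<omega> z * (?X j w \<bullet> b)))))" for w
  proof -
    have "h (?X (Suc j) w) - h (?X j w) =
      (LBINT z. \<rho> z * cos (\<omega> z * (?X (Suc j) w \<bullet> b)) - \<rho> z * cos (\<omega> z * (?X j w \<bullet> b)))"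
      unfolding h by (subst Bochner_Integration.integral_diff) (auto intro!: cos_transform_integrable \<rho> \<omega>)
    then have "A j w * (h (?X (Suc j) w) - h (?X j w)) =
      (LBINT z. A j w * (\<rho> z * cos (\<omega> z * (?X (Suc j) w \<bullet> b)) - \<rho> z * cos (\<omega> z * (?X j w \<bullet> b))))"
      by (simp only: integral_mult_right_zero)
    then show ?thesis by (simp add: algebra_simps)
  qed
  have "(LINT w|M. A j w * (h (?X (Suc j) w) - h (?X j w))) =
      (LBINT z. \<rho> z * ((exp (- \<delta> * \<psi> z) - 1) * I z))"
    unfolding hd F1 E1 I_def ..
  also have "\<dots> = (LBINT z. \<rho> z * R z * I z - \<delta> * ((\<rho> z * \<psi> z) * I z))"
    by (intro Bochner_Integration.integral_cong refl) (simp add: R_def algebra_simps)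
  also have "\<dots> = (LBINT z. \<rho> z * R z * I z)"
    using iRI iZ Z by simp
  finally have "\<bar>\<integral>w. A j w * (h (?X (Suc j) w) - h (?X j w)) \<partial>M\<bar> = norm (LBINT z. \<rho> z * R z * I z)" by simp
  also have "\<dots> \<le> (LBINT z. norm (\<rho> z * R z * I z))" by (rule integral_norm_bound)
  also have "\<dots> \<le> (LBINT z. \<bar>\<rho> z\<bar> * R z)"
  proof (rule integral_mono[OF integrable_norm[OF iRI]])
    show "integrable lborel (\<lambda>z. \<bar>\<rho> z\<bar> * R z)" using integrable_norm[OF iRr] R by (simp add: abs_mult)
    show "norm (\<rho> z * R z * I z) \<le> \<bar>\<rho> z\<bar> * R z" for z
      using Ib'[of z] R[of z] by (simp add: abs_mult mult_left_le)
  qed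
  also have "\<dots> = remainder \<delta>" unfolding remainder_def R_def ..
  finally show "\<bar>\<integral>w. A j w * (h (?X (Suc j) w) - h (?X j w)) \<partial>M\<bar> \<le> remainder \<delta>" .
qed

text \<open>The product \<open>?A j\<close> includes position j, so it indicates that the hit comes
  strictly after step j. Weighted by it, the increments of h telescope up to the hit, and one error
  arises for each of the \<open>N * 2 ^ m\<close> steps.\<close>

lemma dynkin_step_hit:
  "\<bar>(LINT w|M. h (X (step_time q e N m w) w)) - h x\<bar> \<le> real N * (remainder ((1 / 2) ^ m) * 2 ^ m)"
proof -
  let ?\<delta> = "(1 / 2 :: real) ^ m" and ?J = "N * 2 ^ m"
  let ?A = "\<lambda>j w. \<Prod>i\<le>j. indicator {y. e \<le> q y} (X (real i * ?\<delta>) w) :: real"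
  let ?d = "\<lambda>j w. ?A j w * (h (X (real (Suc j) * ?\<delta>) w) - h (X (real j * ?\<delta>) w))"
  have tele: "h (X (real (step_hit q e N m w) * ?\<delta>) w) - h x = (\<Sum>j<?J. ?d j w)" for w
  proof -
    let ?s = "step_hit q e N m w"
    have A: "?A j w = (if j < ?s then 1 else 0)" if "j < ?J" for j
    proof (cases "j < ?s")
      case True
      then show ?thesis using before_step_hit[of _ q e N m w] by (auto intro!: prod.neutral)
    next
      case False
      then have "q (X (real ?s * ?\<delta>) w) < e" using step_hit_prop[of q e N m w] that by auto
      then show ?thesis using False by (auto intro!: prod_zero bexI[of _ ?s])
    qed
    have "(\<Sum>j<?J. ?d j w) = (\<Sum>j<?J. if j < ?s then h (X (real (Suc j) * ?\<delta>) w) - h (X (real j * ?\<delta>) w) else 0)"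
      by (intro sum.cong refl) (simp add: A del: of_nat_Suc)
    also have "\<dots> = (\<Sum>j<?s. h (X (real (Suc j) * ?\<delta>) w) - h (X (real j * ?\<delta>) w))"
      by (rule sum.mono_neutral_cong_right) (use step_hit_le[of q e N m w] in auto)
    also have "\<dots> = h (X (real ?s * ?\<delta>) w) - h (X (real 0 * ?\<delta>) w)"
      by (rule sum_lessThan_telescope)
    finally show ?thesis by (simp add: X_0)
  qed
  note [measurable] = h_measurable X_step_measurable[OF q order_refl, simplified]
  have ih: "integrable M (\<lambda>w. h (X (real (step_hit q e N m w) * ?\<delta>) w))"
    by (rule integrable_const_bound[where B="\<bar>c\<bar> + (LBINT z. \<bar>\<rho> z\<bar>)"]) (auto intro: h_bound)
  have "(LINT w|M. h (X (real (step_hit q e N m w) * ?\<delta>) w)) - h x =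
      (LINT w|M. h (X (real (step_hit q e N m w) * ?\<delta>) w) - h x)"
    using ih by (simp add: prob_space)
  also have "\<dots> = (\<Sum>j<?J. \<integral>w. ?d j w \<partial>M)"
    unfolding tele by (rule Bochner_Integration.integral_sum) (rule dynkin_one_step(2), simp)
  finally have "\<bar>(LINT w|M. h (X (real (step_hit q e N m w) * ?\<delta>) w)) - h x\<bar> \<le> (\<Sum>j<?J. \<bar>\<integral>w. ?d j w \<partial>M\<bar>)"
    by (simp only: sum_abs)
  also have "\<dots> \<le> (\<Sum>j<?J. remainder ?\<delta>)"
    by (intro sum_mono dynkin_one_step(1)) simp
  finally show ?thesis by (simp add: mult_ac)
qed

lemma dynkin_hit: "(LINT w|M. h (X (hit q e N w) w)) = h x"
proof -
  note [measurable] = h_measurable X_step_measurable[OF q order_refl, simplified] X_hit_measurable[OF q order_refl, simplified]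
  have L1: "(\<lambda>m. (LINT w|M. h (X (step_time q e N m w) w))) \<longlonglongrightarrow> (LINT w|M. h (X (hit q e N w) w))"
    by (rule integral_dominated_convergence[where w="\<lambda>_. \<bar>c\<bar> + (LBINT z. \<bar>\<rho> z\<bar>)"])
      (use X_step_tendsto[OF q order_refl] in \<open>auto intro!: h_tendsto h_bound\<close>)
  have L2: "(\<lambda>m. (LINT w|M. h (X (step_time q e N m w) w)) - h x) \<longlonglongrightarrow> 0"
  proof (rule Lim_null_comparison)
    show "\<forall>\<^sub>F m in sequentially. norm ((LINT w|M. h (X (step_time q e N m w) w)) - h x)
        \<le> real N * (remainder ((1 / 2) ^ m) * 2 ^ m)"
      using dynkin_step_hit by simp
    show "(\<lambda>m. real N * (remainder ((1 / 2) ^ m) * 2 ^ m)) \<longlonglongrightarrow> 0"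
      by (rule tendsto_mult_right_zero[OF remainder_tendsto])
  qed
  show ?thesis by (rule LIMSEQ_unique[OF L1 LIM_zero_cancel[OF L2]])
qed

end

end

section \<open>Exit from a bounded open set\<close>

context subordinate_paths
begin

context
  fixes U :: "'v set"
  assumes U: "open U" "bounded U"
begin

text \<open>Its superlevel sets \<open>{y. 1 / real (Suc k) \<le> depth y}\<close> are closed
  subsets that exhaust U.\<close>

definition depth :: "'v \<Rightarrow> real" where "depth y = infdist y (- U)"

text \<open>The cap k grows together with the closed set, so on a path that leaves U it eventually
  ceases to bind.\<close>

definition exhaust_time :: "nat \<Rightarrow> 'a \<Rightarrow> real" where
  "exhaust_time k = hit depth (1 / real (Suc k)) k"

lemma depth_continuous: "continuous_on UNIV depth"
  unfolding depth_def by (intro continuous_intros)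

lemma compl_nonempty: "- U \<noteq> {}"
proof
  assume "- U = {}"
  then have "U = UNIV" by blast
  then show False using U(2) not_bounded_UNIV by simp
qed

lemma depth_eq_0: "depth y = 0 \<longleftrightarrow> y \<notin> U"
  unfolding depth_def using in_closed_iff_infdist_zero[of "- U" y] U(1) compl_nonempty by auto

lemma depth_nonneg: "0 \<le> depth y"
  unfolding depth_def by (rule infdist_nonneg)

lemma exhaust_incseq: "incseq (\<lambda>k. exhaust_time k w)"
proof (rule incseq_SucI)
  fix k
  show "exhaust_time k w \<le> exhaust_time (Suc k) w"
    unfolding exhaust_time_def hit_def[of depth "1 / real (Suc (Suc k))"]
  proof (rule cInf_greatest)
    fix t assume "t \<in> insert (real (Suc k)) {t. 0 \<le> t \<and> depth (X t w) < 1 / real (Suc (Suc k))}"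
    then consider "t = real (Suc k)" | "0 \<le> t" "depth (X t w) < 1 / real (Suc (Suc k))" by auto
    then show "hit depth (1 / real (Suc k)) k w \<le> t"
    proof cases
      case 1
      then show ?thesis using hit_le[of depth "1 / real (Suc k)" k w] by simp
    next
      case 2
      have "1 / real (Suc (Suc k)) \<le> 1 / real (Suc k)" by (simp add: frac_le)
      then show ?thesis using 2 by (intro hit_lower) auto
    qed
  qed simp
qed

lemma exhaust_nonneg: "0 \<le> exhaust_time k w"
  unfolding exhaust_time_def by (rule hit_nonneg)

text \<open>For u = 0 this is a measurable candidate for the exit position. It could differ from X
  at \<open>exit_sup\<close> if the path came close to the complement of U and then jumped exactly
  at \<open>exit_sup\<close>; the shifts u > 0 are there to exclude such a jump.\<close>

definition exit_limit :: "real \<Rightarrow> 'a \<Rightarrow> 'v" where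
  "exit_limit u w = lim (\<lambda>k. X (exhaust_time k w + u) w)"

lemma X_exhaust_measurable: "0 \<le> u \<Longrightarrow> (\<lambda>w. X (exhaust_time k w + u) w) \<in> borel_measurable M"
  unfolding exhaust_time_def by (rule X_hit_measurable[OF depth_continuous])

lemma exit_limit_measurable: "0 \<le> u \<Longrightarrow> exit_limit u \<in> borel_measurable M"
  unfolding exit_limit_def by (rule borel_measurable_lim_metric) (rule X_exhaust_measurable)

definition exit_sup :: "'a \<Rightarrow> real" where
  "exit_sup w = lim (\<lambda>k. exhaust_time k w)"

context
  fixes w :: 'a and t0 :: real
  assumes t0: "0 \<le> t0" "X t0 w \<notin> U"
begin

lemma exhaust_le: "exhaust_time k w \<le> t0"
  unfolding exhaust_time_def using t0 by (intro hit_lower) (auto simp: depth_eq_0[THEN iffD2])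

lemma exhaust_tendsto: "(\<lambda>k. exhaust_time k w) \<longlonglongrightarrow> exit_sup w"
proof -
  obtain s where s: "(\<lambda>k. exhaust_time k w) \<longlonglongrightarrow> s"
    using incseq_convergent[OF exhaust_incseq, of w t0] exhaust_le by blast
  then show ?thesis unfolding exit_sup_def using limI by metis
qed

lemma exhaust_le_sup: "exhaust_time k w \<le> exit_sup w"
  by (rule incseq_le[OF exhaust_incseq exhaust_tendsto])

lemma exit_sup_nonneg: "0 \<le> exit_sup w"
  using exhaust_le_sup[of 0] exhaust_nonneg[of 0 w] by linarith

lemma before_exit_sup:
  assumes "0 \<le> t" "t < exit_sup w"
  shows "X t w \<in> U"
proof -
  have "\<forall>\<^sub>F k in sequentially. t < exhaust_time k w"
    using exhaust_tendsto assms(2) by (rule order_tendstoD)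
  then obtain k where k: "t < exhaust_time k w" using eventually_happens trivial_limit_sequentially by blast
  have "\<not> depth (X t w) < 1 / real (Suc k)"
    using hit_lower[OF assms(1), of depth w "1 / real (Suc k)" k] k unfolding exhaust_time_def by auto
  then have "depth (X t w) \<noteq> 0" by auto
  then show ?thesis by (simp add: depth_eq_0)
qed

text \<open>The clock readings increase, so they converge and B takes the limit along. With u > 0
  the shifted times eventually pass \<open>exit_sup\<close>, which yields the lower bound on the
  limiting reading.\<close>

lemma exit_limit_exists:
  assumes u: "0 \<le> u"
  shows "\<exists>s. (\<lambda>k. S (exhaust_time k w + u) w) \<longlonglongrightarrow> s \<and> s \<le> S (exit_sup w + u) w \<and> 0 \<le> s \<and>
    exit_limit u w = B s w \<and> (\<lambda>k. X (exhaust_time k w + u) w) \<longlonglongrightarrow> B s w \<and> (0 < u \<longrightarrow> S (exit_sup w) w \<le> s)"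
proof -
  obtain s where s: "(\<lambda>k. S (exhaust_time k w + u) w) \<longlonglongrightarrow> s" "s \<le> S (exit_sup w + u) w"
    "\<forall>k. S (exhaust_time k w + u) w \<le> s" "(\<lambda>k. X (exhaust_time k w + u) w) \<longlonglongrightarrow> B s w"
    using X_left_limit[of "\<lambda>k. exhaust_time k w + u" "exit_sup w + u" w] exhaust_incseq[of w]
      exhaust_nonneg[of 0 w] u exhaust_le_sup
    by (auto simp: incseq_def)
  have "0 \<le> s" using s(3)[rule_format, of 0] S_nonneg[of "exhaust_time 0 w + u" w] exhaust_nonneg[of 0 w] u by linarith
  moreover have "exit_limit u w = B s w" unfolding exit_limit_def by (rule limI[OF s(4)])
  moreover have "S (exit_sup w) w \<le> s" if "0 < u"
  proof -
    have "\<forall>\<^sub>F k in sequentially. exit_sup w - u < exhaust_time k w"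
      using exhaust_tendsto by (rule order_tendstoD) (use that in auto)
    then obtain k where "exit_sup w - u < exhaust_time k w"
      using eventually_happens trivial_limit_sequentially by blast
    then have "S (exit_sup w) w \<le> S (exhaust_time k w + u) w" by (intro S_mono exit_sup_nonneg) auto
    then show ?thesis using s(3) order_trans by blast
  qed
  ultimately show ?thesis using s by blast
qed

lemma exit_limit_tendsto: "0 \<le> u \<Longrightarrow> (\<lambda>k. X (exhaust_time k w + u) w) \<longlonglongrightarrow> exit_limit u w"
  using exit_limit_exists by metis

text \<open>Once k exceeds the given time outside U, the cap is inactive and the depth at
  \<open>exhaust_time k w\<close> is at most \<open>1 / real (Suc k)\<close>.\<close>

lemma exit_limit_notin: "exit_limit 0 w \<notin> U"
proof -
  have "(\<lambda>k. depth (X (exhaust_time k w) w)) \<longlonglongrightarrow> depth (exit_limit 0 w)"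
    using continuous_on_tendsto_compose[OF depth_continuous exit_limit_tendsto[of 0]] by simp
  moreover have "(\<lambda>k. depth (X (exhaust_time k w) w)) \<longlonglongrightarrow> 0"
  proof (rule tendsto_sandwich[OF _ _ tendsto_const LIMSEQ_inverse_real_of_nat])
    obtain k0 where k0: "t0 < real k0" using reals_Archimedean2 by blast
    show "\<forall>\<^sub>F k in sequentially. depth (X (exhaust_time k w) w) \<le> inverse (real (Suc k))"
      using eventually_ge_at_top[of k0]
    proof eventually_elim
      case (elim k)
      have "exhaust_time k w < real k" using exhaust_le[of k] k0 elim by linarith
      then have "depth (X (exhaust_time k w) w) \<le> 1 / real (Suc k)"
        unfolding exhaust_time_def by (rule hit_attained[OF depth_continuous])
      then show ?case by (simp add: inverse_eq_divide)
    qed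
  qed (simp add: depth_nonneg)
  ultimately have "depth (exit_limit 0 w) = 0" by (rule LIMSEQ_unique)
  then show ?thesis by (simp add: depth_eq_0)
qed

text \<open>The limiting clock reading is squeezed between the readings at \<open>exit_sup\<close>
  and at \<open>exit_sup\<close> plus the shift, and S is right-continuous.\<close>

lemma exit_limit_rcont: "(\<lambda>i. exit_limit (inverse (real (Suc i))) w) \<longlonglongrightarrow> X (exit_sup w) w"
proof -
  let ?u = "\<lambda>i. inverse (real (Suc i))"
  have "\<forall>i. \<exists>s. s \<le> S (exit_sup w + ?u i) w \<and> 0 \<le> s \<and> exit_limit (?u i) w = B s w \<and> S (exit_sup w) w \<le> s"
    using exit_limit_exists[of "?u _"] by fastforce
  then obtain s where s: "\<And>i. s i \<le> S (exit_sup w + ?u i) w" "\<And>i. 0 \<le> s i"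
      "\<And>i. exit_limit (?u i) w = B (s i) w" "\<And>i. S (exit_sup w) w \<le> s i"
    by metis
  have "filterlim (\<lambda>i. exit_sup w + ?u i) (at_right (exit_sup w)) sequentially"
    unfolding filterlim_at
    using tendsto_add[OF tendsto_const[of "exit_sup w"] LIMSEQ_inverse_real_of_nat]
    by (auto intro!: always_eventually)
  then have "(\<lambda>i. S (exit_sup w + ?u i) w) \<longlonglongrightarrow> S (exit_sup w) w"
    by (rule filterlim_compose[OF S_rcont[OF exit_sup_nonneg]])
  note lim = this
  have "s \<longlonglongrightarrow> S (exit_sup w) w"
    by (rule tendsto_sandwich[OF _ _ tendsto_const lim]) (use s in auto)
  then have "(\<lambda>i. B (s i) w) \<longlonglongrightarrow> B (S (exit_sup w) w) w"
    by (rule B_tendsto) (use s S_nonneg exit_sup_nonneg in auto)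
  then show ?thesis by (simp only: s(3) X_def)
qed

text \<open>Without a jump at \<open>exit_sup\<close> the path is outside U at that very time, and
  it is inside U at all earlier ones, so the minimum exists.\<close>

lemma exit_time_eq:
  assumes "X (exit_sup w) w = exit_limit 0 w"
  shows "exit_time X U w = exit_sup w"
  unfolding exit_time_def
proof (rule Least_equality)
  show "0 \<le> exit_sup w \<and> X (exit_sup w) w \<notin> U" using assms exit_limit_notin exit_sup_nonneg by simp
  show "exit_sup w \<le> t" if "0 \<le> t \<and> X t w \<notin> U" for t
    using before_exit_sup[of t] that by force
qed

end

section \<open>Quasi-left-continuity at the exit from U\<close>

lemma exits_AE: "AE w in M. \<exists>t\<ge>0. X t w \<notin> U"
proof -
  obtain R where R: "0 < R" "\<And>y. y \<in> U \<Longrightarrow> norm y \<le> R"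
    using U(2) bounded_pos by blast
  show ?thesis
    using exits_bounded[OF R(1)] by eventually_elim (use R(2) not_le in blast)
qed

lemma exit_limit_increment:
  assumes u: "0 < u" and b: "b \<in> Basis"
  shows "(LINT w|M. cos (\<xi> * ((exit_limit u w - exit_limit 0 w) \<bullet> b))) = exp (- u * \<phi> (\<xi>\<^sup>2))"
proof -
  have u0: "0 \<le> u" using u by simp
  note [measurable] = X_exhaust_measurable[OF u0] X_exhaust_measurable[OF order_refl, simplified]
    exit_limit_measurable[OF u0] exit_limit_measurable[OF order_refl]
  have "(\<lambda>k. \<integral>w. cos (\<xi> * ((X (exhaust_time k w + u) w - X (exhaust_time k w) w) \<bullet> b)) \<partial>M) \<longlonglongrightarrow>
      (LINT w|M. cos (\<xi> * ((exit_limit u w - exit_limit 0 w) \<bullet> b)))"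
  proof (rule integral_dominated_convergence[where w="\<lambda>_. 1"])
    show "AE w in M. (\<lambda>k. cos (\<xi> * ((X (exhaust_time k w + u) w - X (exhaust_time k w) w) \<bullet> b))) \<longlonglongrightarrow>
      cos (\<xi> * ((exit_limit u w - exit_limit 0 w) \<bullet> b))"
      using exits_AE
    proof eventually_elim
      case (elim w)
      then obtain t where t: "0 \<le> t" "X t w \<notin> U" by blast
      show ?case
        using exit_limit_tendsto[OF t u0] exit_limit_tendsto[OF t order_refl] by (auto intro!: tendsto_intros)
    qed
  qed auto
  moreover have "(LINT w|M. cos (\<xi> * ((X (exhaust_time k w + u) w - X (exhaust_time k w) w) \<bullet> b))) = exp (- u * \<phi> (\<xi>\<^sup>2))" for k
    unfolding exhaust_time_def by (rule hit_increment[OF depth_continuous u0 b])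
  ultimately show ?thesis by (simp add: LIMSEQ_const_iff)
qed

text \<open>Let first k tend to infinity and then u to 0: the increments after the times \<open>exhaust_time k\<close> over a span u
  turn into the possible jump at \<open>exit_sup\<close>, while their characteristic functions tend to 1.\<close>

lemma quasi_left_continuous: "AE w in M. X (exit_sup w) w = exit_limit 0 w"
proof -
  let ?u = "\<lambda>i. inverse (real (Suc i))"
  \<comment> \<open>A measurable version of the position at \<open>exit_sup\<close>.\<close>
  define Z where "Z = (\<lambda>w. lim (\<lambda>i. exit_limit (?u i) w))"
  have Lm [measurable]: "exit_limit (?u i) \<in> borel_measurable M" for i by (rule exit_limit_measurable) simp
  have L0 [measurable]: "exit_limit 0 \<in> borel_measurable M" by (rule exit_limit_measurable) simp
  have Zm [measurable]: "Z \<in> borel_measurable M" unfolding Z_def by (rule borel_measurable_lim_metric) (rule Lm)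
  have Zl: "AE w in M. (\<lambda>i. exit_limit (?u i) w) \<longlonglongrightarrow> Z w \<and> Z w = X (exit_sup w) w"
    using exits_AE
  proof eventually_elim
    case (elim w)
    then obtain t where t: "0 \<le> t" "X t w \<notin> U" by blast
    show ?case using exit_limit_rcont[OF t] limI[OF exit_limit_rcont[OF t]] by (simp add: Z_def)
  qed
  have E: "(LINT w|M. cos (\<xi> * ((Z w - exit_limit 0 w) \<bullet> b))) = 1" if b: "b \<in> Basis" for \<xi> b
  proof -
    have "(\<lambda>i. \<integral>w. cos (\<xi> * ((exit_limit (?u i) w - exit_limit 0 w) \<bullet> b)) \<partial>M) \<longlonglongrightarrow>
        (LINT w|M. cos (\<xi> * ((Z w - exit_limit 0 w) \<bullet> b)))"
    proof (rule integral_dominated_convergence[where w="\<lambda>_. 1"])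
      show "AE w in M. (\<lambda>i. cos (\<xi> * ((exit_limit (?u i) w - exit_limit 0 w) \<bullet> b))) \<longlonglongrightarrow>
         cos (\<xi> * ((Z w - exit_limit 0 w) \<bullet> b))"
        using Zl by eventually_elim (auto intro!: tendsto_intros)
    qed (auto simp del: of_nat_Suc)
    moreover have "(\<lambda>i. exp (- ?u i * \<phi> (\<xi>\<^sup>2))) \<longlonglongrightarrow> exp (- 0 * \<phi> (\<xi>\<^sup>2))"
      by (intro tendsto_intros LIMSEQ_inverse_real_of_nat)
    moreover have "(LINT w|M. cos (\<xi> * ((exit_limit (?u i) w - exit_limit 0 w) \<bullet> b))) = exp (- ?u i * \<phi> (\<xi>\<^sup>2))" for i
      by (rule exit_limit_increment[OF _ b]) simp
    ultimately show ?thesis using LIMSEQ_unique by fastforce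
  qed
  have "AE w in M. cos (\<xi> * ((Z w - exit_limit 0 w) \<bullet> b)) = 1" if b: "b \<in> Basis" for \<xi> b
  proof -
    have i: "integrable M (\<lambda>w. cos (\<xi> * ((Z w - exit_limit 0 w) \<bullet> b)))"
      by (rule integrable_const_bound[where B=1]) auto
    have "(LINT w|M. 1 - cos (\<xi> * ((Z w - exit_limit 0 w) \<bullet> b))) = 0"
      using i E[OF b] by (simp add: prob_space)
    then have "AE w in M. 1 - cos (\<xi> * ((Z w - exit_limit 0 w) \<bullet> b)) = 0"
      by (subst (asm) integral_nonneg_eq_0_iff_AE) (use i in auto)
    then show ?thesis by eventually_elim simp
  qed
  \<comment> \<open>A cosine with mean 1 equals 1 almost surely. Countably many frequencies suffice:
    one that brings the jump below 1 in absolute value forces it to be 0, since cos is strictly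
    decreasing on [0, pi].\<close>
  then have "AE w in M. \<forall>b\<in>Basis. \<forall>n. cos (inverse (real (Suc n)) * ((Z w - exit_limit 0 w) \<bullet> b)) = 1"
    by (intro AE_finite_allI finite_Basis AE_all_countable[THEN iffD2] allI) auto
  then show ?thesis using Zl
  proof eventually_elim
    case (elim w)
    have "(Z w - exit_limit 0 w) \<bullet> b = 0" if b: "b \<in> Basis" for b
    proof -
      let ?y = "(Z w - exit_limit 0 w) \<bullet> b"
      obtain n where n: "\<bar>?y\<bar> < real n" using reals_Archimedean2 by blast
      define z where "z = inverse (real (Suc n)) * ?y"
      have "\<bar>z\<bar> < 1" using n by (simp add: z_def abs_mult divide_simps)
      moreover have "cos z = 1" using elim(1) b by (simp add: z_def)
      ultimately have "z = 0"
        using cos_monotone_0_pi[of 0 "\<bar>z\<bar>"] pi_gt3 by (cases "z = 0") auto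
      then show ?thesis by (simp add: z_def)
    qed
    then have "Z w \<bullet> b = exit_limit 0 w \<bullet> b" if "b \<in> Basis" for b
      using that by (simp add: inner_diff_left)
    then have "Z w = exit_limit 0 w" by (rule euclidean_eqI)
    then show ?case using elim by simp
  qed
qed

lemma exit_position: "AE w in M. X (exit_time X U w) w = exit_limit 0 w"
  using quasi_left_continuous exits_AE
proof eventually_elim
  case (elim w)
  then obtain t where t: "0 \<le> t" "X t w \<notin> U" by blast
  show ?case using exit_time_eq[OF t elim(1)] elim(1) by simp
qed

lemma integral_exit_limit:
  fixes \<rho> \<omega> :: "real \<Rightarrow> real"
  assumes b: "b \<in> Basis" and \<rho>: "integrable lborel \<rho>" and \<omega>: "\<omega> \<in> borel_measurable borel"
    and \<rho>\<phi>: "integrable lborel (\<lambda>z. \<rho> z * \<phi> ((\<omega> z)\<^sup>2))"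
    and h: "\<And>y. h y = c + (LBINT z. \<rho> z * cos (\<omega> z * (y \<bullet> b)))"
    and zero: "\<And>y. y \<in> U \<Longrightarrow> (LBINT z. (\<rho> z * \<phi> ((\<omega> z)\<^sup>2)) * cos (\<omega> z * (y \<bullet> b))) = 0"
  shows "(LINT w|M. h (exit_limit 0 w)) = h x"
proof -
  have z: "(LBINT z. (\<rho> z * \<phi> ((\<omega> z)\<^sup>2)) * cos (\<omega> z * (y \<bullet> b))) = 0" if "1 / real (Suc k) \<le> depth y" for y k
  proof (rule zero)
    have "0 < 1 / real (Suc k)" by simp
    then have "depth y \<noteq> 0" using that by linarith
    then show "y \<in> U" by (simp add: depth_eq_0)
  qed
  have E: "(LINT w|M. h (X (exhaust_time k w) w)) = h x" for k
    unfolding exhaust_time_def by (rule dynkin_hit[OF b \<rho> \<omega> \<rho>\<phi> h depth_continuous z])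
  note [measurable] = h_measurable[OF b \<rho> \<omega> \<rho>\<phi> h depth_continuous z]
    X_exhaust_measurable[OF order_refl, simplified] exit_limit_measurable[OF order_refl]
  have "(\<lambda>k. \<integral>w. h (X (exhaust_time k w) w) \<partial>M) \<longlonglongrightarrow> (LINT w|M. h (exit_limit 0 w))"
  proof (rule integral_dominated_convergence[where w="\<lambda>_. \<bar>c\<bar> + (LBINT z. \<bar>\<rho> z\<bar>)"])
    show "AE w in M. (\<lambda>k. h (X (exhaust_time k w) w)) \<longlonglongrightarrow> h (exit_limit 0 w)"
      using exits_AE
    proof eventually_elim
      case (elim w)
      then obtain t where t: "0 \<le> t" "X t w \<notin> U" by blast
      have "(\<lambda>k. X (exhaust_time k w) w) \<longlonglongrightarrow> exit_limit 0 w"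
        using exit_limit_tendsto[OF t order_refl] by simp
      then show ?case unfolding h by (intro tendsto_intros cos_transform_tendsto \<rho> \<omega>)
    qed
  qed (auto intro!: h_bound[OF b \<rho> \<omega> \<rho>\<phi> h depth_continuous z])
  then show ?thesis unfolding E by (simp add: LIMSEQ_const_iff)
qed

end

end

section \<open>Completion and removal of null sets\<close>

lemma AE_eq_borel_measurable_completion:
  fixes f g :: "'a \<Rightarrow> real"
  assumes g: "g \<in> borel_measurable M" and ae: "AE w in M. f w = g w"
  shows "f \<in> borel_measurable (completion M)"
proof (rule measurableI)
  fix A :: "real set" assume A: "A \<in> sets borel"
  have gA: "g -` A \<inter> space (completion M) \<in> sets (completion M)"
    using measurable_sets[OF measurable_completion[OF g] A] .
  show "f -` A \<inter> space (completion M) \<in> sets (completion M)"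
  proof (rule completion.in_sets_AE[OF _ gA])
    show "AE w in completion M. (w \<in> g -` A \<inter> space (completion M)) = (w \<in> f -` A \<inter> space (completion M))"
      using AE_completion[OF ae] by eventually_elim simp
  qed auto
qed simp

lemma integral_completion_AE_eq:
  fixes f g :: "'a \<Rightarrow> real"
  assumes g: "integrable M g" and ae: "AE w in M. f w = g w"
  shows "integrable (completion M) f" "(\<integral>w. f w \<partial>completion M) = (LINT w|M. g w)"
proof -
  have gm: "g \<in> borel_measurable M" using g by auto
  note fm = AE_eq_borel_measurable_completion[OF gm ae]
  have "integrable (completion M) g" using g gm by (simp add: integrable_completion)
  then show "integrable (completion M) f"
    by (rule integrable_cong_AE_imp[OF _ fm]) (use AE_completion[OF ae] in eventually_elim, simp)
  have "(\<integral>w. f w \<partial>completion M) = (\<integral>w. g w \<partial>completion M)"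
    by (rule integral_cong_AE[OF fm measurable_completion[OF gm] AE_completion[OF ae]])
  then show "(\<integral>w. f w \<partial>completion M) = (LINT w|M. g w)"
    using gm by (simp add: integral_completion)
qed

text \<open>The exit position agrees almost surely with the measurable \<open>exit_limit\<close>, so
  its integral under the completed measure is the one computed by Dynkin's formula. This is the mean
  value property in the form that \<open>harmonic\<close> demands.\<close>

lemma exit_integral_cos_transform:
  fixes M :: "'a measure" and S :: "real \<Rightarrow> 'a \<Rightarrow> real" and B :: "real \<Rightarrow> 'a \<Rightarrow> 'v::euclidean_space"
    and \<rho> \<omega> \<phi> :: "real \<Rightarrow> real"
  assumes "subordination M S B x \<phi>" and Xdef: "\<And>t w. X t w = B (S t w) w"
    and \<phi>: "\<And>l. 0 \<le> l \<Longrightarrow> 0 \<le> \<phi> l" "\<And>l. 0 < l \<Longrightarrow> 0 < \<phi> l" "\<phi> \<in> borel_measurable borel"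
    and U: "open U" "bounded U"
    and b: "b \<in> Basis" and \<rho>: "integrable lborel \<rho>" and \<omega>: "\<omega> \<in> borel_measurable borel"
    and \<rho>\<phi>: "integrable lborel (\<lambda>z. \<rho> z * \<phi> ((\<omega> z)\<^sup>2))"
    and h: "\<And>y. h y = c + (LBINT z. \<rho> z * cos (\<omega> z * (y \<bullet> b)))"
    and zero: "\<And>y. y \<in> U \<Longrightarrow> (LBINT z. (\<rho> z * \<phi> ((\<omega> z)\<^sup>2)) * cos (\<omega> z * (y \<bullet> b))) = 0"
  shows "integrable (completion M) (\<lambda>w. h (X (exit_time X U w) w))"
    and "(\<integral>w. h (X (exit_time X U w) w) \<partial>completion M) = h x"
proof -
  interpret sub: subordination M S B x \<phi> by fact
  have "AE w in M. S 0 w = 0 \<and> mono_on {0..} (\<lambda>t. S t w) \<and> (\<forall>t\<ge>0. continuous (at_right t) (\<lambda>s. S s w)) \<and>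
      B 0 w = x \<and> continuous_on {0..} (\<lambda>t. B t w)"
    using sub.S sub.B unfolding subordinator_def double_speed_BM_def by auto
  then obtain N where N: "{w \<in> space M. \<not> (S 0 w = 0 \<and> mono_on {0..} (\<lambda>t. S t w) \<and>
      (\<forall>t\<ge>0. continuous (at_right t) (\<lambda>s. S s w)) \<and> B 0 w = x \<and> continuous_on {0..} (\<lambda>t. B t w))} \<subseteq> N"
      "emeasure M N = 0" "N \<in> sets M"
    by (rule AE_E)
  define G where "G = space M - N"
  have Gm [measurable]: "G \<in> sets M" using N by (auto simp: G_def)
  have GAE: "AE w in M. w \<in> G"
    by (rule AE_I[of _ _ N]) (use N in \<open>auto simp: G_def\<close>)
  have G: "S 0 w = 0" "mono_on {0..} (\<lambda>t. S t w)" "\<forall>t\<ge>0. continuous (at_right t) (\<lambda>s. S s w)"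
    "B 0 w = x" "continuous_on {0..} (\<lambda>t. B t w)" if "w \<in> G" for w
    using that N(1) by (auto simp: G_def)
  \<comment> \<open>On the exceptional set the clock stands still and B rests at x, so that every
    outcome has regular paths. On G nothing changes, and the exit times agree there.\<close>
  define S' where "S' = (\<lambda>t w. if w \<in> G then S t w else 0)"
  define B' where "B' = (\<lambda>t w. if w \<in> G then B t w else x)"
  define X' where "X' = (\<lambda>t w. B' (S' t w) w)"
  have X'G: "X' t w = B (S t w) w" if "w \<in> G" for t w using that by (simp add: X'_def B'_def S'_def)
  \<comment> \<open>Measurability comes from the rounded clock: X' is a limit at every outcome, not
    merely almost surely.\<close>
  have X'm: "X' t \<in> borel_measurable M" if t: "0 \<le> t" for t
  proof (rule borel_measurable_LIMSEQ_metric)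
    note [measurable] = sub.grid_process_measurable[OF t]
    show "(\<lambda>w. if w \<in> G then B (dyadic_up m (S t w)) w else x) \<in> borel_measurable M" for m
      by measurable
    show "(\<lambda>m. if w \<in> G then B (dyadic_up m (S t w)) w else x) \<longlonglongrightarrow> X' t w" for w
    proof (cases "w \<in> G")
      case True
      have "0 \<le> S t w" using G(1,2)[OF True] t mono_onD[of "{0..}" "\<lambda>t. S t w" 0 t] by simp
      then have "(\<lambda>m. B (dyadic_up m (S t w)) w) \<longlonglongrightarrow> B (S t w) w"
        by (intro continuous_on_tendsto_compose[OF G(5)[OF True] dyadic_up_tendsto])
          (auto simp: dyadic_up_nonneg)
      then show ?thesis using True by (simp add: X'G)
    qed (simp add: X'_def B'_def)
  qed
  have X'AE: "AE w in M. \<forall>t\<ge>0. X' t w = B (S t w) w" using GAE by eventually_elim (simp add: X'G)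
  interpret subordinate_paths M S' B' X' x \<phi>
  proof
    show "X' t w = B' (S' t w) w" for t w by (simp add: X'_def)
    show "S' 0 w = 0" for w by (simp add: S'_def G)
    show "S' s w \<le> S' t w" if "0 \<le> s" "s \<le> t" for s t w
      using G(2)[of w] that mono_onD[of "{0..}" "\<lambda>t. S t w" s t] by (simp add: S'_def)
    show "((\<lambda>s. S' s w) \<longlongrightarrow> S' t w) (at_right t)" if "0 \<le> t" for t w
      using G(3)[of w] that by (auto simp: S'_def continuous_within)
    show "continuous_on {0..} (\<lambda>t. B' t w)" for w using G(5)[of w] by (cases "w \<in> G") (auto simp: B'_def)
    show "B' 0 w = x" for w by (simp add: B'_def G)
    show "X' t \<in> borel_measurable M" if "0 \<le> t" for t by (rule X'm[OF that])
  qed (assumption | rule \<phi> sub.subordinate_increment[OF X'm X'AE])+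
  have h_cont: "continuous_on UNIV h"
    by (rule continuous_on_sequentiallyI) (unfold h, intro tendsto_intros cos_transform_tendsto \<rho> \<omega>, simp)
  have [measurable]: "h \<in> borel_measurable borel" by (rule borel_measurable_continuous_onI[OF h_cont])
  have [measurable]: "exit_limit U 0 \<in> borel_measurable M"
    by (rule exit_limit_measurable[OF U order_refl])
  have "\<bar>h y\<bar> \<le> \<bar>c\<bar> + (LBINT z. \<bar>\<rho> z\<bar>)" for y
    unfolding h using cos_transform_bound[OF \<rho> \<omega>, of "y \<bullet> b"] by linarith
  then have int: "integrable M (\<lambda>w. h (exit_limit U 0 w))"
    by (intro sub.integrable_const_bound[where B="\<bar>c\<bar> + (LBINT z. \<bar>\<rho> z\<bar>)"]) auto
  have ae: "AE w in M. h (X (exit_time X U w) w) = h (exit_limit U 0 w)"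
    using exit_position[OF U] GAE
  proof eventually_elim
    case (elim w)
    have "X' t w = X t w" for t using elim(2) by (simp add: X'G Xdef)
    then show ?case using elim(1) by (simp add: exit_time_def)
  qed
  show "integrable (completion M) (\<lambda>w. h (X (exit_time X U w) w))"
    by (rule integral_completion_AE_eq(1)[OF int ae])
  show "(\<integral>w. h (X (exit_time X U w) w) \<partial>completion M) = h x"
    unfolding integral_completion_AE_eq(2)[OF int ae]
    by (rule integral_exit_limit[OF U b \<rho> \<omega> \<rho>\<phi> h zero])
qed

section \<open>The exponent of the subordinator\<close>

text \<open>The law of the variables Y. Its mass and its mean are both 1, which is why the limit
  exponent is 1 + \<xi>^2 with both coefficients 1.\<close>

definition jump_density :: "real \<Rightarrow> real" where
  "jump_density u = indicator {0<..} u * (2 / 3 * min 1 (1 / u ^ 3))"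

definition jump_exponent :: "real \<Rightarrow> real" where
  "jump_exponent s = (LBINT u. (1 - exp (- s * u)) * jump_density u)"

text \<open>Level n + 1 is a compound Poisson process with rate \<open>2 ^ (Suc n)\<^sup>2\<close>
  and jumps Y shrunk by \<open>2 ^ (2 * (Suc n)\<^sup>2)\<close>.\<close>

definition levy_exponent :: "real \<Rightarrow> real" where
  "levy_exponent l = (\<Sum>n. 2 ^ (Suc n)\<^sup>2 * jump_exponent (l / 2 ^ (2 * (Suc n)\<^sup>2)))"

lemma jump_density_nonneg: "0 \<le> jump_density u"
  by (auto simp: jump_density_def indicator_def)

lemma jump_density_measurable [measurable]: "jump_density \<in> borel_measurable borel"
  unfolding jump_density_def by measurable

lemma jump_density_eq:
  "0 < u \<Longrightarrow> u \<le> 1 \<Longrightarrow> jump_density u = 2 / 3" "1 \<le> u \<Longrightarrow> jump_density u = 2 / 3 / u ^ 3"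
proof -
  show "jump_density u = 2 / 3" if "0 < u" "u \<le> 1"
    using that power_le_one[of u 3] by (auto simp: jump_density_def min_def divide_simps)
  show "jump_density u = 2 / 3 / u ^ 3" if "1 \<le> u"
  proof -
    have "1 \<le> u ^ 3" using that by (rule one_le_power)
    then have "1 / u ^ 3 \<le> 1" using that by (simp add: divide_le_eq)
    then have "min 1 (1 / u ^ 3) = 1 / u ^ 3" by (rule min_absorb2)
    then show ?thesis using that by (simp add: jump_density_def)
  qed
qed

text \<open>C and D are antiderivatives on the flat piece and on the cubic tail, D being normalised
  to vanish at infinity; the fundamental theorem applies to each piece.\<close>

lemma has_integral_jump_density_mult:
  assumes [measurable]: "c \<in> borel_measurable borel" and c: "\<And>u. 0 \<le> u \<Longrightarrow> 0 \<le> c u"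
    and C: "\<And>u. 0 \<le> u \<Longrightarrow> u \<le> 1 \<Longrightarrow> DERIV C u :> c u"
    and D: "\<And>u. 1 \<le> u \<Longrightarrow> DERIV D u :> c u / u ^ 3" "(D \<longlongrightarrow> 0) at_top"
    and val: "2 / 3 * (C 1 - C 0 - D 1) = v"
  shows "has_bochner_integral lborel (\<lambda>u. c u * jump_density u) v"
proof (rule has_bochner_integral_nn_integral)
  have CC: "0 \<le> C 1 - C 0" 
    using DERIV_nonneg_imp_nondecreasing[of 0 1 C] C c by fastforce
  have n1: "(\<integral>\<^sup>+u. ennreal (2 / 3 * c u) * indicator {0..1} u \<partial>lborel) = ennreal (2 / 3 * C 1 - 2 / 3 * C 0)"
  proof (rule nn_integral_FTC_Icc[where F="\<lambda>u. 2 / 3 * C u"])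
    show "((\<lambda>u. 2 / 3 * C u) has_real_derivative 2 / 3 * c u) (at u)" if "u \<in> {0..1}" for u
      by (rule DERIV_cmult[OF C]) (use that in auto)
  qed (auto intro: c)
  have n2: "(\<integral>\<^sup>+u. ennreal (2 / 3 * (c u / u ^ 3)) * indicator {1..} u \<partial>lborel) = ennreal (0 - 2 / 3 * D 1)"
  proof (rule nn_integral_FTC_atLeast[where F="\<lambda>u. 2 / 3 * D u"])
    show "((\<lambda>u. 2 / 3 * D u) has_real_derivative 2 / 3 * (c u / u ^ 3)) (at u)" if "1 \<le> u" for u
      by (rule DERIV_cmult[OF D(1)[OF that]])
    show "((\<lambda>u. 2 / 3 * D u) \<longlongrightarrow> 0) at_top" by (rule tendsto_mult_right_zero[OF D(2)])
    show "0 \<le> 2 / 3 * (c u / u ^ 3)" if "1 \<le> u" for u using c[of u] that by simp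
  qed measurable
  have D1: "0 \<le> - D 1"
  proof -
    have "D 1 \<le> D u" if "1 \<le> u" for u
      by (rule DERIV_nonneg_imp_nondecreasing[OF that]) (use D(1) c in \<open>force intro: divide_nonneg_pos\<close>)
    then have "\<forall>\<^sub>F u in at_top. D 1 \<le> D u" using eventually_ge_at_top[of 1] by (rule eventually_mono[rotated])
    then have "D 1 \<le> 0" by (rule tendsto_lowerbound[OF D(2)]) simp
    then show ?thesis by simp
  qed
  have "(\<integral>\<^sup>+u. ennreal (c u * jump_density u) \<partial>lborel) =
      (\<integral>\<^sup>+u. ennreal (2 / 3 * c u) * indicator {0..1} u + ennreal (2 / 3 * (c u / u ^ 3)) * indicator {1..} u \<partial>lborel)"
  proof (rule nn_integral_cong_AE)
    show "AE u in lborel. ennreal (c u * jump_density u) =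
        ennreal (2 / 3 * c u) * indicator {0..1} u + ennreal (2 / 3 * (c u / u ^ 3)) * indicator {1..} u"
      using AE_lborel_singleton[of 0] AE_lborel_singleton[of 1]
    proof eventually_elim
      case (elim u)
      then have "u < 0 \<or> (0 < u \<and> u < 1) \<or> 1 < u" by linarith
      moreover have "jump_density u = 0" if "u < 0" using that by (simp add: jump_density_def)
      ultimately show ?case
        by (elim disjE) (auto simp: jump_density_eq mult_ac)
    qed
  qed
  also have "\<dots> = ennreal (2 / 3 * C 1 - 2 / 3 * C 0) + ennreal (0 - 2 / 3 * D 1)"
    unfolding n1[symmetric] n2[symmetric] by (rule nn_integral_add) measurable
  also have "\<dots> = ennreal (2 / 3 * C 1 - 2 / 3 * C 0 + (0 - 2 / 3 * D 1))"
    by (rule ennreal_plus[symmetric]) (use CC D1 in auto)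
  also have "2 / 3 * C 1 - 2 / 3 * C 0 + (0 - 2 / 3 * D 1) = v" using val by argo
  finally show "(\<integral>\<^sup>+u. ennreal (c u * jump_density u) \<partial>lborel) = ennreal v" .
  show "0 \<le> v" using CC D1 val by argo
  show "AE u in lborel. 0 \<le> c u * jump_density u"
    using c by (auto simp: jump_density_def indicator_def)
qed measurable

lemma has_integral_jump_density: "has_bochner_integral lborel jump_density 1"
proof -
  have "has_bochner_integral lborel (\<lambda>u. 1 * jump_density u) 1"
  proof (rule has_integral_jump_density_mult[where C="\<lambda>u. u" and D="\<lambda>u. - (1 / 2) / u ^ 2"])
    show "((\<lambda>u::real. - (1 / 2) / u ^ 2) \<longlongrightarrow> 0) at_top" by real_asymp
  qed (auto intro!: derivative_eq_intros simp: divide_simps power2_eq_square power3_eq_cube)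
  then show ?thesis by simp
qed

lemma has_integral_jump_density_mean: "has_bochner_integral lborel (\<lambda>u. u * jump_density u) 1"
proof (rule has_integral_jump_density_mult[where C="\<lambda>u. u ^ 2 / 2" and D="\<lambda>u. - 1 / u"])
  show "((\<lambda>u::real. - 1 / u) \<longlongrightarrow> 0) at_top" by real_asymp
qed (auto intro!: derivative_eq_intros simp: divide_simps power2_eq_square power3_eq_cube)

lemma exponent_bounds:
  fixes s u :: real
  assumes "0 \<le> s" "0 \<le> u"
  shows "0 \<le> 1 - exp (- s * u)" "1 - exp (- s * u) \<le> 1" "1 - exp (- s * u) \<le> s * u"
  using assms exp_ge_add_one_self[of "- s * u"] by auto

lemma exponent_density_bounds:
  assumes "0 \<le> s"
  shows "0 \<le> (1 - exp (- s * u)) * jump_density u"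
    and "(1 - exp (- s * u)) * jump_density u \<le> jump_density u"
    and "(1 - exp (- s * u)) * jump_density u \<le> s * (u * jump_density u)"
proof -
  have "0 \<le> (1 - exp (- s * u)) * jump_density u \<and> (1 - exp (- s * u)) * jump_density u \<le> jump_density u
    \<and> (1 - exp (- s * u)) * jump_density u \<le> s * (u * jump_density u)"
  proof (cases "0 < u")
    case True
    then show ?thesis
      using exponent_bounds[OF assms, of u] jump_density_nonneg[of u] unfolding mult.assoc[symmetric]
      by (intro conjI mult_nonneg_nonneg mult_left_le_one_le mult_right_mono) auto
  qed (simp add: jump_density_def)
  then show "0 \<le> (1 - exp (- s * u)) * jump_density u"
    "(1 - exp (- s * u)) * jump_density u \<le> jump_density u"
    "(1 - exp (- s * u)) * jump_density u \<le> s * (u * jump_density u)"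
    by auto
qed

lemma jump_exponent_integrable:
  assumes "0 \<le> s"
  shows "integrable lborel (\<lambda>u. (1 - exp (- s * u)) * jump_density u)"
proof (rule Bochner_Integration.integrable_bound)
  show "integrable lborel jump_density" using has_integral_jump_density by (rule integrable.intros)
  show "AE u in lborel. norm ((1 - exp (- s * u)) * jump_density u) \<le> norm (jump_density u)"
    using exponent_density_bounds[OF assms] jump_density_nonneg by simp
qed measurable

lemma jump_exponent_mono:
  assumes "0 \<le> s" "s \<le> t"
  shows "jump_exponent s \<le> jump_exponent t"
  unfolding jump_exponent_def
proof (rule integral_mono)
  show "(1 - exp (- s * u)) * jump_density u \<le> (1 - exp (- t * u)) * jump_density u" for u
    using assms by (cases "0 < u") (auto simp: jump_density_nonneg jump_density_def[of u] intro!: mult_right_mono)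
qed (use assms in \<open>auto intro: jump_exponent_integrable[simplified]\<close>)

lemma jump_exponent_0: "jump_exponent 0 = 0"
  by (simp add: jump_exponent_def)

lemma jump_exponent_nonneg: "0 \<le> s \<Longrightarrow> 0 \<le> jump_exponent s"
  using jump_exponent_mono[of 0 s] by (simp add: jump_exponent_0)

lemma jump_exponent_le:
  assumes s: "0 \<le> s"
  shows "jump_exponent s \<le> 1" "jump_exponent s \<le> s"
proof -
  have i: "integrable lborel jump_density" "integrable lborel (\<lambda>u. s * (u * jump_density u))"
    using has_integral_jump_density has_integral_jump_density_mean by (auto intro: integrable.intros)
  have "jump_exponent s \<le> (LBINT u. jump_density u)"
    unfolding jump_exponent_def
    by (rule integral_mono[OF jump_exponent_integrable[OF s] i(1)]) (rule exponent_density_bounds(2)[OF s])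
  then show "jump_exponent s \<le> 1"
    using has_bochner_integral_integral_eq[OF has_integral_jump_density] by simp
  have "jump_exponent s \<le> (LBINT u. s * (u * jump_density u))"
    unfolding jump_exponent_def
    by (rule integral_mono[OF jump_exponent_integrable[OF s] i(2)]) (rule exponent_density_bounds(3)[OF s])
  then show "jump_exponent s \<le> s"
    using has_bochner_integral_integral_eq[OF has_integral_jump_density_mean] by simp
qed

text \<open>Only jumps below 1 are counted. For v = min 1 s * u in [0, 1] one has exp (- v) \<le> 1
  - v / 2, and against the density 2/3 this integrates to min 1 s / 6.\<close>

lemma jump_exponent_ge:
  assumes s: "0 \<le> s"
  shows "min 1 s / 6 \<le> jump_exponent s"
proof -
  let ?m = "min 1 s"
  have m: "0 \<le> ?m" "?m \<le> 1" "?m \<le> s" using s by auto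
  have hb: "has_bochner_integral lborel (\<lambda>u. (?m / 3 * u) * indicator {0..1} u) (?m / 6 * 1 ^ 2 - ?m / 6 * 0 ^ 2)"
    by (rule has_bochner_integral_FTC_Icc_nonneg[where F="\<lambda>u. ?m / 6 * u ^ 2"])
      (use m in \<open>auto intro!: derivative_eq_intros simp: power2_eq_square\<close>)
  have "(LBINT u. (?m / 3 * u) * indicator {0..1} u) \<le> jump_exponent s"
    unfolding jump_exponent_def
  proof (rule integral_mono[OF _ jump_exponent_integrable[OF s]])
    show "integrable lborel (\<lambda>u. (?m / 3 * u) * indicator {0..1} u)" using hb by (rule integrable.intros)
    fix u :: real
    show "(?m / 3 * u) * indicator {0..1} u \<le> (1 - exp (- s * u)) * jump_density u"
    proof (cases "0 < u \<and> u \<le> 1")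
      case True
      let ?v = "?m * u"
      have v: "0 \<le> ?v" "?v \<le> 1" using True m by (auto intro!: mult_le_one)
      have "?v \<le> s * u" using True m by (intro mult_right_mono) auto
      then have "exp (- s * u) \<le> exp (- ?v)" by simp
      also have "\<dots> \<le> 1 - ?v / 2"
      proof -
        have "exp (- ?v) * (1 + ?v) \<le> exp (- ?v) * exp ?v"
          using exp_ge_add_one_self[of ?v] by (intro mult_left_mono) auto
        then have "exp (- ?v) * (1 + ?v) \<le> 1" by (simp add: exp_minus)
        moreover have "1 \<le> (1 - ?v / 2) * (1 + ?v)"
        proof -
          have "0 \<le> ?v * (1 - ?v)" by (rule mult_nonneg_nonneg[OF v(1)]) (use v(2) in linarith)
          then show ?thesis by (simp add: algebra_simps)
        qed
        ultimately have "exp (- ?v) * (1 + ?v) \<le> (1 - ?v / 2) * (1 + ?v)" by linarith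
        then show ?thesis by (rule mult_right_le_imp_le) (use v in linarith)
      qed
      finally have "?v / 2 * (2 / 3) \<le> (1 - exp (- s * u)) * (2 / 3)" by (intro mult_right_mono) auto
      then show ?thesis using True by (simp add: jump_density_eq)
    next
      case False
      then have z: "(?m / 3 * u) * indicator {0..1} u = 0" by (cases "u = 0") auto
      show ?thesis unfolding z by (rule exponent_density_bounds(1)[OF s])
    qed
  qed
  then show ?thesis using has_bochner_integral_integral_eq[OF hb] by simp
qed

lemma jump_exponent_at_top:
  assumes s: "filterlim s at_top sequentially"
  shows "(\<lambda>n. jump_exponent (s n)) \<longlonglongrightarrow> 1"
proof -
  have pos: "\<forall>\<^sub>F n in sequentially. 0 \<le> s n" using s by (simp add: filterlim_at_top)
  \<comment> \<open>Truncation at 0 gives domination for every index, although s is nonnegative only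
    eventually.\<close>
  define s' where "s' = (\<lambda>n. max 0 (s n))"
  have eq: "\<forall>\<^sub>F n in sequentially. s n = s' n" using pos by eventually_elim (simp add: s'_def)
  have s': "filterlim s' at_top sequentially" using filterlim_cong[OF refl refl eq] s by simp
  have "(\<lambda>n. jump_exponent (s' n)) \<longlonglongrightarrow> (LBINT u. jump_density u)"
    unfolding jump_exponent_def
  proof (rule integral_dominated_convergence[where w=jump_density])
    show "AE u in lborel. (\<lambda>n. (1 - exp (- s' n * u)) * jump_density u) \<longlonglongrightarrow> jump_density u"
    proof (intro AE_I2)
      fix u
      show "(\<lambda>n. (1 - exp (- s' n * u)) * jump_density u) \<longlonglongrightarrow> jump_density u"
      proof (cases "0 < u")
        case True
        have "filterlim (\<lambda>n. s' n * u) at_top sequentially"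
          by (rule filterlim_at_top_mult_tendsto_pos[OF tendsto_const True s'])
        then have "filterlim (\<lambda>n. - (s' n * u)) at_bot sequentially"
          by (simp add: filterlim_uminus_at_bot)
        then have "(\<lambda>n. exp (- s' n * u)) \<longlonglongrightarrow> 0" using filterlim_compose[OF exp_at_bot] by fastforce
        then have "(\<lambda>n. (1 - exp (- s' n * u)) * jump_density u) \<longlonglongrightarrow> (1 - 0) * jump_density u"
          by (intro tendsto_intros)
        then show ?thesis by simp
      qed (simp add: jump_density_def)
    qed
    show "AE u in lborel. norm ((1 - exp (- s' n * u)) * jump_density u) \<le> jump_density u" for n
      using exponent_density_bounds(1,2)[of "s' n"] by (simp add: s'_def)
    show "integrable lborel jump_density" using has_integral_jump_density by (rule integrable.intros)
  qed measurable
  then have "(\<lambda>n. jump_exponent (s' n)) \<longlonglongrightarrow> 1"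
    using has_bochner_integral_integral_eq[OF has_integral_jump_density] by simp
  moreover have "\<forall>\<^sub>F n in sequentially. jump_exponent (s' n) = jump_exponent (s n)"
    using eq by eventually_elim simp
  ultimately show ?thesis by (rule Lim_transform_eventually)
qed

text \<open>The derivative at 0 is the mean of the jump law; \<open>u * jump_density u\<close>
  dominates the difference quotients.\<close>

lemma jump_exponent_at_0:
  assumes s: "s \<longlonglongrightarrow> 0" and pos: "\<And>n. 0 < s n"
  shows "(\<lambda>n. jump_exponent (s n) / s n) \<longlonglongrightarrow> 1"
proof -
  have s_neq: "s n \<noteq> 0" for n using pos[of n] by simp
  have eq: "jump_exponent (s n) / s n = (LBINT u. ((1 - exp (- s n * u)) / s n) * jump_density u)" for n
    unfolding jump_exponent_def by simp
  have "(\<lambda>n. \<integral>u. ((1 - exp (- s n * u)) / s n) * jump_density u \<partial>lborel) \<longlonglongrightarrow> (LBINT u. u * jump_density u)"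
  proof (rule integral_dominated_convergence[where w="\<lambda>u. u * jump_density u"])
    show "AE u in lborel. (\<lambda>n. (1 - exp (- s n * u)) / s n * jump_density u) \<longlonglongrightarrow> u * jump_density u"
    proof (intro AE_I2 tendsto_mult tendsto_const)
      fix u :: real
      have "((\<lambda>x. 1 - exp (- x * u)) has_real_derivative u) (at 0)"
        by (auto intro!: derivative_eq_intros)
      then have "((\<lambda>h. (1 - exp (- h * u)) / h) \<longlongrightarrow> u) (at 0)"
        unfolding DERIV_def by simp
      moreover have "filterlim s (at 0) sequentially"
        unfolding filterlim_at using s s_neq by (auto intro!: always_eventually)
      ultimately show "(\<lambda>n. (1 - exp (- s n * u)) / s n) \<longlonglongrightarrow> u" by (rule filterlim_compose)
    qed
    show "AE u in lborel. norm ((1 - exp (- s n * u)) / s n * jump_density u) \<le> u * jump_density u" for n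
    proof (intro AE_I2)
      fix u
      let ?e = "(1 - exp (- s n * u)) * jump_density u"
      have "0 \<le> ?e" "?e \<le> s n * (u * jump_density u)"
        using exponent_density_bounds(1,3)[of "s n" u] pos[of n] by auto
      then have "\<bar>?e / s n\<bar> \<le> u * jump_density u"
        using pos[of n] by (simp add: abs_of_nonneg pos_divide_le_eq mult.commute[of _ "s n"])
      then show "norm ((1 - exp (- s n * u)) / s n * jump_density u) \<le> u * jump_density u" by simp
    qed
    show "integrable lborel (\<lambda>u. u * jump_density u)" using has_integral_jump_density_mean by (rule integrable.intros)
  qed measurable
  then show ?thesis
    unfolding eq has_bochner_integral_integral_eq[OF has_integral_jump_density_mean] .
qed

lemma jump_exponent_measurable [measurable]: "jump_exponent \<in> borel_measurable borel"
  unfolding jump_exponent_def by measurable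

lemma levy_exponent_measurable: "levy_exponent \<in> borel_measurable borel"
  unfolding levy_exponent_def by measurable

section \<open>The exponent of the whole subordinator\<close>

lemma levy_term_nonneg: "0 \<le> l \<Longrightarrow> 0 \<le> 2 ^ (Suc n)\<^sup>2 * jump_exponent (l / 2 ^ (2 * (Suc n)\<^sup>2))"
  by (intro mult_nonneg_nonneg jump_exponent_nonneg) auto

lemma levy_term_le:
  assumes "0 \<le> l"
  shows "2 ^ (Suc n)\<^sup>2 * jump_exponent (l / 2 ^ (2 * (Suc n)\<^sup>2)) \<le> l / 2 ^ (Suc n)\<^sup>2"
proof -
  let ?a = "(Suc n)\<^sup>2"
  have "2 ^ ?a * jump_exponent (l / 2 ^ (2 * ?a)) \<le> 2 ^ ?a * (l / 2 ^ (2 * ?a))"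
    using assms by (intro mult_left_mono jump_exponent_le(2)) auto
  also have "\<dots> = l / 2 ^ ?a" by (simp add: mult_2 power_add)
  finally show ?thesis .
qed

lemma levy_summable:
  assumes "0 \<le> l"
  shows "summable (\<lambda>n. 2 ^ (Suc n)\<^sup>2 * jump_exponent (l / 2 ^ (2 * (Suc n)\<^sup>2)))"
proof (rule summable_comparison_test')
  show "summable (\<lambda>n. l * (1 / 2) ^ n)" by (intro summable_mult summable_geometric) auto
  fix n :: nat
  have "n \<le> (Suc n)\<^sup>2" by (simp add: power2_eq_square)
  then have "(2::real) ^ n \<le> 2 ^ (Suc n)\<^sup>2" by (intro power_increasing) auto
  then have "l / 2 ^ (Suc n)\<^sup>2 \<le> l / 2 ^ n" using assms by (intro divide_left_mono) auto
  then have "2 ^ (Suc n)\<^sup>2 * jump_exponent (l / 2 ^ (2 * (Suc n)\<^sup>2)) \<le> l / 2 ^ n"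
    using levy_term_le[OF assms, of n] by linarith
  then show "norm (2 ^ (Suc n)\<^sup>2 * jump_exponent (l / 2 ^ (2 * (Suc n)\<^sup>2))) \<le> l * (1 / 2) ^ n"
    using levy_term_nonneg[OF assms, of n] by (simp add: power_one_over)
qed

lemma levy_exponent_0: "levy_exponent 0 = 0"
  by (simp add: levy_exponent_def jump_exponent_0)

lemma levy_exponent_nonneg: "0 \<le> l \<Longrightarrow> 0 \<le> levy_exponent l"
  unfolding levy_exponent_def by (rule suminf_nonneg[OF levy_summable levy_term_nonneg])

lemma levy_exponent_pos:
  assumes "0 < l"
  shows "0 < levy_exponent l"
  unfolding levy_exponent_def
proof (rule suminf_pos2[where i=0])
  show "0 < 2 ^ (Suc 0)\<^sup>2 * jump_exponent (l / 2 ^ (2 * (Suc 0)\<^sup>2))"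
    using jump_exponent_ge[of "l / 2 ^ 2"] assms by simp
qed (use assms levy_summable[of l] levy_term_nonneg[of l] in auto)

lemma nn_integral_jump_scaled:
  assumes l: "0 \<le> l" and c: "0 < c"
  shows "(\<integral>\<^sup>+u. ennreal (c * ((1 - exp (- l * u)) * jump_density (c * u))) \<partial>lborel) = ennreal (jump_exponent (l / c))"
proof -
  let ?F = "\<lambda>v. (1 - exp (- (l / c) * v)) * jump_density v"
  have lc: "0 \<le> l / c" using l c by simp
  have "ennreal (jump_exponent (l / c)) = (\<integral>\<^sup>+v. ennreal (?F v) \<partial>lborel)"
    unfolding jump_exponent_def
    by (rule nn_integral_eq_integral[symmetric, OF jump_exponent_integrable[OF lc]]) (use exponent_density_bounds(1)[OF lc] in simp)
  also have "\<dots> = ennreal \<bar>c\<bar> * (\<integral>\<^sup>+u. ennreal (?F (0 + c * u)) \<partial>lborel)"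
    by (rule nn_integral_real_affine) (use c in auto)
  also have "\<dots> = (\<integral>\<^sup>+u. ennreal \<bar>c\<bar> * ennreal (?F (0 + c * u)) \<partial>lborel)"
    by (rule nn_integral_cmult[symmetric]) measurable
  also have "\<dots> = (\<integral>\<^sup>+u. ennreal (c * ((1 - exp (- l * u)) * jump_density (c * u))) \<partial>lborel)"
    using c by (intro nn_integral_cong) (simp add: ennreal_mult'[symmetric])
  finally show ?thesis ..
qed

text \<open>All integrands are nonnegative, so in extended reals the sum over the levels and the
  integral commute; each level is then rescaled to the common jump density.\<close>

lemma Levy_mu_exponent:
  assumes l: "0 < l"
  shows "(LINT u:{0<..}|Levy_mu. 1 - exp (- l * u)) = levy_exponent l"
proof -
  have l0: "0 \<le> l" using l by simp
  let ?a = "\<lambda>n. (Suc n)\<^sup>2" and ?f = "\<lambda>u. indicator {0<..} u *\<^sub>R (1 - exp (- l * u)) :: real"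
  let ?t = "\<lambda>n u. 2 ^ (?a n) * (2 ^ (2 * ?a n) * ((1 - exp (- l * u)) * jump_density (2 ^ (2 * ?a n) * u)))"
  let ?d = "\<lambda>t::real. indicator {0<..} t * (ennreal (2 / 3) * (\<Sum>n. ennreal
        (2 ^ (3 * (Suc n)\<^sup>2) * min 1 ((2 ^ (2 * (Suc n)\<^sup>2) * t) powi (- 3)))))"
  have powi: "u powi (- 3) = 1 / u ^ 3" for u :: real by (simp add: power_int_minus divide_inverse)
  have dm [measurable]: "?d \<in> borel_measurable borel" unfolding powi by measurable
  have f0: "0 \<le> ?f u" for u using exponent_bounds(1)[OF l0, of u] by (auto simp: indicator_def)
  have pt: "?d u * ennreal (?f u) = (\<Sum>n. ennreal (?t n u))" for u
  proof (cases "0 < u")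
    case True
    have e0: "0 \<le> 1 - exp (- l * u)" using exponent_bounds(1)[OF l0, of u] True by simp
    have "ennreal (?t n u) = (ennreal (2 / 3) * ennreal (1 - exp (- l * u))) *
        ennreal (2 ^ (3 * ?a n) * min 1 ((2 ^ (2 * ?a n) * u) powi (- 3)))" for n
    proof -
      \<comment> \<open>The exponent 3 splits as 1 + 2: the rate of the level and the Jacobian of
        its scaling.\<close>
      have "(2::real) ^ (3 * ?a n) = 2 ^ (?a n) * 2 ^ (2 * ?a n)" by (simp flip: power_add)
      then have "?t n u = 2 / 3 * (1 - exp (- l * u)) * (2 ^ (3 * ?a n) * min 1 ((2 ^ (2 * ?a n) * u) powi (- 3)))"
        using True by (simp add: jump_density_def powi)
      then have "ennreal (?t n u) = ennreal (2 / 3 * (1 - exp (- l * u))) * ennreal (2 ^ (3 * ?a n) * min 1 ((2 ^ (2 * ?a n) * u) powi (- 3)))"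
        using e0 by (simp only:) (rule ennreal_mult', simp)
      also have "ennreal (2 / 3 * (1 - exp (- l * u))) = ennreal (2 / 3) * ennreal (1 - exp (- l * u))"
        by (rule ennreal_mult') simp
      finally show ?thesis .
    qed
    then show ?thesis using True by (simp add: ennreal_suminf_cmult mult_ac)
  next
    case False
    then have "jump_density (2 ^ (2 * ?a n) * u) = 0" for n
      by (simp add: jump_density_def zero_less_mult_iff)
    then show ?thesis using False by simp
  qed
  have "(\<integral>\<^sup>+u. ennreal (?f u) \<partial>Levy_mu) = (\<integral>\<^sup>+u. ?d u * ennreal (?f u) \<partial>lborel)"
    unfolding Levy_mu_def by (rule nn_integral_density) (use dm in measurable)
  also have "\<dots> = (\<Sum>n. \<integral>\<^sup>+u. ennreal (?t n u) \<partial>lborel)"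
    unfolding pt by (rule nn_integral_suminf) measurable
  also have "\<dots> = (\<Sum>n. ennreal (2 ^ (?a n) * jump_exponent (l / 2 ^ (2 * ?a n))))"
  proof (rule suminf_cong)
    fix n
    have "(\<integral>\<^sup>+u. ennreal (?t n u) \<partial>lborel) =
      (\<integral>\<^sup>+u. ennreal (2 ^ (?a n)) * ennreal (2 ^ (2 * ?a n) * ((1 - exp (- l * u)) * jump_density (2 ^ (2 * ?a n) * u))) \<partial>lborel)"
      by (intro nn_integral_cong ennreal_mult') simp
    also have "\<dots> = ennreal (2 ^ (?a n)) * (\<integral>\<^sup>+u. ennreal (2 ^ (2 * ?a n) * ((1 - exp (- l * u)) * jump_density (2 ^ (2 * ?a n) * u))) \<partial>lborel)"
      by (rule nn_integral_cmult) measurable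
    also have "\<dots> = ennreal (2 ^ (?a n) * jump_exponent (l / 2 ^ (2 * ?a n)))"
      using nn_integral_jump_scaled[OF l0, of "2 ^ (2 * ?a n)"] by (simp add: ennreal_mult')
    finally show "(\<integral>\<^sup>+u. ennreal (?t n u) \<partial>lborel) = ennreal (2 ^ (?a n) * jump_exponent (l / 2 ^ (2 * ?a n)))" .
  qed
  also have "\<dots> = ennreal (levy_exponent l)"
    unfolding levy_exponent_def by (rule suminf_ennreal2[OF levy_term_nonneg[OF l0] levy_summable[OF l0]])
  finally have nn: "(\<integral>\<^sup>+u. ennreal (?f u) \<partial>Levy_mu) = ennreal (levy_exponent l)" .
  have "(LINT u:{0<..}|Levy_mu. 1 - exp (- l * u)) = enn2real (\<integral>\<^sup>+u. ennreal (?f u) \<partial>Levy_mu)"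
    unfolding set_lebesgue_integral_def
    by (rule integral_eq_nn_integral) (use f0 in \<open>auto simp: Levy_mu_def\<close>)
  then show ?thesis using nn levy_exponent_nonneg[OF l0] by simp
qed

text \<open>The levels \<open>n + 1\<close> and \<open>n + 2\<close> are balanced at the squared frequency \<open>2 ^ ((n + 1)\<^sup>2 + (n + 2)\<^sup>2)\<close>:
  there the first one acts as killing at unit rate and the second one as the Laplacian.\<close>

definition scaled_exponent :: "nat \<Rightarrow> real \<Rightarrow> real" where
  "scaled_exponent n \<xi> = levy_exponent (\<xi>\<^sup>2 * 2 ^ ((Suc n)\<^sup>2 + (Suc (Suc n))\<^sup>2)) / 2 ^ (Suc n)\<^sup>2"

definition scaled_term :: "nat \<Rightarrow> real \<Rightarrow> nat \<Rightarrow> real" where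
  "scaled_term n \<xi> m = 2 ^ (Suc m)\<^sup>2 *
     jump_exponent (\<xi>\<^sup>2 * 2 ^ ((Suc n)\<^sup>2 + (Suc (Suc n))\<^sup>2) / 2 ^ (2 * (Suc m)\<^sup>2)) / 2 ^ (Suc n)\<^sup>2"

lemma scaled_summable: "summable (scaled_term n \<xi>)"
  unfolding scaled_term_def by (rule summable_divide[OF levy_summable]) simp

lemma scaled_exponent_eq: "scaled_exponent n \<xi> = suminf (scaled_term n \<xi>)"
  unfolding scaled_exponent_def scaled_term_def levy_exponent_def
  by (rule suminf_divide[symmetric, OF levy_summable]) simp

lemma scaled_term_nonneg: "0 \<le> scaled_term n \<xi> m"
  unfolding scaled_term_def by (intro divide_nonneg_nonneg levy_term_nonneg) auto

text \<open>The gap \<open>2 * n + 3\<close> between consecutive squares separates the scales. It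
  grows with n, so the killing level sees an argument tending to infinity and the diffusive level
  one tending to 0.\<close>

lemma square_Suc_Suc: "(Suc (Suc n))\<^sup>2 = (Suc n)\<^sup>2 + (2 * n + 3)"
  by (simp add: power2_eq_square)

lemma scaled_term_killing: "scaled_term n \<xi> n = jump_exponent (\<xi>\<^sup>2 * 2 ^ (2 * n + 3))"
  unfolding scaled_term_def square_Suc_Suc mult_2[of "(Suc n)\<^sup>2"] power_add by simp

lemma scaled_term_diffusion: "scaled_term n \<xi> (Suc n) = 2 ^ (2 * n + 3) * jump_exponent (\<xi>\<^sup>2 / 2 ^ (2 * n + 3))"
  unfolding scaled_term_def square_Suc_Suc mult_2[of "_ + _"] power_add by (simp add: mult_ac)

text \<open>These levels jump too rarely: bounding \<open>jump_exponent\<close> by 1 leaves the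
  ratio of their rate to the killing rate.\<close>

lemma scaled_term_low:
  assumes "m < n"
  shows "scaled_term n \<xi> m \<le> (1 / 2) ^ (2 * n + 1)"
proof -
  have "(Suc m)\<^sup>2 + (2 * n + 1) \<le> n\<^sup>2 + (2 * n + 1)" using assms by (simp add: power_mono)
  also have "\<dots> = (Suc n)\<^sup>2" by (simp add: power2_eq_square)
  finally have "(2::real) ^ ((Suc m)\<^sup>2 + (2 * n + 1)) \<le> 2 ^ (Suc n)\<^sup>2" by (intro power_increasing) auto
  then have p: "2 ^ (Suc m)\<^sup>2 / 2 ^ (Suc n)\<^sup>2 \<le> (1 / 2 :: real) ^ (2 * n + 1)"
    unfolding power_add[of _ "(Suc m)\<^sup>2"] by (simp add: power_one_over divide_simps)
  have "scaled_term n \<xi> m \<le> 2 ^ (Suc m)\<^sup>2 * 1 / 2 ^ (Suc n)\<^sup>2"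
    unfolding scaled_term_def by (intro divide_right_mono mult_left_mono jump_exponent_le(1)) auto
  then show ?thesis using p unfolding mult_1_right by linarith
qed

text \<open>These levels jump too little: the linear bound on \<open>jump_exponent\<close> leaves
  the ratio of their diffusivity to that of the diffusive level.\<close>

lemma scaled_term_high: "scaled_term n \<xi> (j + (n + 2)) \<le> \<xi>\<^sup>2 * (1 / 2) ^ (2 * n + 3) * (1 / 2) ^ j"
proof -
  let ?c = "(Suc (j + (n + 2)))\<^sup>2" and ?a = "(Suc n)\<^sup>2" and ?b = "(Suc (Suc n))\<^sup>2"
  have "?b + (2 * n + 3) + j \<le> ?c" by (simp add: power2_eq_square algebra_simps)
  then have "(2::real) ^ (?b + (2 * n + 3) + j) \<le> 2 ^ ?c" by (intro power_increasing) auto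
  then have p: "2 ^ ?b / 2 ^ ?c \<le> (1 / 2 :: real) ^ (2 * n + 3) * (1 / 2) ^ j"
    unfolding power_add[of _ _ j] power_add[of _ ?b] by (simp add: power_one_over divide_simps mult_ac)
  have "scaled_term n \<xi> (j + (n + 2)) \<le> 2 ^ ?c * (\<xi>\<^sup>2 * 2 ^ (?a + ?b) / 2 ^ (2 * ?c)) / 2 ^ ?a"
    unfolding scaled_term_def by (intro divide_right_mono mult_left_mono jump_exponent_le(2)) auto
  also have "\<dots> = \<xi>\<^sup>2 * (2 ^ ?b / 2 ^ ?c)"
    unfolding mult_2[of ?c] power_add by simp
  also have "\<dots> \<le> \<xi>\<^sup>2 * ((1 / 2 :: real) ^ (2 * n + 3) * (1 / 2) ^ j)"
    by (rule mult_left_mono[OF p]) simp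
  finally show ?thesis by (simp add: mult.assoc)
qed

lemma scaled_exponent_split:
  "scaled_exponent n \<xi> = (\<Sum>j. scaled_term n \<xi> (j + (n + 2))) + (\<Sum>m<n. scaled_term n \<xi> m)
     + scaled_term n \<xi> n + scaled_term n \<xi> (Suc n)"
  unfolding scaled_exponent_eq using suminf_split_initial_segment[OF scaled_summable, of n \<xi> "n + 2"] by simp

text \<open>The killing level alone gives this bound. Being uniform in n, it provides the dominating
  function for the passage to the limit.\<close>

lemma scaled_exponent_ge: "min 1 (\<xi>\<^sup>2) / 6 \<le> scaled_exponent n \<xi>"
proof -
  have "(1::real) \<le> 2 ^ (2 * n + 3)" by (rule one_le_power) simp
  then have "\<xi>\<^sup>2 * 1 \<le> \<xi>\<^sup>2 * 2 ^ (2 * n + 3)" by (rule mult_left_mono) simp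
  then have "jump_exponent (\<xi>\<^sup>2) \<le> scaled_term n \<xi> n"
    unfolding scaled_term_killing by (intro jump_exponent_mono) auto
  moreover have "0 \<le> (\<Sum>j. scaled_term n \<xi> (j + (n + 2)))"
    by (rule suminf_nonneg[OF summable_ignore_initial_segment[OF scaled_summable] scaled_term_nonneg])
  moreover have "0 \<le> (\<Sum>m<n. scaled_term n \<xi> m)" by (rule sum_nonneg) (rule scaled_term_nonneg)
  ultimately show ?thesis
    using scaled_exponent_split[of n \<xi>] scaled_term_nonneg[of n \<xi> "Suc n"] jump_exponent_ge[of "\<xi>\<^sup>2"] by simp
qed

text \<open>At \<xi> = 0 every exponent vanishes while 1 + \<xi>^2 is 1. Frequencies near 0 must
  therefore be controlled by the test function and not by this convergence.\<close>

lemma scaled_exponent_tendsto: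
  assumes \<xi>: "\<xi> \<noteq> 0"
  shows "(\<lambda>n. scaled_exponent n \<xi>) \<longlonglongrightarrow> 1 + \<xi>\<^sup>2"
proof -
  have x2: "0 < \<xi>\<^sup>2" using \<xi> by simp
  have A: "(\<lambda>n. \<Sum>j. scaled_term n \<xi> (j + (n + 2))) \<longlonglongrightarrow> 0"
  proof (rule tendsto_sandwich[OF _ _ tendsto_const])
    show "\<forall>\<^sub>F n in sequentially. 0 \<le> (\<Sum>j. scaled_term n \<xi> (j + (n + 2)))"
      by (intro always_eventually allI suminf_nonneg summable_ignore_initial_segment scaled_summable scaled_term_nonneg)
    show "\<forall>\<^sub>F n in sequentially. (\<Sum>j. scaled_term n \<xi> (j + (n + 2))) \<le> \<xi>\<^sup>2 * (1 / 2) ^ (2 * n + 3) * 2"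
    proof (intro always_eventually allI)
      fix n
      have g: "(\<lambda>j. (1 / 2 :: real) ^ j) sums 2" using geometric_sums[of "1 / 2 :: real"] by simp
      have "(\<Sum>j. scaled_term n \<xi> (j + (n + 2))) \<le> (\<Sum>j. \<xi>\<^sup>2 * (1 / 2) ^ (2 * n + 3) * (1 / 2) ^ j)"
        by (intro suminf_le scaled_term_high summable_ignore_initial_segment scaled_summable summable_mult sums_summable[OF g])
      also have "\<dots> = \<xi>\<^sup>2 * (1 / 2) ^ (2 * n + 3) * 2"
        using sums_unique[OF sums_mult[OF g, of "\<xi>\<^sup>2 * (1 / 2) ^ (2 * n + 3)"]] by simp
      finally show "(\<Sum>j. scaled_term n \<xi> (j + (n + 2))) \<le> \<xi>\<^sup>2 * (1 / 2) ^ (2 * n + 3) * 2" .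
    qed
    show "(\<lambda>n. \<xi>\<^sup>2 * (1 / 2) ^ (2 * n + 3) * 2) \<longlonglongrightarrow> 0" by real_asymp
  qed
  have B: "(\<lambda>n. \<Sum>m<n. scaled_term n \<xi> m) \<longlonglongrightarrow> 0"
  proof (rule tendsto_sandwich[OF _ _ tendsto_const])
    show "\<forall>\<^sub>F n in sequentially. 0 \<le> (\<Sum>m<n. scaled_term n \<xi> m)"
      by (intro always_eventually allI sum_nonneg scaled_term_nonneg)
    show "\<forall>\<^sub>F n in sequentially. (\<Sum>m<n. scaled_term n \<xi> m) \<le> real n * (1 / 2) ^ (2 * n + 1)"
    proof (intro always_eventually allI)
      fix n
      have "(\<Sum>m<n. scaled_term n \<xi> m) \<le> (\<Sum>m<n. (1 / 2) ^ (2 * n + 1))"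
        by (intro sum_mono scaled_term_low) auto
      then show "(\<Sum>m<n. scaled_term n \<xi> m) \<le> real n * (1 / 2) ^ (2 * n + 1)" by simp
    qed
    show "(\<lambda>n. real n * (1 / 2) ^ (2 * n + 1)) \<longlonglongrightarrow> 0" by real_asymp
  qed
  have C: "(\<lambda>n. scaled_term n \<xi> n) \<longlonglongrightarrow> 1"
    unfolding scaled_term_killing
  proof (rule jump_exponent_at_top)
    show "filterlim (\<lambda>n. \<xi>\<^sup>2 * 2 ^ (2 * n + 3)) at_top sequentially" using x2 by real_asymp
  qed
  have D: "(\<lambda>n. scaled_term n \<xi> (Suc n)) \<longlonglongrightarrow> \<xi>\<^sup>2 * 1"
  proof -
    have "(\<lambda>n. jump_exponent (\<xi>\<^sup>2 / 2 ^ (2 * n + 3)) / (\<xi>\<^sup>2 / 2 ^ (2 * n + 3))) \<longlonglongrightarrow> 1"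
    proof (rule jump_exponent_at_0)
      show "(\<lambda>n. \<xi>\<^sup>2 / 2 ^ (2 * n + 3)) \<longlonglongrightarrow> 0" by real_asymp
    qed (use x2 in simp)
    then have "(\<lambda>n. \<xi>\<^sup>2 * (jump_exponent (\<xi>\<^sup>2 / 2 ^ (2 * n + 3)) / (\<xi>\<^sup>2 / 2 ^ (2 * n + 3)))) \<longlonglongrightarrow> \<xi>\<^sup>2 * 1"
      by (rule tendsto_mult_left)
    also have "(\<lambda>n. \<xi>\<^sup>2 * (jump_exponent (\<xi>\<^sup>2 / 2 ^ (2 * n + 3)) / (\<xi>\<^sup>2 / 2 ^ (2 * n + 3)))) = (\<lambda>n. scaled_term n \<xi> (Suc n))"
      using \<xi> by (simp add: scaled_term_diffusion field_simps)
    finally show ?thesis .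
  qed
  show ?thesis
    unfolding scaled_exponent_split using tendsto_add[OF tendsto_add[OF tendsto_add[OF A B] C] D] by simp
qed

section \<open>The limit problem\<close>

lemma integrable_cauchy_kernel: "integrable lborel (\<lambda>x::real. K / (1 + x\<^sup>2))"
  using integrable_inverse_1_plus_square
  by (auto simp: set_integrable_def divide_inverse)

lemma one_minus_cos_le: "1 - cos (x::real) \<le> x\<^sup>2 / 2"
proof -
  have "\<bar>sin (x / 2)\<bar>\<^sup>2 \<le> \<bar>x / 2\<bar>\<^sup>2" by (rule power_mono[OF abs_sin_x_le_abs_x]) simp
  then show ?thesis using cos_double_sin[of "x / 2"] by (simp add: power_divide)
qed

lemma cos_quartic_bound: "\<bar>1 - cos x - x\<^sup>2 / 2\<bar> \<le> (x::real) ^ 4 / 24"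
proof -
  obtain t where t: "cos x = (\<Sum>m<4. cos_coeff m * x ^ m) + (cos (t + 1 / 2 * real 4 * pi) / fact 4) * x ^ 4"
    using Maclaurin_cos_expansion[of x 4] by blast
  have s: "(\<Sum>m<4. cos_coeff m * x ^ m) = 1 - x\<^sup>2 / 2"
  proof -
    have "{..<4::nat} = {0, 1, 2, 3}" by auto
    then show ?thesis by (simp add: cos_coeff_def)
  qed
  have "\<bar>(cos (t + 1 / 2 * real 4 * pi) / fact 4) * x ^ 4\<bar> = \<bar>cos (t + 1 / 2 * real 4 * pi)\<bar> * (x ^ 4 / 24)"
    by (simp add: abs_mult fact_numeral)
  also have "\<dots> \<le> 1 * (x ^ 4 / 24)" by (intro mult_right_mono) auto
  finally show ?thesis using t s by simp
qed

lemma cos_kernel_integrable: "integrable lborel (\<lambda>u::real. (1 - cos (x * u)) / u\<^sup>2)"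
\<comment> \<open>Near 0 the quadratic bound on 1 - cos counts, for large u the bound 2;
  \<open>x\<^sup>2 + 4\<close> covers both together.\<close>
proof (rule Bochner_Integration.integrable_bound[OF integrable_cauchy_kernel[of "x\<^sup>2 + 4"]])
  show "AE u in lborel. norm ((1 - cos (x * u)) / u\<^sup>2) \<le> norm ((x\<^sup>2 + 4) / (1 + u\<^sup>2))"
  proof (intro AE_I2)
    fix u :: real
    show "norm ((1 - cos (x * u)) / u\<^sup>2) \<le> norm ((x\<^sup>2 + 4) / (1 + u\<^sup>2))"
    proof (cases "u = 0")
      case False
      then have u: "0 < u\<^sup>2" by simp
      have c: "0 \<le> 1 - cos (x * u)" "1 - cos (x * u) \<le> 2" "1 - cos (x * u) \<le> x\<^sup>2 * u\<^sup>2 / 2"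
        using one_minus_cos_le[of "x * u"] cos_ge_minus_one[of "x * u"] by (auto simp: power_mult_distrib)
      have "(1 - cos (x * u)) * (1 + u\<^sup>2) = (1 - cos (x * u)) + (1 - cos (x * u)) * u\<^sup>2"
        by (simp add: algebra_simps)
      also have "\<dots> \<le> x\<^sup>2 * u\<^sup>2 / 2 + 2 * u\<^sup>2"
        using c u by (intro add_mono mult_right_mono) auto
      also have "\<dots> \<le> (x\<^sup>2 + 4) * u\<^sup>2"
      proof -
        have "0 \<le> x\<^sup>2 * u\<^sup>2" by simp
        then show ?thesis using u unfolding distrib_right by linarith
      qed
      finally have "(1 - cos (x * u)) / u\<^sup>2 \<le> (x\<^sup>2 + 4) / (1 + u\<^sup>2)"
        using u by (simp add: divide_simps add_pos_pos)
      then show ?thesis using c by (simp add: abs_of_nonneg)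
    qed simp
  qed
qed measurable

text \<open>The factor in the representation of the absolute value as an integral of 1 - cos, from
  which piecewise linear functions get explicit transforms.\<close>

definition cos_constant :: real where
  "cos_constant = (LBINT u. (1 - cos u) / u\<^sup>2)"

text \<open>By scaling, so the value of the constant, which is \<open>pi\<close>, does not matter.\<close>

lemma integral_cos_kernel: "(LBINT u. (1 - cos (x * u)) / u\<^sup>2) = cos_constant * \<bar>x\<bar>"
proof (cases "x = 0")
  case False
  have "cos_constant = \<bar>x\<bar> *\<^sub>R (LBINT u. (1 - cos (0 + x * u)) / (0 + x * u)\<^sup>2)"
    unfolding cos_constant_def by (rule lborel_integral_real_affine[OF False])
  also have "\<dots> = (LBINT u. inverse \<bar>x\<bar> * ((1 - cos (x * u)) / u\<^sup>2))"
    unfolding integral_scaleR_right[symmetric]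
  proof (intro Bochner_Integration.integral_cong refl)
    fix u :: real
    have "(x * u)\<^sup>2 = \<bar>x\<bar> * (\<bar>x\<bar> * u\<^sup>2)" by (simp add: power_mult_distrib power2_eq_square)
    then show "\<bar>x\<bar> *\<^sub>R ((1 - cos (0 + x * u)) / (0 + x * u)\<^sup>2) = inverse \<bar>x\<bar> * ((1 - cos (x * u)) / u\<^sup>2)"
      using False by (simp add: divide_inverse)
  qed
  also have "\<dots> = inverse \<bar>x\<bar> * (LBINT u. (1 - cos (x * u)) / u\<^sup>2)" by (rule integral_mult_right_zero)
  finally show ?thesis using False by (simp add: field_simps)
qed simp

lemma cos_constant_pos: "0 < cos_constant"
proof -
  \<comment> \<open>On [1, 2] one has cos u \<le> cos 1 and u^2 \<le> 4, so the integrand is at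
    least this constant there.\<close>
  let ?d = "(1 - cos 1) / 4 :: real"
  have "cos (1::real) < cos 0" by (rule cos_monotone_0_pi) (use pi_gt3 in auto)
  then have d: "0 < ?d" by simp
  have i: "integrable lborel (\<lambda>u::real. ?d * indicator {1..2} u)" by simp
  have "(\<integral>u. ?d * indicator {1..2} u \<partial>(lborel :: real measure)) \<le> cos_constant"
    unfolding cos_constant_def
  proof (rule integral_mono[OF i])
    show "integrable lborel (\<lambda>u::real. (1 - cos u) / u\<^sup>2)" using cos_kernel_integrable[of 1] by simp
    show "?d * indicator {1..2} u \<le> (1 - cos u) / u\<^sup>2" for u :: real
    proof (cases "u \<in> {1..2}")
      case True
      have "cos u \<le> cos 1" by (rule cos_monotone_0_pi_le) (use True pi_gt3 in auto)
      moreover have "u\<^sup>2 \<le> 2\<^sup>2" by (rule power_mono) (use True in auto)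
      ultimately have "(1 - cos 1) / 4 \<le> (1 - cos u) / u\<^sup>2"
        using True d by (intro frac_le) auto
      then show ?thesis using True by simp
    qed simp
  qed
  then show ?thesis using d by simp
qed

definition tent :: "real \<Rightarrow> real \<Rightarrow> real \<Rightarrow> real" where
  "tent p w x = max 0 (w - \<bar>x - p\<bar>)"

text \<open>Symmetrising makes the transform a pure cosine transform. A tent has area w^2, so after
  the division each pair has mass 2, whatever its width.\<close>

definition tent_pair :: "real \<Rightarrow> real \<Rightarrow> real \<Rightarrow> real" where
  "tent_pair p w x = (tent p w x + tent (- p) w x) / w\<^sup>2"

text \<open>Proportional to \<xi>^2 times the transform of the pair, the form in which a second
  difference appears.\<close>

definition tent_freq :: "real \<Rightarrow> real \<Rightarrow> real \<Rightarrow> real" where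
  "tent_freq p w \<xi> = 2 * (1 - cos (w * \<xi>)) * cos (p * \<xi>) / w\<^sup>2"

text \<open>A tent is a second difference of the absolute value.\<close>

lemma integral_tent:
  assumes w: "0 < w"
  shows "has_bochner_integral lborel (\<lambda>\<xi>. 2 * (1 - cos (w * \<xi>)) * cos ((x - p) * \<xi>) / \<xi>\<^sup>2) (2 * (cos_constant * tent p w x))"
proof -
  let ?y = "x - p"
  have hb: "has_bochner_integral lborel (\<lambda>u. (1 - cos (y * u)) / u\<^sup>2) (cos_constant * \<bar>y\<bar>)" for y
    using cos_kernel_integrable[of y] integral_cos_kernel[of y] by (simp add: has_bochner_integral_iff)
  have t: "\<bar>?y + w\<bar> + \<bar>?y - w\<bar> - 2 * \<bar>?y\<bar> = 2 * tent p w x" using w by (simp add: tent_def abs_if)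
  have "has_bochner_integral lborel (\<lambda>\<xi>. ((1 - cos ((?y + w) * \<xi>)) / \<xi>\<^sup>2 + (1 - cos ((?y - w) * \<xi>)) / \<xi>\<^sup>2) - 2 * ((1 - cos (?y * \<xi>)) / \<xi>\<^sup>2))
    ((cos_constant * \<bar>?y + w\<bar> + cos_constant * \<bar>?y - w\<bar>) - 2 * (cos_constant * \<bar>?y\<bar>))"
    by (intro has_bochner_integral_diff has_bochner_integral_add has_bochner_integral_mult_right hb)
  also have "(cos_constant * \<bar>?y + w\<bar> + cos_constant * \<bar>?y - w\<bar>) - 2 * (cos_constant * \<bar>?y\<bar>) = cos_constant * (2 * tent p w x)"
    unfolding t[symmetric] by (simp add: algebra_simps)
  also have "(\<lambda>\<xi>. ((1 - cos ((?y + w) * \<xi>)) / \<xi>\<^sup>2 + (1 - cos ((?y - w) * \<xi>)) / \<xi>\<^sup>2) - 2 * ((1 - cos (?y * \<xi>)) / \<xi>\<^sup>2)) =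
      (\<lambda>\<xi>. 2 * (1 - cos (w * \<xi>)) * cos ((x - p) * \<xi>) / \<xi>\<^sup>2)"
  proof
    fix \<xi>
    have "cos ((?y + w) * \<xi>) + cos ((?y - w) * \<xi>) = 2 * cos (w * \<xi>) * cos (?y * \<xi>)"
      by (simp add: distrib_right left_diff_distrib[of _ w] cos_add cos_diff)
    then have "(1 - cos ((?y + w) * \<xi>)) + (1 - cos ((?y - w) * \<xi>)) - 2 * (1 - cos (?y * \<xi>)) =
        2 * (1 - cos (w * \<xi>)) * cos (?y * \<xi>)"
      by (simp add: algebra_simps)
    then show "((1 - cos ((?y + w) * \<xi>)) / \<xi>\<^sup>2 + (1 - cos ((?y - w) * \<xi>)) / \<xi>\<^sup>2) - 2 * ((1 - cos (?y * \<xi>)) / \<xi>\<^sup>2) =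
        2 * (1 - cos (w * \<xi>)) * cos (?y * \<xi>) / \<xi>\<^sup>2"
      by (simp add: add_divide_distrib[symmetric] diff_divide_distrib[symmetric])
  qed
  finally show ?thesis by (simp add: mult.left_commute)
qed

lemma integral_tent_pair:
  assumes w: "0 < w"
  shows "has_bochner_integral lborel (\<lambda>\<xi>. tent_freq p w \<xi> / \<xi>\<^sup>2 * cos (x * \<xi>)) (cos_constant * tent_pair p w x)"
proof -
  have "has_bochner_integral lborel (\<lambda>\<xi>. (1 / (2 * w\<^sup>2)) * (2 * (1 - cos (w * \<xi>)) * cos ((x - p) * \<xi>) / \<xi>\<^sup>2 +
      2 * (1 - cos (w * \<xi>)) * cos ((x - - p) * \<xi>) / \<xi>\<^sup>2))
    ((1 / (2 * w\<^sup>2)) * (2 * (cos_constant * tent p w x) + 2 * (cos_constant * tent (- p) w x)))"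
    by (intro has_bochner_integral_mult_right has_bochner_integral_add integral_tent w)
  also have "(1 / (2 * w\<^sup>2)) * (2 * (cos_constant * tent p w x) + 2 * (cos_constant * tent (- p) w x)) = cos_constant * tent_pair p w x"
    by (simp add: tent_pair_def algebra_simps add_divide_distrib)
  also have "(\<lambda>\<xi>. (1 / (2 * w\<^sup>2)) * (2 * (1 - cos (w * \<xi>)) * cos ((x - p) * \<xi>) / \<xi>\<^sup>2 +
      2 * (1 - cos (w * \<xi>)) * cos ((x - - p) * \<xi>) / \<xi>\<^sup>2)) = (\<lambda>\<xi>. tent_freq p w \<xi> / \<xi>\<^sup>2 * cos (x * \<xi>))"
  proof
    fix \<xi>
    have c: "cos ((x - p) * \<xi>) + cos ((x - - p) * \<xi>) = 2 * cos (p * \<xi>) * cos (x * \<xi>)"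
      by (simp add: distrib_right left_diff_distrib cos_add cos_diff)
    have "(1 / (2 * w\<^sup>2)) * (2 * (1 - cos (w * \<xi>)) * cos ((x - p) * \<xi>) / \<xi>\<^sup>2 + 2 * (1 - cos (w * \<xi>)) * cos ((x - - p) * \<xi>) / \<xi>\<^sup>2)
      = (1 / (2 * w\<^sup>2)) * (2 * (1 - cos (w * \<xi>)) * (cos ((x - p) * \<xi>) + cos ((x - - p) * \<xi>)) / \<xi>\<^sup>2)"
      by (simp only: distrib_left add_divide_distrib)
    then show "(1 / (2 * w\<^sup>2)) * (2 * (1 - cos (w * \<xi>)) * cos ((x - p) * \<xi>) / \<xi>\<^sup>2 + 2 * (1 - cos (w * \<xi>)) * cos ((x - - p) * \<xi>) / \<xi>\<^sup>2)
      = tent_freq p w \<xi> / \<xi>\<^sup>2 * cos (x * \<xi>)"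
      unfolding c by (simp add: tent_freq_def)
  qed
  finally show ?thesis .
qed

text \<open>Because of the common mass the leading term is \<xi>^2 for all p and w. The quartic
  error has a part w^2 / 12 from the width and a part p^2 / 2 from the displacement.\<close>

lemma tent_freq_bounds:
  assumes w: "0 < w"
  shows "\<bar>tent_freq p w \<xi>\<bar> \<le> 4 / w\<^sup>2" "\<bar>tent_freq p w \<xi> - \<xi>\<^sup>2\<bar> \<le> (w\<^sup>2 / 12 + p\<^sup>2 / 2) * \<xi> ^ 4"
proof -
  have c: "0 \<le> 1 - cos (w * \<xi>)" "1 - cos (w * \<xi>) \<le> 2" using cos_ge_minus_one[of "w * \<xi>"] by auto
  have "\<bar>(1 - cos (w * \<xi>)) * cos (p * \<xi>)\<bar> \<le> 2 * 1" unfolding abs_mult using c by (intro mult_mono) auto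
  then have "2 * \<bar>(1 - cos (w * \<xi>)) * cos (p * \<xi>)\<bar> / w\<^sup>2 \<le> 2 * (2 * 1) / w\<^sup>2"
    by (intro divide_right_mono mult_left_mono) auto
  moreover have "\<bar>tent_freq p w \<xi>\<bar> = 2 * \<bar>(1 - cos (w * \<xi>)) * cos (p * \<xi>)\<bar> / w\<^sup>2"
    unfolding tent_freq_def mult.assoc by (simp only: abs_divide abs_mult abs_numeral abs_power2)
  ultimately show "\<bar>tent_freq p w \<xi>\<bar> \<le> 4 / w\<^sup>2" by simp
  define a where "a = 2 * (1 - cos (w * \<xi>)) / w\<^sup>2"
  have e: "tent_freq p w \<xi> - \<xi>\<^sup>2 = (a - \<xi>\<^sup>2) + (a * (cos (p * \<xi>) - 1))"
    unfolding tent_freq_def a_def by (simp add: algebra_simps diff_divide_distrib)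
  have "\<bar>a - \<xi>\<^sup>2\<bar> = 2 / w\<^sup>2 * \<bar>1 - cos (w * \<xi>) - (w * \<xi>)\<^sup>2 / 2\<bar>"
  proof -
    have "a - \<xi>\<^sup>2 = 2 / w\<^sup>2 * (1 - cos (w * \<xi>) - (w * \<xi>)\<^sup>2 / 2)"
      unfolding a_def using w by (simp add: field_simps power2_eq_square)
    then show ?thesis by (simp only: abs_mult) simp
  qed
  also have "\<dots> \<le> 2 / w\<^sup>2 * ((w * \<xi>) ^ 4 / 24)"
    by (rule mult_left_mono[OF cos_quartic_bound]) simp
  also have "\<dots> = w\<^sup>2 / 12 * \<xi> ^ 4" using w by (simp add: field_simps power2_eq_square power4_eq_xxxx)
  finally have 1: "\<bar>a - \<xi>\<^sup>2\<bar> \<le> w\<^sup>2 / 12 * \<xi> ^ 4" .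
  have a: "0 \<le> a" "a \<le> \<xi>\<^sup>2"
    using c one_minus_cos_le[of "w * \<xi>"] w unfolding a_def by (auto simp: divide_simps power_mult_distrib mult_ac)
  have "\<bar>a * (cos (p * \<xi>) - 1)\<bar> = a * (1 - cos (p * \<xi>))" using a by (simp add: abs_mult)
  also have "\<dots> \<le> \<xi>\<^sup>2 * ((p * \<xi>)\<^sup>2 / 2)" using a one_minus_cos_le[of "p * \<xi>"] by (intro mult_mono) auto
  also have "\<dots> = p\<^sup>2 / 2 * \<xi> ^ 4" by (simp add: field_simps power2_eq_square power4_eq_xxxx)
  finally have 2: "\<bar>a * (cos (p * \<xi>) - 1)\<bar> \<le> p\<^sup>2 / 2 * \<xi> ^ 4" .
  show "\<bar>tent_freq p w \<xi> - \<xi>\<^sup>2\<bar> \<le> (w\<^sup>2 / 12 + p\<^sup>2 / 2) * \<xi> ^ 4"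
    unfolding e distrib_right using 1 2 abs_triangle_ineq[of "a - \<xi>\<^sup>2" "a * (cos (p * \<xi>) - 1)"] by linarith
qed

text \<open>Its density is the Green function of 1 minus the second derivative on the line.\<close>

definition laplace_law :: "real measure" where
  "laplace_law = density lborel (\<lambda>z. ennreal (exp (- \<bar>z\<bar>) / 2))"

text \<open>Adding 1 to the cosine keeps the integrand nonnegative, so the fundamental theorem for
  nonnegative integrands applies. The surplus is later removed by subtracting half of the case \<xi>
  = 0.\<close>

lemma integral_exp_cos_half:
  "has_bochner_integral lborel (\<lambda>z::real. indicator {0..} z * (exp (- z) * (1 + cos (\<xi> * z)))) (1 + 1 / (1 + \<xi>\<^sup>2))"
proof (rule has_bochner_integral_nn_integral)
  let ?G = "\<lambda>z. - exp (- z) + exp (- z) * (\<xi> * sin (\<xi> * z) - cos (\<xi> * z)) / (1 + \<xi>\<^sup>2)"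
  have pos: "0 < 1 + \<xi>\<^sup>2" by (rule add_pos_nonneg) auto
  have nn: "0 \<le> exp (- z) * (1 + cos (\<xi> * z))" for z
    using cos_ge_minus_one[of "\<xi> * z"] by (intro mult_nonneg_nonneg) (simp, linarith)
  have "(\<integral>\<^sup>+z. ennreal (exp (- z) * (1 + cos (\<xi> * z))) * indicator {0..} z \<partial>lborel) = ennreal (0 - ?G 0)"
  proof (rule nn_integral_FTC_atLeast)
    show "(?G has_real_derivative exp (- z) * (1 + cos (\<xi> * z))) (at z)" for z
    proof -
      have K: "((\<lambda>z. exp (- z) * (\<xi> * sin (\<xi> * z) - cos (\<xi> * z))) has_real_derivative exp (- z) * cos (\<xi> * z) * (1 + \<xi>\<^sup>2)) (at z)"
        by (auto intro!: derivative_eq_intros simp: algebra_simps power2_eq_square)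
      have nz: "1 + \<xi>\<^sup>2 \<noteq> 0" using pos by simp
      have L: "((\<lambda>z. - exp (- z)) has_real_derivative exp (- z)) (at z)"
        by (auto intro!: derivative_eq_intros)
      have "exp (- z) + exp (- z) * cos (\<xi> * z) * (1 + \<xi>\<^sup>2) / (1 + \<xi>\<^sup>2) = exp (- z) * (1 + cos (\<xi> * z))"
        unfolding nonzero_mult_div_cancel_right[OF nz] by (simp add: distrib_left)
      then show ?thesis using DERIV_add[OF L DERIV_cdivide[OF K, of "1 + \<xi>\<^sup>2"]] by (simp only:)
    qed
    have e0: "((\<lambda>z::real. exp (- z)) \<longlongrightarrow> 0) at_top" by real_asymp
    have "((\<lambda>z. exp (- z) * (\<xi> * sin (\<xi> * z) - cos (\<xi> * z))) \<longlongrightarrow> 0) at_top"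
    proof (rule Lim_null_comparison)
      show "\<forall>\<^sub>F z in at_top. norm (exp (- z) * (\<xi> * sin (\<xi> * z) - cos (\<xi> * z))) \<le> exp (- z) * (\<bar>\<xi>\<bar> + 1)"
      proof (intro always_eventually allI)
        fix z :: real
        have "\<bar>\<xi> * sin (\<xi> * z)\<bar> \<le> \<bar>\<xi>\<bar> * 1" unfolding abs_mult by (intro mult_left_mono) auto
        then have "\<bar>\<xi> * sin (\<xi> * z) - cos (\<xi> * z)\<bar> \<le> \<bar>\<xi>\<bar> + 1" using abs_cos_le_one[of "\<xi> * z"] by linarith
        then show "norm (exp (- z) * (\<xi> * sin (\<xi> * z) - cos (\<xi> * z))) \<le> exp (- z) * (\<bar>\<xi>\<bar> + 1)"
          by (simp add: abs_mult)
      qed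
      show "((\<lambda>z. exp (- z) * (\<bar>\<xi>\<bar> + 1)) \<longlongrightarrow> 0) at_top" by (rule tendsto_mult_left_zero[OF e0])
    qed
    then have "(?G \<longlongrightarrow> - 0 + 0 / (1 + \<xi>\<^sup>2)) at_top" using pos by (intro tendsto_intros e0) auto
    then show "(?G \<longlongrightarrow> 0) at_top" by simp
  qed (use nn in auto)
  also have "0 - ?G 0 = 1 + 1 / (1 + \<xi>\<^sup>2)" by simp
  finally show "(\<integral>\<^sup>+z. ennreal (indicator {0..} z * (exp (- z) * (1 + cos (\<xi> * z)))) \<partial>lborel) = ennreal (1 + 1 / (1 + \<xi>\<^sup>2))"
    by (simp add: indicator_mult_ennreal mult.commute)
  show "AE z in lborel. 0 \<le> indicator {0..} z * (exp (- z) * (1 + cos (\<xi> * z)))" using nn by auto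
qed (auto intro: add_nonneg_nonneg)

lemma integral_exp_abs_cos:
  "has_bochner_integral lborel (\<lambda>z::real. exp (- \<bar>z\<bar>) / 2 * (1 + cos (\<xi> * z))) (1 + 1 / (1 + \<xi>\<^sup>2))"
proof -
  let ?g = "\<lambda>z::real. indicator {0..} z * (exp (- z) * (1 + cos (\<xi> * z)))"
  note h = integral_exp_cos_half[of \<xi>]
  have r: "has_bochner_integral lborel (\<lambda>z. ?g (- z)) (1 + 1 / (1 + \<xi>\<^sup>2))"
    using lborel_has_bochner_integral_real_affine_iff[of "-1" ?g "1 + 1 / (1 + \<xi>\<^sup>2)" 0] h by simp
  have "has_bochner_integral lborel (\<lambda>z. (1 / 2) * (?g z + ?g (- z))) ((1 / 2) * ((1 + 1 / (1 + \<xi>\<^sup>2)) + (1 + 1 / (1 + \<xi>\<^sup>2))))"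
    by (intro has_bochner_integral_mult_right has_bochner_integral_add h r)
  moreover have "(1 / 2) * (a + a) = a" for a :: real by simp
  ultimately have "has_bochner_integral lborel (\<lambda>z. (1 / 2) * (?g z + ?g (- z))) (1 + 1 / (1 + \<xi>\<^sup>2))" by (simp only:)
  moreover have "AE z in lborel. (1 / 2) * (?g z + ?g (- z)) = exp (- \<bar>z\<bar>) / 2 * (1 + cos (\<xi> * z))"
    using AE_lborel_singleton[of 0] by eventually_elim (auto simp: indicator_def)
  ultimately show ?thesis
    by (subst has_bochner_integral_cong_AE[symmetric]) auto
qed

lemma laplace_law_cos:
  "has_bochner_integral lborel (\<lambda>z::real. exp (- \<bar>z\<bar>) / 2 * cos (\<xi> * z)) (1 / (1 + \<xi>\<^sup>2))"
proof -
  have 1: "has_bochner_integral lborel (\<lambda>z::real. (1 / 2) * (exp (- \<bar>z\<bar>) / 2 * (1 + cos (0 * z)))) ((1 / 2) * (1 + 1 / (1 + 0\<^sup>2)))"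
    by (intro has_bochner_integral_mult_right integral_exp_abs_cos)
  have "has_bochner_integral lborel (\<lambda>z::real. exp (- \<bar>z\<bar>) / 2 * (1 + cos (\<xi> * z)) - (1 / 2) * (exp (- \<bar>z\<bar>) / 2 * (1 + cos (0 * z))))
    ((1 + 1 / (1 + \<xi>\<^sup>2)) - (1 / 2) * (1 + 1 / (1 + 0\<^sup>2)))"
    by (intro has_bochner_integral_diff integral_exp_abs_cos 1)
  then show ?thesis by (simp add: algebra_simps add_divide_distrib)
qed

lemma prob_space_laplace_law: "prob_space laplace_law"
proof
  have hb: "has_bochner_integral lborel (\<lambda>z::real. exp (- \<bar>z\<bar>) / 2) 1"
    using laplace_law_cos[of 0] by simp
  have "emeasure laplace_law (space laplace_law) = (\<integral>\<^sup>+z. ennreal (exp (- \<bar>z\<bar>) / 2) \<partial>lborel)"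
    unfolding laplace_law_def by (subst emeasure_density) auto
  also have "\<dots> = ennreal 1"
    using hb by (subst nn_integral_eq_integral) (auto simp: has_bochner_integral_iff)
  finally show "emeasure laplace_law (space laplace_law) = 1" by simp
qed

lemma integral_laplace_law:
  fixes g :: "real \<Rightarrow> real"
  assumes [measurable]: "g \<in> borel_measurable borel"
  shows "(LINT z|laplace_law. g z) = (LBINT z. exp (- \<bar>z\<bar>) / 2 * g z)"
  unfolding laplace_law_def by (subst integral_density) auto

lemma laplace_law_shift: "(LINT z|laplace_law. cos ((x - z) * \<xi>)) = cos (x * \<xi>) / (1 + \<xi>\<^sup>2)"
proof -
  have s: "(LBINT z. exp (- \<bar>z\<bar>) / 2 * sin (\<xi> * z)) = 0"
    using lborel_integral_real_affine[of "-1" "\<lambda>z. exp (- \<bar>z\<bar>) / 2 * sin (\<xi> * z)" 0] by simp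
  have ic: "integrable lborel (\<lambda>z::real. exp (- \<bar>z\<bar>) / 2 * cos (\<xi> * z))" for \<xi>
    using laplace_law_cos by (rule integrable.intros)
  have isn: "integrable lborel (\<lambda>z::real. exp (- \<bar>z\<bar>) / 2 * sin (\<xi> * z))"
    by (rule Bochner_Integration.integrable_bound[OF ic[of 0]]) (auto simp: abs_mult mult_left_le)
  have "(LINT z|laplace_law. cos ((x - z) * \<xi>)) = (LBINT z. exp (- \<bar>z\<bar>) / 2 * cos ((x - z) * \<xi>))"
    by (rule integral_laplace_law) measurable
  also have "\<dots> = (LBINT z. cos (x * \<xi>) * (exp (- \<bar>z\<bar>) / 2 * cos (\<xi> * z)) + sin (x * \<xi>) * (exp (- \<bar>z\<bar>) / 2 * sin (\<xi> * z)))"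
    by (intro Bochner_Integration.integral_cong refl) (simp add: left_diff_distrib cos_diff algebra_simps)
  also have "\<dots> = cos (x * \<xi>) / (1 + \<xi>\<^sup>2)"
    unfolding Bochner_Integration.integral_add[OF integrable_mult_right[OF ic] integrable_mult_right[OF isn]]
      integral_mult_right_zero s has_bochner_integral_integral_eq[OF laplace_law_cos] by simp
  finally show ?thesis .
qed

lemma sets_laplace_law [measurable_cong]: "sets laplace_law = sets borel"
  by (simp add: laplace_law_def)

section \<open>Tents smoothed by the Laplace law\<close>

lemma tent_bounds: "0 \<le> tent p w x" "0 < w \<Longrightarrow> tent p w x \<le> w"
  by (auto simp: tent_def)

lemma tent_pair_nonneg: "0 \<le> tent_pair p w x"
  unfolding tent_pair_def using tent_bounds(1) by simp

lemma tent_pair_le: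
  assumes "0 < w"
  shows "tent_pair p w x \<le> 2 / w"
proof -
  have "tent_pair p w x \<le> (w + w) / w\<^sup>2"
    unfolding tent_pair_def by (intro divide_right_mono add_mono tent_bounds assms) auto
  also have "\<dots> = 2 / w" using assms by (simp add: power2_eq_square)
  finally show ?thesis .
qed

lemma tent_pair_measurable [measurable]: "tent_pair p w \<in> borel_measurable borel"
  unfolding tent_pair_def tent_def by measurable

lemma tent_pair_inside: "\<bar>x\<bar> \<le> r \<Longrightarrow> tent_pair (r + w) w x = 0"
  by (auto simp: tent_pair_def tent_def)

lemma tent_freq_measurable [measurable]: "tent_freq p w \<in> borel_measurable borel"
  unfolding tent_freq_def by measurable

lemma levy_scaled_measurable [measurable]: "scaled_exponent n \<in> borel_measurable borel"
proof -
  note [measurable] = levy_exponent_measurable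
  show ?thesis unfolding scaled_exponent_def by measurable
qed

text \<open>The bounded solution v of v - v'' = \<open>tent_pair p w\<close>, that is, the solution
  of the limit problem with this source.\<close>

definition smoothed :: "real \<Rightarrow> real \<Rightarrow> real \<Rightarrow> real" where
  "smoothed p w x = (LINT z|laplace_law. tent_pair p w (x - z))"

lemma smoothed_integrable:
  assumes "0 < w"
  shows "integrable laplace_law (\<lambda>z. tent_pair p w (x - z))"
proof -
  interpret prob_space laplace_law by (rule prob_space_laplace_law)
  show ?thesis
    by (rule integrable_const_bound[where B="2 / w"]) (use tent_pair_le[OF assms] tent_pair_nonneg in auto)
qed

lemma smoothed_bounds:
  assumes "0 < w"
  shows "0 \<le> smoothed p w x" "smoothed p w x \<le> 2 / w"
proof -
  interpret prob_space laplace_law by (rule prob_space_laplace_law)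
  show "0 \<le> smoothed p w x"
    unfolding smoothed_def by (intro integral_nonneg_AE) (simp add: tent_pair_nonneg)
  have "smoothed p w x \<le> (LINT z|laplace_law. 2 / w)"
    unfolding smoothed_def by (intro integral_mono smoothed_integrable assms tent_pair_le) simp
  then show "smoothed p w x \<le> 2 / w" by (simp add: prob_space)
qed

text \<open>From 0 the tents are reached only with r \<le> \<bar>z\<bar> \<le> r + 2. There the
  density is at most exp (- r) / 2 and the pair at most 2, and the two intervals have total length
  4.\<close>

lemma smoothed_0_le:
  assumes r: "0 < r"
  shows "smoothed (r + 1) 1 0 \<le> 4 * exp (- r)"
proof -
  let ?g = "\<lambda>z. exp (- \<bar>z\<bar>) / 2 * tent_pair (r + 1) 1 (0 - z)"
  let ?k = "\<lambda>z. exp (- r) * (indicator {r..r + 2} z + indicator {- r - 2..- r} z)"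
  have "smoothed (r + 1) 1 0 = (LBINT z. ?g z)"
    unfolding smoothed_def by (rule integral_laplace_law) measurable
  also have "\<dots> \<le> (LBINT z. ?k z)"
  proof (rule integral_mono')
    show "integrable lborel ?k" by simp
    fix z :: real
    have t: "tent_pair (r + 1) 1 (0 - z) \<le> 2" using tent_pair_le[of 1 "r + 1" "0 - z"] by simp
    show "?g z \<le> ?k z"
    proof (cases "r \<le> \<bar>z\<bar> \<and> \<bar>z\<bar> \<le> r + 2")
      case True
      have "?g z \<le> exp (- r) / 2 * 2"
        using True t tent_pair_nonneg by (intro mult_mono divide_right_mono) auto
      also have "\<dots> \<le> ?k z" using True by (auto simp: indicator_def)
      finally show ?thesis .
    next
      case False
      then have "1 \<le> \<bar>0 - z - (r + 1)\<bar>" "1 \<le> \<bar>0 - z - - (r + 1)\<bar>" using r by linarith+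
      then have "tent_pair (r + 1) 1 (0 - z) = 0" unfolding tent_pair_def tent_def by simp
      then show ?thesis by simp
    qed
    show "0 \<le> ?k z" by (auto simp: indicator_def)
  qed
  also have "\<dots> = 4 * exp (- r)" using r by simp
  finally show ?thesis .
qed

text \<open>Only z in an interval of length 1 are used, those for which x - z is within 1/2 of the
  centre r + 1 of the right tent. There the tent is at least 1/2 and the density at least exp (x - r
  - 3/2) / 2.\<close>

lemma smoothed_ge:
  assumes x: "0 \<le> x" "x \<le> r"
  shows "exp (x - r - 3 / 2) / 4 \<le> smoothed (r + 1) 1 x"
proof -
  let ?g = "\<lambda>z. exp (- \<bar>z\<bar>) / 2 * tent_pair (r + 1) 1 (x - z)"
  let ?k = "\<lambda>z. exp (x - r - 3 / 2) / 4 * indicator {x - r - 3 / 2..x - r - 1 / 2} z"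
  have "exp (x - r - 3 / 2) / 4 = (LBINT z. ?k z)" by simp
  also have "\<dots> \<le> (LBINT z. ?g z)"
  proof (rule integral_mono)
    show "integrable lborel ?k" by simp
    show "integrable lborel ?g"
      using smoothed_integrable[OF zero_less_one, of "r + 1" x] unfolding laplace_law_def
      by (subst (asm) integrable_density) auto
    show "?k z \<le> ?g z" for z
    proof (cases "z \<in> {x - r - 3 / 2..x - r - 1 / 2}")
      case True
      then have z: "x - r - 3 / 2 \<le> z" "z \<le> x - r - 1 / 2" by auto
      have "1 / 2 \<le> tent (r + 1) 1 (x - z)" using z by (auto simp: tent_def abs_if)
      then have t: "1 / 2 \<le> tent_pair (r + 1) 1 (x - z)"
        unfolding tent_pair_def using tent_bounds(1)[of "- (r + 1)" 1 "x - z"] by simp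
      have "exp (x - r - 3 / 2) / 2 * (1 / 2) \<le> ?g z"
        using z x t by (intro mult_mono divide_right_mono) auto
      then show ?thesis using True by simp
    next
      case False
      then show ?thesis using tent_pair_nonneg[of "r + 1" 1 "x - z"] by simp
    qed
  qed
  also have "\<dots> = smoothed (r + 1) 1 x"
    unfolding smoothed_def by (rule integral_laplace_law[symmetric]) measurable
  finally show ?thesis .
qed

text \<open>Convolution with the Laplace law divides the transform by 1 + \<xi>^2; the interchange
  of integrals rests on integrability of the tent transform.\<close>

lemma smoothed_fourier:
  assumes w: "0 < w"
  shows "has_bochner_integral lborel (\<lambda>\<xi>. tent_freq p w \<xi> / \<xi>\<^sup>2 / (1 + \<xi>\<^sup>2) * cos (\<xi> * x)) (cos_constant * smoothed p w x)"
proof -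
  interpret prob_space laplace_law by (rule prob_space_laplace_law)
  have i0: "integrable lborel (\<lambda>\<xi>. tent_freq p w \<xi> / \<xi>\<^sup>2)"
    using integral_tent_pair[OF w, of p 0] by (simp add: has_bochner_integral_iff)
  have "(LINT z|laplace_law. (LBINT \<xi>. tent_freq p w \<xi> / \<xi>\<^sup>2 * cos ((x - z) * \<xi>))) =
      (LBINT \<xi>. tent_freq p w \<xi> / \<xi>\<^sup>2 * (LINT z|laplace_law. cos ((x - z) * \<xi>)))"
  proof (rule integral_bounded_swap(1)[OF i0, where C=1])
    have "(\<lambda>(z, \<xi>). cos ((x - z) * \<xi>)) \<in> borel_measurable (borel \<Otimes>\<^sub>M lborel)" by measurable
    then show "(\<lambda>(z, \<xi>). cos ((x - z) * \<xi>)) \<in> borel_measurable (laplace_law \<Otimes>\<^sub>M lborel)"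
      using measurable_cong_sets[OF sets_pair_measure_cong[OF sets_laplace_law refl] refl] by blast
  qed simp
  also have "\<dots> = (LBINT \<xi>. tent_freq p w \<xi> / \<xi>\<^sup>2 / (1 + \<xi>\<^sup>2) * cos (\<xi> * x))"
    unfolding laplace_law_shift by (intro Bochner_Integration.integral_cong refl) (simp add: mult.commute)
  also have "(LINT z|laplace_law. (LBINT \<xi>. tent_freq p w \<xi> / \<xi>\<^sup>2 * cos ((x - z) * \<xi>))) =
      (LINT z|laplace_law. cos_constant * tent_pair p w (x - z))"
    using has_bochner_integral_integral_eq[OF integral_tent_pair[OF w]] by simp
  finally have eq: "(LBINT \<xi>. tent_freq p w \<xi> / \<xi>\<^sup>2 / (1 + \<xi>\<^sup>2) * cos (\<xi> * x)) = cos_constant * smoothed p w x"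
    by (simp add: smoothed_def)
  have "integrable lborel (\<lambda>\<xi>. tent_freq p w \<xi> / \<xi>\<^sup>2 / (1 + \<xi>\<^sup>2) * cos (\<xi> * x))"
  proof (rule Bochner_Integration.integrable_bound[OF i0])
    show "AE \<xi> in lborel. norm (tent_freq p w \<xi> / \<xi>\<^sup>2 / (1 + \<xi>\<^sup>2) * cos (\<xi> * x)) \<le> norm (tent_freq p w \<xi> / \<xi>\<^sup>2)"
    proof (intro AE_I2)
      fix \<xi> :: real
      have p: "1 \<le> 1 + \<xi>\<^sup>2" by simp
      have "\<bar>tent_freq p w \<xi> / \<xi>\<^sup>2\<bar> / (1 + \<xi>\<^sup>2) \<le> \<bar>tent_freq p w \<xi> / \<xi>\<^sup>2\<bar> / 1"
        by (intro divide_left_mono) (auto intro: add_pos_nonneg)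
      then have "\<bar>tent_freq p w \<xi> / \<xi>\<^sup>2\<bar> / (1 + \<xi>\<^sup>2) * \<bar>cos (\<xi> * x)\<bar> \<le> \<bar>tent_freq p w \<xi> / \<xi>\<^sup>2\<bar> * 1"
        using p by (intro mult_mono) auto
      then show "norm (tent_freq p w \<xi> / \<xi>\<^sup>2 / (1 + \<xi>\<^sup>2) * cos (\<xi> * x)) \<le> norm (tent_freq p w \<xi> / \<xi>\<^sup>2)"
        using p by (simp add: abs_mult)
    qed
  qed measurable
  then show ?thesis using eq by (simp add: has_bochner_integral_iff)
qed

text \<open>The transforms of two normalised pairs of tents agree to second order at 0.  This makes their difference
  integrable against the reciprocal of the exponent, which is of order \<open>1 / \<xi>\<^sup>2\<close> there.\<close>

lemma tent_difference_bound:
  assumes w: "0 < w" and v: "0 < v"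
  shows "\<exists>K\<ge>0. \<forall>\<xi>. \<bar>tent_freq p w \<xi> - tent_freq q v \<xi>\<bar> \<le> K * (min 1 (\<xi>\<^sup>2))\<^sup>2"
proof -
  define K where "K = (4 / w\<^sup>2 + 4 / v\<^sup>2) + ((w\<^sup>2 / 12 + p\<^sup>2 / 2) + (v\<^sup>2 / 12 + q\<^sup>2 / 2))"
  have K: "0 \<le> 4 / w\<^sup>2 + 4 / v\<^sup>2" "0 \<le> (w\<^sup>2 / 12 + p\<^sup>2 / 2) + (v\<^sup>2 / 12 + q\<^sup>2 / 2)" by auto
  have "\<bar>tent_freq p w \<xi> - tent_freq q v \<xi>\<bar> \<le> K * (min 1 (\<xi>\<^sup>2))\<^sup>2" for \<xi>
  proof (cases "\<xi>\<^sup>2 \<le> 1")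
    case True
    then have m: "(min 1 (\<xi>\<^sup>2))\<^sup>2 = \<xi> ^ 4" by (simp flip: power_mult)
    have "\<bar>tent_freq p w \<xi> - tent_freq q v \<xi>\<bar> \<le> (w\<^sup>2 / 12 + p\<^sup>2 / 2) * \<xi> ^ 4 + (v\<^sup>2 / 12 + q\<^sup>2 / 2) * \<xi> ^ 4"
      using tent_freq_bounds(2)[OF w, of p \<xi>] tent_freq_bounds(2)[OF v, of q \<xi>] by linarith
    also have "\<dots> = ((w\<^sup>2 / 12 + p\<^sup>2 / 2) + (v\<^sup>2 / 12 + q\<^sup>2 / 2)) * \<xi> ^ 4" by (simp only: distrib_right)
    also have "\<dots> \<le> K * \<xi> ^ 4" using K by (intro mult_right_mono) (auto simp: K_def)
    finally show ?thesis unfolding m .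
  next
    case False
    have "\<bar>tent_freq p w \<xi> - tent_freq q v \<xi>\<bar> \<le> 4 / w\<^sup>2 + 4 / v\<^sup>2"
      using tent_freq_bounds(1)[OF w, of p \<xi>] tent_freq_bounds(1)[OF v, of q \<xi>] by linarith
    also have "\<dots> \<le> K" using K by (simp add: K_def)
    finally show ?thesis using False by simp
  qed
  moreover have "0 \<le> K" using K by (simp add: K_def)
  ultimately show ?thesis by blast
qed

text \<open>One factor min 1 \<xi>^2 cancels the lower bound of the exponent. The other, divided by
  \<xi>^2, is at most 2 / (1 + \<xi>^2), which is integrable.\<close>

lemma quotient_bound:
  fixes N P K \<xi> :: real
  assumes N: "\<bar>N\<bar> \<le> K * (min 1 (\<xi>\<^sup>2))\<^sup>2" and P: "min 1 (\<xi>\<^sup>2) / 6 \<le> P" and K: "0 \<le> K"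
  shows "\<bar>N / \<xi>\<^sup>2 / P\<bar> \<le> 12 * K / (1 + \<xi>\<^sup>2)"
proof (cases "\<xi> = 0")
  case False
  let ?m = "min 1 (\<xi>\<^sup>2)"
  have x: "0 < \<xi>\<^sup>2" using False by simp
  then have m: "0 < ?m" by simp
  have "0 < P" using P m by linarith
  then have "\<bar>N / \<xi>\<^sup>2 / P\<bar> = \<bar>N\<bar> / \<xi>\<^sup>2 / P" by (simp add: abs_mult)
  also have "\<dots> \<le> K * ?m\<^sup>2 / \<xi>\<^sup>2 / (?m / 6)"
    using N P m x K by (intro frac_le divide_right_mono) auto
  also have "\<dots> = 6 * K * (?m / \<xi>\<^sup>2)" using m by (simp add: power2_eq_square)
  also have "\<dots> \<le> 6 * K * (2 / (1 + \<xi>\<^sup>2))"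
  proof (rule mult_left_mono)
    have "?m * 1 \<le> \<xi>\<^sup>2" "?m * \<xi>\<^sup>2 \<le> 1 * \<xi>\<^sup>2" using x by (auto intro: mult_right_mono)
    then have "?m * (1 + \<xi>\<^sup>2) \<le> 2 * \<xi>\<^sup>2" unfolding distrib_left by linarith
    then show "?m / \<xi>\<^sup>2 \<le> 2 / (1 + \<xi>\<^sup>2)" using x by (simp add: divide_simps add_pos_pos)
  qed (use K in simp)
  finally show ?thesis by simp
qed (use K in simp)

text \<open>The narrow tents next to the endpoints of \<open>[- r, r]\<close> are the sources of the test function.  The pair
  of width \<open>exp r\<close> makes the total mass zero and is so flat that the constant \<open>3 * exp (- r)\<close> compensates its
  negative contribution.\<close>

lemma killed_diffusion_test_function:
  assumes r: "0 < r"
  obtains n \<rho> where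
    "integrable lborel \<rho>" "integrable lborel (\<lambda>\<xi>. \<rho> \<xi> * scaled_exponent n \<xi>)"
    "\<And>x. \<bar>x\<bar> \<le> r \<Longrightarrow> (LBINT \<xi>. \<rho> \<xi> * scaled_exponent n \<xi> * cos (\<xi> * x)) = 0"
    "\<And>x. 0 \<le> 3 * exp (- r) + (LBINT \<xi>. \<rho> \<xi> * cos (\<xi> * x))"
    "3 * exp (- r) + (LBINT \<xi>. \<rho> \<xi> * cos (\<xi> * 0)) \<le> 8 * exp (- r)"
    "\<And>x. 0 \<le> x \<Longrightarrow> x \<le> r \<Longrightarrow> exp (x - r - 3 / 2) / 4 \<le> 3 * exp (- r) + (LBINT \<xi>. \<rho> \<xi> * cos (\<xi> * x))"
proof -
  \<comment> \<open>Smoothed, the wide pair is at most 2 / W = 2 exp (- r). The third exp (- r) in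
    the constant absorbs the error of the limit.\<close>
  define W where "W = exp r"
  have W: "0 < W" and iW: "1 / W = exp (- r)" by (simp_all add: W_def exp_minus divide_inverse)
  define N where "N = (\<lambda>\<xi>. tent_freq (r + 1) 1 \<xi> - tent_freq (r + W) W \<xi>)"
  note cc = cos_constant_pos
  obtain K where K: "0 \<le> K" "\<And>\<xi>. \<bar>N \<xi>\<bar> \<le> K * (min 1 (\<xi>\<^sup>2))\<^sup>2"
    using tent_difference_bound[OF zero_less_one W, of "r + 1" "r + W"] unfolding N_def by blast
  have Nm [measurable]: "N \<in> borel_measurable borel" unfolding N_def by measurable
  \<comment> \<open>The density of the potential for the rescaled exponent; \<open>\<rho>'\<close>
    is its counterpart for the limit exponent. A common \<open>k\<close> dominates both for all
    n.\<close>
  define \<rho> where "\<rho> = (\<lambda>n \<xi>. N \<xi> / \<xi>\<^sup>2 / scaled_exponent n \<xi> / cos_constant)"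
  define \<rho>' where "\<rho>' = (\<lambda>\<xi>. N \<xi> / \<xi>\<^sup>2 / (1 + \<xi>\<^sup>2) / cos_constant)"
  define k where "k = (\<lambda>\<xi>. (12 * K / cos_constant) / (1 + \<xi>\<^sup>2))"
  have ki: "integrable lborel k" unfolding k_def by (rule integrable_cauchy_kernel)
  have \<rho>m [measurable]: "\<rho> n \<in> borel_measurable lborel" for n unfolding \<rho>_def by measurable
  have \<rho>'m [measurable]: "\<rho>' \<in> borel_measurable lborel" unfolding \<rho>'_def by measurable
  have \<rho>b: "\<bar>\<rho> n \<xi>\<bar> \<le> k \<xi>" for n \<xi>
    using divide_right_mono[OF quotient_bound[OF K(2) scaled_exponent_ge K(1), of \<xi> n] less_imp_le[OF cc]]
    unfolding \<rho>_def k_def abs_divide[of _ cos_constant] abs_of_pos[OF cc] by (simp add: mult.commute)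
  have \<rho>'b: "\<bar>\<rho>' \<xi>\<bar> \<le> k \<xi>" for \<xi>
  proof -
    have "min 1 (\<xi>\<^sup>2) / 6 \<le> 1 + \<xi>\<^sup>2" using zero_le_power2[of \<xi>] by (simp add: min_def)
    from divide_right_mono[OF quotient_bound[OF K(2) this K(1)] less_imp_le[OF cc]]
    show ?thesis unfolding \<rho>'_def k_def abs_divide[of _ cos_constant] abs_of_pos[OF cc] by (simp add: mult.commute)
  qed
  have k0: "0 \<le> k \<xi>" for \<xi> using \<rho>'b[of \<xi>] by linarith
  have \<rho>i: "integrable lborel (\<rho> n)" for n
    by (rule Bochner_Integration.integrable_bound[OF ki]) (use \<rho>b k0 in auto)
  have \<rho>'i: "integrable lborel \<rho>'"
    by (rule Bochner_Integration.integrable_bound[OF ki]) (use \<rho>'b k0 in auto)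
  have lim: "(\<lambda>n. \<integral>\<xi>. \<bar>\<rho> n \<xi> - \<rho>' \<xi>\<bar> \<partial>lborel) \<longlonglongrightarrow> (\<integral>\<xi>. 0 \<partial>(lborel :: real measure))"
  proof (rule integral_dominated_convergence[where w="\<lambda>\<xi>. 2 * k \<xi>"])
    show "AE \<xi> in lborel. (\<lambda>n. \<bar>\<rho> n \<xi> - \<rho>' \<xi>\<bar>) \<longlonglongrightarrow> 0"
    proof (intro AE_I2)
      fix \<xi> :: real
      show "(\<lambda>n. \<bar>\<rho> n \<xi> - \<rho>' \<xi>\<bar>) \<longlonglongrightarrow> 0"
      \<comment> \<open>At \<xi> = 0, where the exponents do not converge to 1 + \<xi>^2, both
        densities are 0 because division by 0 gives 0.\<close>
      proof (cases "\<xi> = 0")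
        case False
        have "1 + \<xi>\<^sup>2 \<noteq> 0" by (metis add_pos_nonneg less_irrefl zero_le_power2 zero_less_one)
        then have "(\<lambda>n. \<rho> n \<xi>) \<longlonglongrightarrow> \<rho>' \<xi>"
          unfolding \<rho>_def \<rho>'_def using cc
          by (intro tendsto_divide tendsto_const scaled_exponent_tendsto False) auto
        then have "(\<lambda>n. \<bar>\<rho> n \<xi> - \<rho>' \<xi>\<bar>) \<longlonglongrightarrow> \<bar>\<rho>' \<xi> - \<rho>' \<xi>\<bar>" by (intro tendsto_intros)
        then show ?thesis by simp
      qed (simp add: \<rho>_def \<rho>'_def)
    qed
    show "AE \<xi> in lborel. norm \<bar>\<rho> n \<xi> - \<rho>' \<xi>\<bar> \<le> 2 * k \<xi>" for n
    proof (intro AE_I2)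
      fix \<xi>
      show "norm \<bar>\<rho> n \<xi> - \<rho>' \<xi>\<bar> \<le> 2 * k \<xi>" using \<rho>b[of n \<xi>] \<rho>'b[of \<xi>] by simp
    qed
    show "integrable lborel (\<lambda>\<xi>. 2 * k \<xi>)" using ki by simp
  qed measurable
  then have "\<forall>\<^sub>F n in sequentially. (LBINT \<xi>. \<bar>\<rho> n \<xi> - \<rho>' \<xi>\<bar>) < 1 / W"
    by (rule order_tendstoD) (use W in simp)
  then obtain n where n: "(LBINT \<xi>. \<bar>\<rho> n \<xi> - \<rho>' \<xi>\<bar>) < 1 / W"
    using eventually_happens trivial_limit_sequentially by blast
  have ci: "integrable lborel (\<lambda>\<xi>. g \<xi> * cos (\<xi> * x))" if "integrable lborel g" for g and x :: real
    by (rule Bochner_Integration.integrable_bound[OF that]) (use that in \<open>auto simp: abs_mult mult_left_le\<close>)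
  have close: "\<bar>(LBINT \<xi>. \<rho> n \<xi> * cos (\<xi> * x)) - (LBINT \<xi>. \<rho>' \<xi> * cos (\<xi> * x))\<bar> \<le> 1 / W" for x
  proof -
    have "(LBINT \<xi>. \<rho> n \<xi> * cos (\<xi> * x)) - (LBINT \<xi>. \<rho>' \<xi> * cos (\<xi> * x)) =
      (LBINT \<xi>. (\<rho> n \<xi> - \<rho>' \<xi>) * cos (\<xi> * x))"
      unfolding left_diff_distrib by (rule Bochner_Integration.integral_diff[symmetric]) (intro ci \<rho>i \<rho>'i)+
    also have "norm \<dots> \<le> (LBINT \<xi>. norm ((\<rho> n \<xi> - \<rho>' \<xi>) * cos (\<xi> * x)))"
      by (rule integral_norm_bound)
    also have "\<dots> \<le> (LBINT \<xi>. \<bar>\<rho> n \<xi> - \<rho>' \<xi>\<bar>)"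
      by (intro integral_mono integrable_norm ci Bochner_Integration.integrable_diff \<rho>i \<rho>'i integrable_abs)
        (auto simp: abs_mult mult_left_le)
    finally show ?thesis using n by simp
  qed
  have limval: "(LBINT \<xi>. \<rho>' \<xi> * cos (\<xi> * x)) = smoothed (r + 1) 1 x - smoothed (r + W) W x" for x
  proof -
    have "has_bochner_integral lborel (\<lambda>\<xi>. (1 / cos_constant) * (tent_freq (r + 1) 1 \<xi> / \<xi>\<^sup>2 / (1 + \<xi>\<^sup>2) * cos (\<xi> * x)
        - tent_freq (r + W) W \<xi> / \<xi>\<^sup>2 / (1 + \<xi>\<^sup>2) * cos (\<xi> * x)))
      ((1 / cos_constant) * (cos_constant * smoothed (r + 1) 1 x - cos_constant * smoothed (r + W) W x))"
      by (intro has_bochner_integral_mult_right has_bochner_integral_diff smoothed_fourier W zero_less_one)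
    also have "(1 / cos_constant) * (cos_constant * smoothed (r + 1) 1 x - cos_constant * smoothed (r + W) W x)
        = smoothed (r + 1) 1 x - smoothed (r + W) W x"
      using cc by (simp add: diff_divide_distrib)
    also have "(\<lambda>\<xi>. (1 / cos_constant) * (tent_freq (r + 1) 1 \<xi> / \<xi>\<^sup>2 / (1 + \<xi>\<^sup>2) * cos (\<xi> * x)
        - tent_freq (r + W) W \<xi> / \<xi>\<^sup>2 / (1 + \<xi>\<^sup>2) * cos (\<xi> * x))) = (\<lambda>\<xi>. \<rho>' \<xi> * cos (\<xi> * x))"
      unfolding \<rho>'_def N_def by (simp add: diff_divide_distrib left_diff_distrib)
    finally show ?thesis by (rule has_bochner_integral_integral_eq)
  qed
  have low: "smoothed (r + 1) 1 x \<le> 3 * exp (- r) + (LBINT \<xi>. \<rho> n \<xi> * cos (\<xi> * x))" for x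
    using close[of x] smoothed_bounds(2)[OF W, of "r + W" x] unfolding limval iW[symmetric] by simp
  have \<rho>\<Psi>: "\<rho> n \<xi> * scaled_exponent n \<xi> = (1 / cos_constant) * (N \<xi> / \<xi>\<^sup>2)" for \<xi>
  proof (cases "\<xi> = 0")
    case False
    then have "0 < min 1 (\<xi>\<^sup>2) / 6" by simp
    then have "scaled_exponent n \<xi> \<noteq> 0" using scaled_exponent_ge[of \<xi> n] by linarith
    then show ?thesis by (simp add: \<rho>_def)
  qed (simp add: \<rho>_def)
  have Nint: "has_bochner_integral lborel (\<lambda>\<xi>. \<rho> n \<xi> * scaled_exponent n \<xi> * cos (\<xi> * x))
      ((1 / cos_constant) * (cos_constant * tent_pair (r + 1) 1 x - cos_constant * tent_pair (r + W) W x))" for x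
  proof -
    have "has_bochner_integral lborel (\<lambda>\<xi>. (1 / cos_constant) * (tent_freq (r + 1) 1 \<xi> / \<xi>\<^sup>2 * cos (x * \<xi>)
        - tent_freq (r + W) W \<xi> / \<xi>\<^sup>2 * cos (x * \<xi>)))
      ((1 / cos_constant) * (cos_constant * tent_pair (r + 1) 1 x - cos_constant * tent_pair (r + W) W x))"
      by (intro has_bochner_integral_mult_right has_bochner_integral_diff integral_tent_pair W zero_less_one)
    also have "(\<lambda>\<xi>. (1 / cos_constant) * (tent_freq (r + 1) 1 \<xi> / \<xi>\<^sup>2 * cos (x * \<xi>)
        - tent_freq (r + W) W \<xi> / \<xi>\<^sup>2 * cos (x * \<xi>))) = (\<lambda>\<xi>. \<rho> n \<xi> * scaled_exponent n \<xi> * cos (\<xi> * x))"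
      unfolding \<rho>\<Psi> N_def by (simp add: diff_divide_distrib left_diff_distrib right_diff_distrib mult.commute)
    finally show ?thesis .
  qed
  show thesis
  proof (rule that[of "\<rho> n" n])
    show "integrable lborel (\<rho> n)" by (rule \<rho>i)
    show "integrable lborel (\<lambda>\<xi>. \<rho> n \<xi> * scaled_exponent n \<xi>)"
      using Nint[of 0] by (simp add: has_bochner_integral_iff)
    show "(LBINT \<xi>. \<rho> n \<xi> * scaled_exponent n \<xi> * cos (\<xi> * x)) = 0" if "\<bar>x\<bar> \<le> r" for x
      using has_bochner_integral_integral_eq[OF Nint[of x]] tent_pair_inside[OF that] by simp
    show "0 \<le> 3 * exp (- r) + (LBINT \<xi>. \<rho> n \<xi> * cos (\<xi> * x))" for x
      using low[of x] smoothed_bounds(1)[of 1 "r + 1" x] by linarith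
    \<comment> \<open>The 8 is 3 from the constant, 1 from the error of the limit and 4 from the
      smoothed narrow pair at 0; the wide pair only lowers the value.\<close>
    show "3 * exp (- r) + (LBINT \<xi>. \<rho> n \<xi> * cos (\<xi> * 0)) \<le> 8 * exp (- r)"
      using close[of 0] smoothed_bounds(1)[OF W, of "r + W" 0] smoothed_0_le[OF r] unfolding limval iW by linarith
    show "exp (x - r - 3 / 2) / 4 \<le> 3 * exp (- r) + (LBINT \<xi>. \<rho> n \<xi> * cos (\<xi> * x))" if "0 \<le> x" "x \<le> r" for x
      using low[of x] smoothed_ge[OF that] by linarith
  qed
qed

section \<open>Failure of the Harnack inequality\<close>

theorem theorem6p7:
  fixes P :: "'v::euclidean_space \<Rightarrow> 'a measure"
    and S :: "real \<Rightarrow> 'a \<Rightarrow> real"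
    and B :: "real \<Rightarrow> 'a \<Rightarrow> 'v"
    and X :: "real \<Rightarrow> 'a \<Rightarrow> 'v"
  assumes "\<And>x. prob_space (P x)"
    and "\<And>x. subordinator (P x) S"
    and "\<And>x. zero_drift_Levy_measure (P x) S Levy_mu"
    and "\<And>x. double_speed_BM (P x) x B"
    and "\<And>x. indep_processes (P x) S B"
    and "\<And>t w. X t w = B (S t w) w"
  shows "\<not> EHI P X"
proof
  assume "EHI P X"
  then obtain C \<kappa> where C: "1 \<le> C" and \<kappa>: "0 < \<kappa>" "\<kappa> < 1"
    and ehi: "\<And>x0 r h x y. 0 < r \<Longrightarrow> (\<And>y. 0 \<le> h y) \<Longrightarrow> harmonic P X (ball x0 r) h \<Longrightarrow>
      x \<in> ball x0 (\<kappa> * r) \<Longrightarrow> y \<in> ball x0 (\<kappa> * r) \<Longrightarrow> h x \<le> C * h y"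
    unfolding EHI_def by blast
  obtain b :: 'v where b: "b \<in> Basis" using nonempty_Basis by blast
  \<comment> \<open>This gives \<kappa> r / 2 = ln (32 C) + 2. The 32 is the product of the 4 and
    the 8 in the bounds of h off and at the centre, and 2 exceeds the loss 3/2 by 1/2, which leaves
    a factor exp (1/2) to spare.\<close>
  define r where "r = 2 / \<kappa> * (ln (32 * C) + 2)"
  have lnC: "0 \<le> ln (32 * C)" using C by simp
  have r: "0 < r" unfolding r_def using \<kappa> lnC by (intro mult_pos_pos add_nonneg_pos) auto
  obtain n \<rho> where \<rho>: "integrable lborel \<rho>" "integrable lborel (\<lambda>\<xi>. \<rho> \<xi> * scaled_exponent n \<xi>)"
    and zero: "\<And>x. \<bar>x\<bar> \<le> r \<Longrightarrow> (LBINT \<xi>. \<rho> \<xi> * scaled_exponent n \<xi> * cos (\<xi> * x)) = 0"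
    and nonneg: "\<And>x. 0 \<le> 3 * exp (- r) + (LBINT \<xi>. \<rho> \<xi> * cos (\<xi> * x))"
    and centre: "3 * exp (- r) + (LBINT \<xi>. \<rho> \<xi> * cos (\<xi> * 0)) \<le> 8 * exp (- r)"
    and large: "\<And>x. 0 \<le> x \<Longrightarrow> x \<le> r \<Longrightarrow> exp (x - r - 3 / 2) / 4 \<le> 3 * exp (- r) + (LBINT \<xi>. \<rho> \<xi> * cos (\<xi> * x))"
    by (rule killed_diffusion_test_function[OF r]) blast
  \<comment> \<open>The ratio between rescaled and original lengths at stage n: radius r in rescaled
    units is r / s for X.\<close>
  define s where "s = sqrt (2 ^ ((Suc n)\<^sup>2 + (Suc (Suc n))\<^sup>2))"
  have s: "0 < s" by (simp add: s_def)
  have s2: "(\<xi> * s)\<^sup>2 = \<xi>\<^sup>2 * 2 ^ ((Suc n)\<^sup>2 + (Suc (Suc n))\<^sup>2)" for \<xi>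
    by (simp add: s_def power_mult_distrib)
  define h where "h = (\<lambda>y::'v. 3 * exp (- r) + (LBINT \<xi>. \<rho> \<xi> * cos (\<xi> * s * (y \<bullet> b))))"
  \<comment> \<open>Undoing the change of the time scale costs a constant factor, which does not
    affect the vanishing of the generator.\<close>
  have lev: "\<rho> \<xi> * levy_exponent ((\<xi> * s)\<^sup>2) = 2 ^ (Suc n)\<^sup>2 * (\<rho> \<xi> * scaled_exponent n \<xi>)" for \<xi>
    unfolding s2 by (simp add: scaled_exponent_def)
  have sub: "subordination (P x) S B x levy_exponent" for x
  proof -
    interpret prob_space "P x" by (rule assms(1))
    show ?thesis
    proof
      show "(\<integral>w. exp (- l * S t w) \<partial>P x) = exp (- t * levy_exponent l)" if "0 < l" "0 < t" for l t
        using assms(3)[of x, unfolded zero_drift_Levy_measure_def, rule_format, OF that]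
        unfolding Levy_mu_exponent[OF that(1)] .
    qed (rule assms levy_exponent_0)+
  qed
  have "harmonic P X (ball 0 (r / s)) h"
    unfolding harmonic_def
  proof (intro allI impI)
    fix U :: "'v set" and x :: 'v
    assume U: "open U \<and> compact (closure U) \<and> closure U \<subseteq> ball 0 (r / s)"
    then have U': "open U" "bounded U" using compact_imp_bounded bounded_subset closure_subset by blast+
    have z: "(LBINT \<xi>. \<rho> \<xi> * levy_exponent ((\<xi> * s)\<^sup>2) * cos (\<xi> * s * (y \<bullet> b))) = 0" if "y \<in> U" for y
    proof -
      have "norm y < r / s" using that U closure_subset[of U] by auto
      then have "\<bar>y \<bullet> b\<bar> < r / s" using Basis_le_norm[OF b, of y] by linarith
      then have "\<bar>s * (y \<bullet> b)\<bar> \<le> r" using s by (simp add: abs_mult field_simps)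
      from zero[OF this] show ?thesis by (simp add: lev mult.assoc)
    qed
    have \<rho>\<phi>: "integrable lborel (\<lambda>\<xi>. \<rho> \<xi> * levy_exponent ((\<xi> * s)\<^sup>2))"
      unfolding lev by (rule integrable_mult_right[OF \<rho>(2)])
    have \<omega>: "(\<lambda>\<xi>. \<xi> * s) \<in> borel_measurable borel" by measurable
    have h': "h y = 3 * exp (- r) + (LBINT \<xi>. \<rho> \<xi> * cos (\<xi> * s * (y \<bullet> b)))" for y
      by (simp add: h_def)
    note E = exit_integral_cos_transform[OF sub assms(6) levy_exponent_nonneg levy_exponent_pos
        levy_exponent_measurable U' b \<rho>(1) \<omega> \<rho>\<phi> h' z, of x]
    show "integrable (completion (P x)) (\<lambda>w. h (X (exit_time X U w) w)) \<and>
        h x = (\<integral>w. h (X (exit_time X U w) w) \<partial>completion (P x))"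
      using E by simp
  qed
  moreover have "0 \<le> h y" for y using nonneg[of "s * (y \<bullet> b)"] by (simp add: h_def mult.assoc)
  \<comment> \<open>Half of the admissible radius keeps the point inside the open ball; its rescaled
    coordinate is \<kappa> r / 2.\<close>
  moreover have "(\<kappa> * r / (2 * s)) *\<^sub>R b \<in> ball 0 (\<kappa> * (r / s))"
    using \<kappa> r s b by (simp add: divide_simps)
  moreover have "0 \<in> ball (0::'v) (\<kappa> * (r / s))" using \<kappa> r s by simp
  ultimately have "h ((\<kappa> * r / (2 * s)) *\<^sub>R b) \<le> C * h 0"
    using r s by (intro ehi[of "r / s" h 0]) auto
  moreover have "C * h 0 \<le> C * (8 * exp (- r))"
    using centre C by (intro mult_left_mono) (auto simp: h_def)
  moreover have "exp (\<kappa> * r / 2 - r - 3 / 2) / 4 \<le> h ((\<kappa> * r / (2 * s)) *\<^sub>R b)"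
  proof -
    have "\<kappa> * r \<le> 1 * r" using \<kappa> r by (intro mult_right_mono) auto
    then have "exp (\<kappa> * r / 2 - r - 3 / 2) / 4 \<le> 3 * exp (- r) + (LBINT \<xi>. \<rho> \<xi> * cos (\<xi> * (\<kappa> * r / 2)))"
      using \<kappa> r by (intro large) auto
    also have "\<dots> = h ((\<kappa> * r / (2 * s)) *\<^sub>R b)"
      using s b by (simp add: h_def)
    finally show ?thesis .
  qed
  ultimately have "exp (\<kappa> * r / 2 - r - 3 / 2) / 4 \<le> C * (8 * exp (- r))" by linarith
  moreover have "\<kappa> * r / 2 - r - 3 / 2 = (ln (32 * C) + 1 / 2) + (- r)"
  proof -
    have "\<kappa> * r = 2 * (ln (32 * C) + 2)" using \<kappa> by (simp add: r_def)
    moreover have "a / 2 - r - 3 / 2 = (L + 1 / 2) + (- r)" if "a = 2 * (L + 2)" for a L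
      using that by argo
    ultimately show ?thesis by blast
  qed
  ultimately have "exp (ln (32 * C) + 1 / 2) * exp (- r) \<le> 32 * C * exp (- r)"
    by (simp only: exp_add[of _ "- r"])
  then have "exp (ln (32 * C) + 1 / 2) \<le> 32 * C" by simp
  then show False using C by (simp add: exp_add)
qed

end
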